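(* Let $\delta>0$ and let $b$ be an integer sufficiently large in terms of $\delta$. Fix $a_0\in\{0,\dots,b-1\}$, let $\mathcal{A}$ be the set of non-negative integers none of whose base-$b$ digits equals $a_0$, and $\mathcal{A}_r=\{n\in\mathcal{A}:n\equiv r\ (\mathrm{mod}\ b)\}$. Let $k$ be a positive integer, $X=b^k$, and $D\in[1,X^{1/2})$. Let $r\in\mathcal{A}\cap[0,b)$ with $(r,b)=1$ and let $s$ be a positive integer with $(r-s,b)=1$. Let $\mathfrak{f}$ be an arithmetic function supported on integers coprime to $b$ with $|\mathfrak{f}(n)|\ll\log n$. Let $\sigma$ be an arithmetic function supported on $[1,D]$ with $|\sigma|\le\tau$, and for each $d$ in its support let $c_d$ be a reduced residue class modulo $d$. Assume: (a) for any $y\in[X^{3/4},X]$, any $A>0$ and any integer $d\in[1,X)$ there is a parameter $\lambda_d$ with $|\lambda_d|\ll\log X$ such that $\sum_{n\le y,(n,d)=1}\mathfrak{f}(n)=y\lambda_d+O_{A,b}(y/(\log y)^A)$; (b) for any $A,C>0$, \[\sum_{\substack{d\le D\\(d,b)=1}}\ \sum_{\substack{q\le(\log X)^C\\ q\mid X}}\max_{(c,d)=1}\max_{(m,q)=1}\max_{X^{3/4}\le y\le X}\Bigg|\sum_{\substack{n\le y\\ n\equiv c\ (d)\\ n\equiv m\ (q)}}\mathfrak{f}(n)-\frac{y\lambda_d}{\varphi(dq)}\Bigg|\ll_{A,C,b}\frac{X}{(\log X)^A};\] (c) for some $\omega\in(0,1)$ with $\alpha_b<\omega/2$ there is an absolute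 constant $C'>0$ such that for every $\theta=a/q+\beta$ with $(a,q)=1$, $|\beta|<1/q^2$, $H=1+|\beta|X$, $qH\in[1,X]$, \[\sum_{\substack{d\le D\\(d,b)=1}}\sigma(d)\sum_{\substack{n<X\\ n\equiv c_d\ (\mathrm{mod}\ d)}}\mathfrak{f}(n)e(n\theta)\ll_{b,\delta,\omega}X\Big(\frac{(qH)^\omega}{X^\omega}+\frac1{(qH)^\omega}\Big)(\log X)^{C'}.\] Then for any $A>0$, \[\sum_{\substack{d\le D\\(d,b)=1}}\sigma(d)\Bigg(\sum_{\substack{n<X\\ n\equiv c_d\ (\mathrm{mod}\ d)}}\mathfrak{f}(n)1_{\mathcal{A}_r}(n+s)-\frac{\lambda_d}{\varphi(d)}\frac{b}{\varphi(b)}\sum_{n<X}1_{\mathcal{A}_r}(n)\Bigg)\ll\frac{X^\zeta}{(\log X)^A},\] with $\zeta=\log(b-1)/\log b$ and implied constant depending at most on $A,b,\delta,\omega$.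
   Context: $\tau$ is the divisor function; $e(y)=e^{2\pi iy}$. $\alpha_b=\log\big(C_b\frac{b\log b}{b-1}\big)/\log b$, where $C_b\in[1/\log b,1+3/\log b]$ is the constant (depending only on $b$) in Maynard's $L^1$ bound $\sum_{0\le t<b^k}|\widehat{1}_{\mathcal{A}_r}(t/b^k)|\ll(C_bb\log b)^k$, with $\widehat{1}_{\mathcal{A}_r}(\theta)=\sum_{n<b^k}1_{\mathcal{A}_r}(n)e(n\theta)$; in particular $\alpha_b\to0$ as $b\to\infty$.
   Formalization: The implied constant may also depend on the fixed positive integer s; uniformity in s is false as written, e.g. for s = a_0 b^k with a_0 ≥ 1, where n+s always contains the digit a_0 for n < X. *)

theory Defs
  imports "HOL-Analysis.Analysis" "HOL-Number_Theory.Number_Theory"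
begin

definition e :: "real \<Rightarrow> complex" where
  "e y = exp (2 * of_real pi * \<i> * of_real y)"

definition divisor_fun :: "nat \<Rightarrow> nat" where
  "divisor_fun n = card {d. d dvd n}"

text \<open>
  The digits of the base-b expansion without leading zeros; the number 0 has the single
  digit 0. Leading zeros must not be counted, since the forbidden digit may be 0.
\<close>
definition digit_set :: "nat \<Rightarrow> nat \<Rightarrow> nat set" where
  "digit_set b n = {n div b ^ i mod b | i. i = 0 \<or> b ^ i \<le> n}"

definition missing_digit :: "nat \<Rightarrow> nat \<Rightarrow> nat set" where
  "missing_digit b a\<^sub>0 = {n. a\<^sub>0 \<notin> digit_set b n}"

definition missing_digit_class :: "nat \<Rightarrow> nat \<Rightarrow> nat \<Rightarrow> nat set" where
  "missing_digit_class b a\<^sub>0 r = {n \<in> missing_digit b a\<^sub>0. [n = r] (mod b)}"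

definition missing_digit_hat :: "nat \<Rightarrow> nat \<Rightarrow> nat \<Rightarrow> nat \<Rightarrow> real \<Rightarrow> complex" where
  "missing_digit_hat b a\<^sub>0 r k \<theta> =
     (\<Sum>n<b ^ k. indicator (missing_digit_class b a\<^sub>0 r) n * e (real n * \<theta>))"

text \<open>
  \<open>C\<close> is an admissible value of the constant \<open>C\<^sub>b\<close> in Maynard's \<open>L\<^sup>1\<close> bound: it depends on
  \<open>b\<close> only, so the same \<open>C\<close> serves every forbidden digit and every residue.
\<close>
definition L1_constant :: "nat \<Rightarrow> real \<Rightarrow> bool" where
  "L1_constant b C \<longleftrightarrow>
     1 / ln (real b) \<le> C \<and> C \<le> 1 + 3 / ln (real b) \<and>
     (\<exists>K. \<forall>a\<^sub>0<b. \<forall>r<b. \<forall>k\<ge>1. r \<in> missing_digit b a\<^sub>0 \<longrightarrow> coprime r b \<longrightarrow>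
        (\<Sum>t<b ^ k. norm (missing_digit_hat b a\<^sub>0 r k (real t / real (b ^ k))))
          \<le> K * (C * real b * ln (real b)) ^ k)"

definition alpha :: "nat \<Rightarrow> real \<Rightarrow> real" where
  "alpha b C = ln (C * (real b * ln (real b) / (real b - 1))) / ln (real b)"

definition zeta_exp :: "nat \<Rightarrow> real" where
  "zeta_exp b = ln (real b - 1) / ln (real b)"

definition moduli :: "nat \<Rightarrow> real \<Rightarrow> nat set" where
  "moduli b D = {d. 1 \<le> d \<and> real d \<le> D \<and> coprime d b}"

text \<open>
  In the three hypotheses below the numbers and functions \<open>K\<close> are the implied constants.
  They are explicit parameters so that the final implied constant can be required not to
  depend on \<open>X\<close>, \<open>D\<close>, \<open>f\<close>, \<open>\<sigma>\<close>, \<open>c\<close> and \<open>lam\<close>, all of which may vary together.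
\<close>

definition mean_value_hyp ::
    "nat \<Rightarrow> (nat \<Rightarrow> complex) \<Rightarrow> (nat \<Rightarrow> complex) \<Rightarrow> real \<Rightarrow> (real \<Rightarrow> real) \<Rightarrow> bool" where
  "mean_value_hyp X f lam K\<^sub>l K \<longleftrightarrow>
     (\<forall>d. 1 \<le> d \<and> d < X \<longrightarrow>
        norm (lam d) \<le> K\<^sub>l * ln (real X) \<and>
        (\<forall>A>0. \<forall>y::real. real X powr (3/4) \<le> y \<and> y \<le> real X \<longrightarrow>
           norm ((\<Sum>n | 1 \<le> n \<and> real n \<le> y \<and> coprime n d. f n) - of_real y * lam d)
             \<le> K A * (y / ln y powr A)))"

text \<open>
  A supremum in \<open>y\<close>: the quantity jumps at integers and need not attain a maximum.
  It is bounded on the interval, so the real supremum is the genuine one.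
\<close>
definition progression_error ::
    "nat \<Rightarrow> (nat \<Rightarrow> complex) \<Rightarrow> (nat \<Rightarrow> complex) \<Rightarrow> nat \<Rightarrow> nat \<Rightarrow> real" where
  "progression_error X f lam d q =
     (MAX c\<in>{c. c < d \<and> coprime c d}. MAX m\<in>{m. m < q \<and> coprime m q}.
        SUP y\<in>{real X powr (3/4)..real X}.
          norm ((\<Sum>n | 1 \<le> n \<and> real n \<le> y \<and> [n = c] (mod d) \<and> [n = m] (mod q). f n)
                - of_real y * lam d / of_nat (totient (d * q))))"

definition level_of_distribution_hyp ::
    "nat \<Rightarrow> nat \<Rightarrow> real \<Rightarrow> (nat \<Rightarrow> complex) \<Rightarrow> (nat \<Rightarrow> complex) \<Rightarrow>
     (real \<Rightarrow> real \<Rightarrow> real) \<Rightarrow> bool" where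
  "level_of_distribution_hyp b X D f lam K \<longleftrightarrow>
     (\<forall>A>0. \<forall>C>0.
        (\<Sum>d\<in>moduli b D. \<Sum>q | q dvd X \<and> real q \<le> ln (real X) powr C.
           progression_error X f lam d q)
          \<le> K A C * (real X / ln (real X) powr A))"

definition exponential_sum_hyp ::
    "nat \<Rightarrow> nat \<Rightarrow> real \<Rightarrow> (nat \<Rightarrow> complex) \<Rightarrow> (nat \<Rightarrow> complex) \<Rightarrow> (nat \<Rightarrow> nat) \<Rightarrow>
     real \<Rightarrow> real \<Rightarrow> real \<Rightarrow> bool" where
  "exponential_sum_hyp b X D f \<sigma> c \<omega> C' K \<longleftrightarrow>
     (\<forall>(\<theta>::real) (a::int) (q::nat) (\<beta>::real) (H::real).
        q \<ge> 1 \<and> coprime a (int q) \<and> \<theta> = real_of_int a / real q + \<beta> \<and>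
        \<bar>\<beta>\<bar> < 1 / (real q)\<^sup>2 \<and> H = 1 + \<bar>\<beta>\<bar> * real X \<and>
        1 \<le> real q * H \<and> real q * H \<le> real X \<longrightarrow>
        norm (\<Sum>d\<in>moduli b D. \<sigma> d *
                (\<Sum>n | n < X \<and> [n = c d] (mod d). f n * e (real n * \<theta>)))
          \<le> K * (real X *
               ((real q * H) powr \<omega> / real X powr \<omega> + 1 / (real q * H) powr \<omega>) *
               ln (real X) powr C'))"

end

(*
  The discrepancy is expanded into additive characters mod X = b^k: it is the average over t mod X
  of the Fourier coefficient of the digit set at t/X against the exponential sum of f minus its
  expected value on integers prime to b.

  The Fourier coefficients of the digit set factor over the digits, so the L1 bound at the points
  u/b^j, applied to the low digits at spaced fractions a/q and to the high digits at the points
  t/X in one cluster around a/q, bounds the sum of the coefficients over all t/X close to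
  fractions with q H of size S by (b-1)^k S^(2 alpha) up to powers of log X.  The exponential sum
  hypothesis saves S^omega there, and 2 alpha < omega, so the t with S above a large power of log X
  are negligible.  For the remaining few t, either q does not divide X, and then every block of
  about sqrt k digits contains one at which the Fourier factor is smaller by a fixed proportion,
  or q divides X, and the level of distribution together with partial summation applies.
*)
theory Submission
  imports Defs
begin

section \<open>The additive character\<close>

text \<open>Fractions with denominators near \<open>b ^ i\<close> are only about
  \<open>b ^ (- 2 i)\<close> apart, so summing over them spends about 2 i low digits on the L1
  bound, and a cluster of radius \<open>b ^ l\<close> spends l high digits. Each such digit costs
  \<open>b powr alpha\<close>, so the loss is \<open>q^2 H\<close> to the power \<alpha>, at most
  \<open>(q H) powr (2 \<alpha>)\<close>; this is where \<alpha> < \<omega> / 2 comes from. The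
  forbidden digit 0 spoils the factorisation: zeros may pad a number on the left but not occur
  inside it, so the coefficient is a sum of partial products of all lengths. Products of every
  length are therefore estimated, at the cost of one factor k. The expected value is put on the n
  prime to b because its transform then lives on the multiples of \<open>b ^ (k - 1)\<close>. These
  t are all near fractions with small denominator; elsewhere only f is left and the exponential sum
  hypothesis applies directly. Since ln X lies between k and b k, the cut-off R is a power of k.
  Blocks of length J near sqrt k serve two needs: one block has to resolve denominators up to R,
  that is \<open>2 R^2 \<le> b ^ J\<close>, while the number of blocks has to outgrow log k.\<close>

lemma e_eq_cis: "e y = cis (2 * pi * y)"
  by (simp add: e_def cis_conv_exp mult_ac)

lemma e_zero [simp]: "e 0 = 1"
  by (simp add: e_eq_cis)

lemma e_add: "e (x + y) = e x * e y"
  by (simp add: e_eq_cis cis_mult distrib_left)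

lemma norm_e [simp]: "norm (e x) = 1"
  by (simp add: e_eq_cis)

lemma e_of_nat_mult: "e (real n * x) = e x ^ n"
  by (simp add: e_eq_cis Complex.DeMoivre mult_ac)

lemma e_of_int [simp]: "e (of_int n) = 1"
  using cis_multiple_2pi[of "of_int n"] by (simp add: e_eq_cis)

lemma e_add_of_int [simp]: "e (x + of_int n) = e x"
  by (simp add: e_add)

lemma e_frac: "e (frac x) = e x"
  using e_add_of_int[of "frac x" "\<lfloor>x\<rfloor>"] by (simp add: frac_def)

lemma e_eq_1_iff: "e x = 1 \<longleftrightarrow> x \<in> \<int>"
proof
  assume "e x = 1"
  then obtain n :: int where "2 * pi * x = of_int (2 * n) * pi"
    unfolding e_eq_cis cis_conv_exp exp_eq_1 by auto
  then have "x = of_int n" by simp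
  then show "x \<in> \<int>" by simp
next
  assume "x \<in> \<int>"
  then show "e x = 1" by (auto elim: Ints_cases)
qed

lemma norm_one_minus_e: "norm (1 - e y) = 2 * \<bar>sin (pi * y)\<bar>"
proof -
  have "norm (1 - e y) ^ 2 = (1 - cos (2 * (pi * y)))^2 + sin (2 * (pi * y))^2"
    by (simp add: e_eq_cis cmod_power2 mult_ac)
  also have "\<dots> = 2 - 2 * cos (2 * (pi * y))"
    using sin_cos_squared_add[of "2 * (pi * y)"] by (simp add: power2_diff)
  also have "\<dots> = (2 * \<bar>sin (pi * y)\<bar>)^2"
    by (simp add: cos_double_sin power_mult_distrib)
  finally show ?thesis
    by (rule power2_eq_imp_eq) auto
qed

lemma norm_one_plus_e: "norm (1 + e y) = 2 * \<bar>cos (pi * y)\<bar>"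
proof -
  have "norm (1 + e y) ^ 2 = (1 + cos (2 * (pi * y)))^2 + sin (2 * (pi * y))^2"
    by (simp add: e_eq_cis cmod_power2 mult_ac)
  also have "\<dots> = 2 + 2 * cos (2 * (pi * y))"
    using sin_cos_squared_add[of "2 * (pi * y)"] by (simp add: power2_sum)
  also have "\<dots> = (2 * \<bar>cos (pi * y)\<bar>)^2"
    by (simp add: cos_double_cos power_mult_distrib)
  finally show ?thesis
    by (rule power2_eq_imp_eq) auto
qed

lemma norm_one_minus_e_le: "norm (1 - e y) \<le> 2 * pi * \<bar>y\<bar>"
  using abs_sin_x_le_abs_x[of "pi * y"] by (simp add: norm_one_minus_e abs_mult)

text \<open>Jordan's inequality: the sine is concave on this interval and so lies above its
  chord.\<close>

lemma sin_ge_linear: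
  fixes x :: real
  assumes "0 \<le> x" "x \<le> pi / 2"
  shows "2 * x / pi \<le> sin x"
proof -
  have "convex_on {0..pi/2} (\<lambda>x. - sin x)"
  proof (rule f''_ge0_imp_convex)
    show "convex {0..pi/2}" by simp
  next
    fix x :: real
    show "((\<lambda>x. - sin x) has_real_derivative (- cos x)) (at x)"
      by (auto intro!: derivative_eq_intros)
    show "((\<lambda>x. - cos x) has_real_derivative sin x) (at x)"
      by (auto intro!: derivative_eq_intros)
    assume "x \<in> {0..pi/2}"
    then show "0 \<le> sin x" by (intro sin_ge_zero) auto
  qed
  from convex_onD[OF this, of "2 * x / pi" 0 "pi/2"] assms
  show ?thesis by (simp add: field_simps)
qed

text \<open>\<open>min y (1 - y)\<close> is the distance from y to the nearest integer; Jordan's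
  inequality is applied on the nearer side.\<close>

lemma norm_one_minus_e_ge:
  assumes "0 \<le> y" "y \<le> 1"
  shows "4 * min y (1 - y) \<le> norm (1 - e y)"
proof -
  have *: "2 * y \<le> sin (pi * y)" if "0 \<le> y" "y \<le> 1/2" for y :: real
    using sin_ge_linear[of "pi * y"] that by (simp add: field_simps)
  show ?thesis
  proof (cases "y \<le> 1/2")
    case True
    with assms *[of y] show ?thesis by (simp add: norm_one_minus_e min_def)
  next
    case False
    have "sin (pi * y) = sin (pi * (1 - y))"
      using sin_pi_minus[of "pi * y"] by (simp add: algebra_simps)
    with False assms *[of "1 - y"] show ?thesis by (simp add: norm_one_minus_e min_def)
  qed
qed

text \<open>The usual bound \<open>1 / (2 * min y (1 - y))\<close> for a geometric sum. The minimum
  is traded for two reciprocals so that summing over a grid later gives two harmonic sums.\<close>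

lemma norm_geometric_e_le:
  assumes "0 < y" "y < 1"
  shows "norm (\<Sum>n<N. e (real n * y)) \<le> (1 / y + 1 / (1 - y)) / 2"
proof -
  have m: "0 < min y (1 - y)" using assms by simp
  have ne: "e y \<noteq> 1" using assms by (auto simp: e_eq_1_iff elim!: Ints_cases)
  have "norm (\<Sum>n<N. e (real n * y)) = norm (1 - e y ^ N) / norm (1 - e y)"
    using ne by (simp add: e_of_nat_mult sum_gp_strict norm_divide)
  also have "\<dots> \<le> 2 / (4 * min y (1 - y))"
  proof (rule frac_le)
    show "norm (1 - e y ^ N) \<le> 2"
      using norm_triangle_ineq4[of 1 "e y ^ N"] by (simp add: norm_power)
  qed (use m norm_one_minus_e_ge[of y] assms in auto)
  also have "\<dots> = (1 / min y (1 - y)) / 2" by simp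
  also have "1 / min y (1 - y) \<le> 1 / y + 1 / (1 - y)"
    using assms by (auto simp: min_def)
  finally show ?thesis by simp
qed

lemma sum_e_orthogonality:
  assumes "N > 0"
  shows "(\<Sum>u<N. e (real u * (of_int m / real N))) = (if int N dvd m then of_nat N else 0)"
proof (cases "int N dvd m")
  case True
  then obtain j where j: "m = int N * j" by auto
  have "e (real u * (of_int m / real N)) = 1" for u
  proof -
    have "real u * (of_int m / real N) = of_int (int u * j)"
      using assms by (simp add: j field_simps)
    then show ?thesis by (metis e_of_int)
  qed
  with True show ?thesis by simp
next
  case False
  have ne: "e (of_int m / real N) \<noteq> 1"
  proof
    assume "e (of_int m / real N) = 1"
    then obtain j :: int where "of_int m / real N = of_int j"
      by (auto simp: e_eq_1_iff elim: Ints_cases)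
    then have "real_of_int m = of_int (j * int N)" using assms by (simp add: field_simps)
    then have "m = j * int N" by (simp only: of_int_eq_iff)
    with False show False by simp
  qed
  have "e (of_int m / real N) ^ N = 1"
    using assms by (simp flip: e_of_nat_mult)
  then show ?thesis using ne False
    by (simp only: e_of_nat_mult sum_gp_strict) simp
qed

section \<open>Exponential sums over missing digits\<close>

definition digit_sum :: "nat \<Rightarrow> nat \<Rightarrow> real \<Rightarrow> complex" where
  "digit_sum b a0 x = (\<Sum>d\<in>{..<b} - {a0}. e (real d * x))"

text \<open>The modulus of the exponential sum over all strings of n digits other than
  \<open>a0\<close>, leading zeros being treated as ordinary digits.\<close>

definition digit_prod :: "nat \<Rightarrow> nat \<Rightarrow> nat \<Rightarrow> real \<Rightarrow> real" where
  "digit_prod b a0 n x = (\<Prod>i<n. norm (digit_sum b a0 (real (b ^ i) * x)))"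

lemma digit_sum_add_of_int: "digit_sum b a0 (x + of_int m) = digit_sum b a0 x"
proof -
  have "e (real d * (x + of_int m)) = e (real d * x)" for d
    using e_add_of_int[of "real d * x" "int d * m"] by (simp add: distrib_left)
  then show ?thesis by (simp add: digit_sum_def)
qed

lemma digit_prod_add_of_int: "digit_prod b a0 n (x + of_int m) = digit_prod b a0 n x"
proof -
  have "digit_sum b a0 (real (b ^ i) * (x + of_int m)) = digit_sum b a0 (real (b ^ i) * x)" for i
    using digit_sum_add_of_int[of b a0 "real (b ^ i) * x" "int (b ^ i) * m"]
    by (simp add: distrib_left)
  then show ?thesis by (simp add: digit_prod_def)
qed

lemma digit_prod_nonneg: "0 \<le> digit_prod b a0 n x"
  by (simp add: digit_prod_def prod_nonneg)

lemma norm_digit_sum_le: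
  assumes "a0 < b"
  shows "norm (digit_sum b a0 x) \<le> real (b - 1)"
proof -
  have "norm (digit_sum b a0 x) \<le> (\<Sum>d\<in>{..<b} - {a0}. 1)"
    unfolding digit_sum_def by (rule sum_norm_le) simp
  also have "\<dots> = real (b - 1)" using assms by simp
  finally show ?thesis .
qed

lemma digit_prod_le:
  assumes "a0 < b"
  shows "digit_prod b a0 n x \<le> real (b - 1) ^ n"
proof -
  have "digit_prod b a0 n x \<le> (\<Prod>i<n. real (b - 1))"
    unfolding digit_prod_def by (intro prod_mono conjI norm_ge_zero norm_digit_sum_le assms)
  then show ?thesis by simp
qed

lemma digit_prod_add:
  "digit_prod b a0 (m + n) x = digit_prod b a0 m x * digit_prod b a0 n (real (b ^ m) * x)"
  by (induction n) (simp_all add: digit_prod_def power_add mult_ac)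

lemma digit_prod_Suc:
  "digit_prod b a0 (Suc n) x = norm (digit_sum b a0 x) * digit_prod b a0 n (real b * x)"
  using digit_prod_add[of b a0 1 n x] by (simp add: digit_prod_def)

text \<open>Lowering every digit by 1 turns the alphabet without 0 into the alphabet without
  \<open>b - 1\<close> and changes only a phase. In this way the L1 bound for products reaches the
  forbidden digit 0, where the Fourier coefficient itself is not a product.\<close>

lemma norm_digit_sum_zero:
  assumes "b \<ge> 1"
  shows "norm (digit_sum b 0 x) = norm (digit_sum b (b - 1) x)"
proof -
  have "digit_sum b 0 x = (\<Sum>d\<in>{..<b} - {b - 1}. e (real (Suc d) * x))"
    unfolding digit_sum_def
    by (rule sum.reindex_bij_witness[of _ Suc "\<lambda>d. d - 1"]) auto
  also have "\<dots> = e x * digit_sum b (b - 1) x"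
    by (simp add: digit_sum_def sum_distrib_left algebra_simps flip: e_add)
  finally show ?thesis by (simp add: norm_mult)
qed

lemma digit_prod_zero:
  assumes "b \<ge> 1"
  shows "digit_prod b 0 n x = digit_prod b (b - 1) n x"
  unfolding digit_prod_def using norm_digit_sum_zero[OF assms] by simp

text \<open>Splits off the last digit. A zero quotient contributes nothing, because it would only
  supply a leading zero.\<close>

lemma digit_set_rec:
  assumes "b \<ge> 2"
  shows "digit_set b n = insert (n mod b) (if n div b = 0 then {} else digit_set b (n div b))"
proof (intro equalityI subsetI)
  fix x assume "x \<in> digit_set b n"
  then obtain i where x: "x = n div b ^ i mod b" and i: "i = 0 \<or> b ^ i \<le> n"
    by (auto simp: digit_set_def)
  show "x \<in> insert (n mod b) (if n div b = 0 then {} else digit_set b (n div b))"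
  proof (cases i)
    case 0
    with x show ?thesis by simp
  next
    case (Suc j)
    then have le: "b * b ^ j \<le> n" using i by simp
    then have "b ^ j \<le> n div b"
      using assms by (simp add: less_eq_div_iff_mult_less_eq mult.commute)
    moreover from this have "n div b \<noteq> 0" using assms
      by (metis le_zero_eq not_numeral_le_zero power_not_zero)
    moreover have "x = (n div b) div b ^ j mod b"
      by (simp add: x Suc div_mult2_eq)
    ultimately show ?thesis by (auto simp: digit_set_def)
  qed
next
  fix x assume x: "x \<in> insert (n mod b) (if n div b = 0 then {} else digit_set b (n div b))"
  show "x \<in> digit_set b n"
  proof (cases "x = n mod b")
    case True
    then show ?thesis by (auto simp: digit_set_def intro!: exI[of _ 0])
  next
    case False
    with x have nz: "n div b \<noteq> 0" and "x \<in> digit_set b (n div b)" by (auto split: if_splits)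
    then obtain j where x: "x = (n div b) div b ^ j mod b" and j: "j = 0 \<or> b ^ j \<le> n div b"
      by (auto simp: digit_set_def)
    from j nz have "b ^ j \<le> n div b" by auto
    then have "b ^ Suc j \<le> n"
      using assms by (simp add: less_eq_div_iff_mult_less_eq mult.commute)
    moreover have "x = n div b ^ Suc j mod b" by (simp add: x div_mult2_eq)
    ultimately show ?thesis unfolding digit_set_def by blast
  qed
qed

lemma missing_digit_rec:
  assumes "b \<ge> 2"
  shows "n \<in> missing_digit b a0 \<longleftrightarrow>
    n mod b \<noteq> a0 \<and> (n div b = 0 \<or> n div b \<in> missing_digit b a0)"
  unfolding missing_digit_def mem_Collect_eq by (subst digit_set_rec[OF assms]) auto

lemma missing_digit_less:
  assumes "b \<ge> 2" "n < b"
  shows "n \<in> missing_digit b a0 \<longleftrightarrow> n \<noteq> a0"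
  using missing_digit_rec[OF assms(1), of n a0] assms(2) by simp

section \<open>The digit set with 0 adjoined\<close>

text \<open>
  Adjoining 0 gives a set that is stable under prepending digits, also when the forbidden
  digit is 0 and missing digits above the leading one must not be counted.
\<close>
definition padded_sum :: "nat \<Rightarrow> nat \<Rightarrow> nat \<Rightarrow> real \<Rightarrow> complex" where
  "padded_sum b a0 k x = (\<Sum>n<b ^ k. if n = 0 \<or> n \<in> missing_digit b a0 then e (real n * x) else 0)"

lemma padded_sum_0: "padded_sum b a0 0 x = 1"
  by (simp add: padded_sum_def)

text \<open>For \<open>a0 = 0\<close> the number 0 belongs to the padded set although its last digit
  is forbidden; it is the extra summand 1.\<close>

lemma padded_sum_Suc:
  assumes b: "b \<ge> 2"
  shows "padded_sum b a0 (Suc k) x =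
    (if a0 = 0 then 1 else 0) + digit_sum b a0 x * padded_sum b a0 k (real b * x)"
proof -
  let ?P = "\<lambda>n. n = 0 \<or> n \<in> missing_digit b a0"
  let ?h = "\<lambda>n. if ?P n then e (real n * x) else 0"
  let ?z = "\<lambda>n d. if a0 = 0 \<and> d = 0 \<and> n = 0 then 1 else (0::complex)"
  have "padded_sum b a0 (Suc k) x = (\<Sum>n<b ^ k. \<Sum>d<b. ?h (d + n * b))"
    by (simp only: padded_sum_def power_Suc2 sum_mult_product)
  also have "\<dots> = (\<Sum>n<b ^ k. \<Sum>d<b. ?z n d +
      (if d \<noteq> a0 then e (real d * x) else 0) * (if ?P n then e (real n * (real b * x)) else 0))"
  proof (intro sum.cong refl)
    fix n d assume "d \<in> {..<b}"
    then have d: "d < b" by simp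
    then have "(d + n * b) mod b = d" "(d + n * b) div b = n" by auto
    then have P: "d + n * b \<in> missing_digit b a0 \<longleftrightarrow> d \<noteq> a0 \<and> ?P n"
      using missing_digit_rec[OF b, of "d + n * b" a0] by simp
    have E: "e (real (d + n * b) * x) = e (real d * x) * e (real n * (real b * x))"
      by (simp add: algebra_simps flip: e_add)
    show "?h (d + n * b) = ?z n d +
      (if d \<noteq> a0 then e (real d * x) else 0) * (if ?P n then e (real n * (real b * x)) else 0)"
      unfolding E P using b by auto
  qed
  also have "\<dots> = (\<Sum>n<b ^ k. \<Sum>d<b. ?z n d) +
      (\<Sum>d<b. if d \<noteq> a0 then e (real d * x) else 0) * padded_sum b a0 k (real b * x)"
    unfolding padded_sum_def sum_product sum.distrib
    by (subst (2) sum.swap) simp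
  also have "(\<Sum>d<b. if d \<noteq> a0 then e (real d * x) else 0) = digit_sum b a0 x"
    unfolding digit_sum_def by (rule sum.mono_neutral_cong_right) auto
  also have "(\<Sum>n<b ^ k. \<Sum>d<b. ?z n d) = (if a0 = 0 then 1 else 0)"
  proof (cases "a0 = 0")
    case True
    have "(\<Sum>n<b ^ k. \<Sum>d<b. ?z n d) = (\<Sum>n<b ^ k. if n = 0 then (\<Sum>d<b. if d = 0 then 1 else 0) else 0)"
      using True by (intro sum.cong refl) auto
    then show ?thesis using True b by simp
  qed simp
  finally show ?thesis .
qed

text \<open>The congruence modulo b fixes the last digit, which therefore contributes only a phase;
  the other digits see the frequency multiplied by b.\<close>

lemma missing_digit_hat_Suc:
  assumes b: "b \<ge> 2" and r: "r < b" "r \<in> missing_digit b a0"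
  shows "missing_digit_hat b a0 r (Suc k) \<theta> = e (real r * \<theta>) * padded_sum b a0 k (real b * \<theta>)"
proof -
  let ?P = "\<lambda>n. n = 0 \<or> n \<in> missing_digit b a0"
  have ra: "r \<noteq> a0" using missing_digit_less[OF b r(1)] r(2) by simp
  have "missing_digit_hat b a0 r (Suc k) \<theta> = (\<Sum>n<b ^ k. \<Sum>d<b.
      indicator (missing_digit_class b a0 r) (d + n * b) * e (real (d + n * b) * \<theta>))"
    by (simp only: missing_digit_hat_def power_Suc2 sum_mult_product)
  also have "\<dots> = (\<Sum>n<b ^ k. \<Sum>d<b. if d = r then
      (if ?P n then e (real r * \<theta>) * e (real n * (real b * \<theta>)) else 0) else 0)"
  proof (intro sum.cong refl)
    fix n d assume "d \<in> {..<b}"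
    then have d: "d < b" by simp
    then have dn: "(d + n * b) mod b = d" "(d + n * b) div b = n" by auto
    then have P: "d + n * b \<in> missing_digit_class b a0 r \<longleftrightarrow> d = r \<and> ?P n"
      using missing_digit_rec[OF b, of "d + n * b" a0] ra r(1)
      by (auto simp: missing_digit_class_def cong_def)
    have E: "e (real (d + n * b) * \<theta>) = e (real d * \<theta>) * e (real n * (real b * \<theta>))"
      by (simp add: algebra_simps flip: e_add)
    show "indicator (missing_digit_class b a0 r) (d + n * b) * e (real (d + n * b) * \<theta>) =
      (if d = r then (if ?P n then e (real r * \<theta>) * e (real n * (real b * \<theta>)) else 0) else 0)"
      unfolding E indicator_def P by auto
  qed
  also have "\<dots> = (\<Sum>n<b ^ k. if ?P n then e (real r * \<theta>) * e (real n * (real b * \<theta>)) else 0)"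
    using r(1) by simp
  also have "\<dots> = e (real r * \<theta>) * padded_sum b a0 k (real b * \<theta>)"
    unfolding padded_sum_def sum_distrib_left by (intro sum.cong) auto
  finally show ?thesis .
qed

text \<open>Iterating the recursion, each extra summand 1 stops the product early. For the forbidden
  digit 0 the partial products correspond to the possible lengths of a number.\<close>

lemma norm_padded_sum_le:
  assumes "b \<ge> 2"
  shows "norm (padded_sum b a0 k x) \<le> (\<Sum>j\<le>k. digit_prod b a0 j x)"
proof (induction k arbitrary: x)
  case 0
  then show ?case by (simp add: padded_sum_0 digit_prod_def)
next
  case (Suc k)
  have "norm (padded_sum b a0 (Suc k) x) \<le>
      1 + norm (digit_sum b a0 x) * norm (padded_sum b a0 k (real b * x))"
    unfolding padded_sum_Suc[OF assms]
    by (rule order.trans[OF norm_triangle_ineq]) (simp add: norm_mult)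
  also have "\<dots> \<le> 1 + norm (digit_sum b a0 x) * (\<Sum>j\<le>k. digit_prod b a0 j (real b * x))"
    by (intro add_mono mult_left_mono Suc.IH) auto
  also have "\<dots> = (\<Sum>j\<le>Suc k. digit_prod b a0 j x)"
    unfolding sum.atMost_Suc_shift by (simp add: digit_prod_Suc sum_distrib_left digit_prod_def[of _ _ 0])
  finally show ?case .
qed

lemma norm_padded_sum_eq:
  assumes "b \<ge> 2" "a0 \<noteq> 0"
  shows "norm (padded_sum b a0 k x) = digit_prod b a0 k x"
proof (induction k arbitrary: x)
  case 0
  then show ?case by (simp add: padded_sum_0 digit_prod_def)
next
  case (Suc k)
  then show ?case
    using assms by (simp add: padded_sum_Suc norm_mult digit_prod_Suc)
qed

lemma norm_missing_digit_hat_le: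
  assumes "b \<ge> 2" "r < b" "r \<in> missing_digit b a0"
  shows "norm (missing_digit_hat b a0 r (Suc k) \<theta>) \<le> (\<Sum>j\<le>k. digit_prod b a0 j (real b * \<theta>))"
  using norm_padded_sum_le[OF assms(1)] by (simp add: missing_digit_hat_Suc[OF assms] norm_mult)

lemma sum_power_le_power_Suc:
  assumes "(2::real) \<le> x"
  shows "(\<Sum>j\<le>k. x ^ j) \<le> x ^ Suc k"
proof (induction k)
  case 0
  then show ?case using assms by simp
next
  case (Suc k)
  have "(\<Sum>j\<le>Suc k. x ^ j) \<le> 2 * x ^ Suc k" using Suc by simp
  also have "\<dots> \<le> x * x ^ Suc k" using assms by (intro mult_right_mono) auto
  finally show ?case by simp
qed

lemma norm_missing_digit_hat_le_power:
  assumes "b \<ge> 3" "a0 < b" "r < b" "r \<in> missing_digit b a0"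
  shows "norm (missing_digit_hat b a0 r (Suc k) \<theta>) \<le> real (b - 1) ^ Suc k"
proof -
  have "norm (missing_digit_hat b a0 r (Suc k) \<theta>) \<le> (\<Sum>j\<le>k. real (b - 1) ^ j)"
    by (rule order.trans[OF norm_missing_digit_hat_le sum_mono[OF digit_prod_le]]) (use assms in auto)
  also have "\<dots> \<le> real (b - 1) ^ Suc k"
    by (rule sum_power_le_power_Suc) (use assms in auto)
  finally show ?thesis .
qed

text \<open>For a nonzero forbidden digit the coefficient of a residue class is a phase times the
  digit product, so the hypothesis for a single admissible residue suffices. The forbidden digit 0
  is then read off from \<open>b - 1\<close>.\<close>

lemma digit_prod_L1_bound:
  assumes L1: "L1_constant b C" and b: "b \<ge> 3"
  obtains K where "K \<ge> 0" "\<And>a0 n. a0 < b \<Longrightarrow>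
    (\<Sum>u<b ^ n. digit_prod b a0 n (real u / real (b ^ n))) \<le> K * (C * real b * ln (real b)) ^ n"
proof -
  define L where "L = C * real b * ln (real b)"
  obtain K where K: "\<And>a0 r k. a0 < b \<Longrightarrow> r < b \<Longrightarrow> k \<ge> 1 \<Longrightarrow> r \<in> missing_digit b a0 \<Longrightarrow> coprime r b \<Longrightarrow>
        (\<Sum>t<b ^ k. norm (missing_digit_hat b a0 r k (real t / real (b ^ k)))) \<le> K * L ^ k"
    using L1 unfolding L1_constant_def L_def by blast
  have "1 / ln (real b) \<le> C" using L1 by (simp add: L1_constant_def)
  moreover have "0 < 1 / ln (real b)" using b by simp
  ultimately have "0 < C" by linarith
  then have L: "0 < L" using b by (simp add: L_def)
  have nz: "(\<Sum>u<b ^ n. digit_prod b a0 n (real u / real (b ^ n))) \<le> \<bar>K\<bar> * L / real b * L ^ n"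
    if a: "a0 < b" "a0 \<noteq> 0" for a0 n
  proof -
    \<comment> \<open>Both 1 and \<open>b - 1\<close> are prime to b, and they differ because b is
      at least 3, so one of them is not the forbidden digit.\<close>
    define r where "r = (if a0 = 1 then b - 1 else 1)"
    have "coprime (b - 1) b" using b by (intro coprime_diff_one_left_nat) simp
    then have r: "r < b" "r \<noteq> a0" "coprime r b"
      using a b by (auto simp: r_def)
    have rm: "r \<in> missing_digit b a0" using r missing_digit_less[of b r a0] b by simp
    have eq: "norm (missing_digit_hat b a0 r (Suc n) (real t / real (b ^ Suc n))) =
        digit_prod b a0 n (real t / real (b ^ n))" for t
      using b a by (simp add: missing_digit_hat_Suc[OF _ r(1) rm] norm_mult norm_padded_sum_eq)
    \<comment> \<open>The product has period 1 and is evaluated at b times the frequency, so the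
      grid of \<open>b ^ Suc n\<close> points runs b times through the grid of \<open>b ^ n\<close>
      points.\<close>
    have "real b * (\<Sum>u<b ^ n. digit_prod b a0 n (real u / real (b ^ n))) =
        (\<Sum>i<b. \<Sum>u<b ^ n. digit_prod b a0 n (real u / real (b ^ n)))"
      by simp
    also have "\<dots> = (\<Sum>i<b. \<Sum>u<b ^ n. digit_prod b a0 n (real (u + i * b ^ n) / real (b ^ n)))"
    proof (intro sum.cong refl)
      fix u i
      have "real (u + i * b ^ n) / real (b ^ n) = real u / real (b ^ n) + of_int (int i)"
        using b by (simp add: field_simps)
      then show "digit_prod b a0 n (real u / real (b ^ n)) =
          digit_prod b a0 n (real (u + i * b ^ n) / real (b ^ n))"
        by (simp only: digit_prod_add_of_int)
    qed
    also have "\<dots> = (\<Sum>t<b ^ Suc n. digit_prod b a0 n (real t / real (b ^ n)))"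
      by (simp only: sum_mult_product power_Suc)
    also have "\<dots> = (\<Sum>t<b ^ Suc n. norm (missing_digit_hat b a0 r (Suc n) (real t / real (b ^ Suc n))))"
      by (simp only: eq)
    also have "\<dots> \<le> K * L ^ Suc n" using K[OF a(1) r(1) _ rm r(3), of "Suc n"] by simp
    also have "\<dots> \<le> \<bar>K\<bar> * L ^ Suc n" using L by (intro mult_right_mono) auto
    finally show ?thesis using b by (simp add: field_simps)
  qed
  show ?thesis
  proof (rule that[of "\<bar>K\<bar> * L / real b"])
    show "0 \<le> \<bar>K\<bar> * L / real b" using L by simp
  next
    fix a0 n assume a: "a0 < b"
    have "(\<Sum>u<b ^ n. digit_prod b a0 n (real u / real (b ^ n))) \<le> \<bar>K\<bar> * L / real b * L ^ n"
    proof (cases "a0 = 0")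
      case True
      then show ?thesis using nz[of "b - 1" n] b by (simp add: digit_prod_zero)
    qed (use nz a in simp)
    then show "(\<Sum>u<b ^ n. digit_prod b a0 n (real u / real (b ^ n)))
        \<le> \<bar>K\<bar> * L / real b * (C * real b * ln (real b)) ^ n" by (simp only: L_def)
  qed
qed

section \<open>Interpolation of trigonometric polynomials\<close>

text \<open>A polynomial of degree below N is recovered from N equally spaced values with the
  normalised Dirichlet kernel; orthogonality on the grid keeps only the diagonal
  frequencies.\<close>

lemma trig_poly_interpolation:
  assumes N: "N > 0" and F: "\<And>x. F x = (\<Sum>m<N. a m * e (real m * x))"
  shows "F x = (\<Sum>u<N. F (real u / real N) * ((\<Sum>m<N. e (real m * (x - real u / real N))) / of_nat N))"
proof -
  have "(\<Sum>u<N. F (real u / real N) * (\<Sum>m<N. e (real m * (x - real u / real N)))) =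
     (\<Sum>u<N. \<Sum>l<N. \<Sum>m<N. a l * e (real m * x) * e (real u * (of_int (int l - int m) / real N)))"
    unfolding F sum_product
  proof (intro sum.cong refl)
    fix u l m
    have "real l * (real u / real N) + real m * (x - real u / real N) =
        real m * x + real u * (of_int (int l - int m) / real N)"
      by (simp add: algebra_simps diff_divide_distrib)
    then have "e (real l * (real u / real N)) * e (real m * (x - real u / real N)) =
        e (real m * x) * e (real u * (of_int (int l - int m) / real N))"
      by (simp only: e_add[symmetric])
    then show "a l * e (real l * (real u / real N)) * e (real m * (x - real u / real N)) =
        a l * e (real m * x) * e (real u * (of_int (int l - int m) / real N))"
      by (simp add: mult.assoc)
  qed
  also have "\<dots> = (\<Sum>l<N. \<Sum>m<N. a l * e (real m * x) *
      (\<Sum>u<N. e (real u * (of_int (int l - int m) / real N))))"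
    unfolding sum_distrib_left by (subst sum.swap, rule sum.cong[OF refl], subst sum.swap, rule refl)
  also have "\<dots> = (\<Sum>l<N. \<Sum>m<N. if m = l then of_nat N * (a l * e (real l * x)) else 0)"
  proof (intro sum.cong refl)
    fix l m assume "l \<in> {..<N}" "m \<in> {..<N}"
    then have "int N dvd int l - int m \<longleftrightarrow> m = l"
      unfolding mod_eq_dvd_iff[symmetric] by auto
    then show "a l * e (real m * x) * (\<Sum>u<N. e (real u * (of_int (int l - int m) / real N))) =
        (if m = l then of_nat N * (a l * e (real l * x)) else 0)"
      unfolding sum_e_orthogonality[OF N] by simp
  qed
  also have "\<dots> = of_nat N * F x"
    by (simp add: F sum_distrib_left)
  finally show ?thesis using N by (simp add: sum_divide_distrib[symmetric])
qed

text \<open>Labels the arc of length \<open>1 / N\<close> of the circle that contains x. Counting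
  points per arc replaces a spacing condition modulo 1.\<close>

definition cell :: "nat \<Rightarrow> real \<Rightarrow> nat" where
  "cell N x = nat \<lfloor>real N * frac x\<rfloor>"

lemma cell_less:
  assumes "N > 0"
  shows "cell N x < N"
proof -
  have "real N * frac x < real N"
    using assms frac_lt_1[of x] by (simp add: mult_less_cancel_left1)
  then show ?thesis
    using assms frac_ge_0[of x] by (simp add: cell_def nat_less_iff floor_less_iff)
qed

lemma cell_bounds:
  "real (cell N x) \<le> real N * frac x" "real N * frac x < real (cell N x) + 1"
proof -
  have "real (cell N x) = of_int \<lfloor>real N * frac x\<rfloor>"
    by (simp add: cell_def)
  then show "real (cell N x) \<le> real N * frac x" "real N * frac x < real (cell N x) + 1"
    using floor_correct[of "real N * frac x"] by auto
qed

lemma cell_div: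
  assumes "N' > 0"
  shows "cell N x = cell (N * N') x div N'"
proof -
  have "int (cell N x) = \<lfloor>(real (N * N') * frac x) / real_of_int (int N')\<rfloor>"
    using assms by (simp add: cell_def)
  also have "\<dots> = \<lfloor>real (N * N') * frac x\<rfloor> div int N'"
    by (rule floor_divide_real_eq_div) simp
  also have "\<dots> = int (cell (N * N') x div N')"
    by (simp add: cell_def zdiv_int)
  finally show ?thesis by simp
qed

text \<open>Here z is the number of cells from u to x going round the circle in one direction, and
  \<open>N - z\<close> measures the way round in the other. The kernel decays like the reciprocal of
  the shorter one.\<close>

lemma dirichlet_kernel_cell_le:
  fixes x :: real
  assumes N: "N > 0" and u: "u < N"
  defines "z \<equiv> (cell N x + N - u) mod N"
  shows "norm (\<Sum>m<N. e (real m * (x - real u / real N))) / real N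
    \<le> 1 / real (z + 1) + 1 / real (N - z)"
proof -
  have zN: "z < N" using N by (simp add: z_def)
  define t where "t = real N * frac x - real (cell N x)"
  have t: "0 \<le> t" "t < 1" using cell_bounds[of N x] by (auto simp: t_def)
  define y where "y = (real z + t) / real N"
  define j where "j = (int (cell N x) - int u) div int N"
  have "int (cell N x + N - u) = (int (cell N x) - int u) + int N" using u by simp
  then have "int z = (int (cell N x) - int u) mod int N"
    unfolding z_def zmod_int by simp
  then have "int (cell N x) - int u = int z + int N * j"
    unfolding j_def by simp
  then have "real_of_int (int (cell N x) - int u) = real_of_int (int z + int N * j)"
    by (rule arg_cong)
  then have j: "real (cell N x) - real u = real z + real N * of_int j" by simp
  have "x - real u / real N = frac x + of_int \<lfloor>x\<rfloor> - real u / real N" by (simp add: frac_def)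
  also have "frac x = (real (cell N x) + t) / real N" using N by (simp add: t_def)
  also have "\<dots> + of_int \<lfloor>x\<rfloor> - real u / real N = (real (cell N x) - real u + t) / real N + of_int \<lfloor>x\<rfloor>"
    by (simp add: add_divide_distrib diff_divide_distrib)
  also have "\<dots> = y + of_int (\<lfloor>x\<rfloor> + j)"
    unfolding j y_def using N by (simp add: field_simps)
  finally have "e (real m * (x - real u / real N)) = e (real m * y)" for m
    using e_add_of_int[of "real m * y" "int m * (\<lfloor>x\<rfloor> + j)"] by (simp add: distrib_left)
  then have eq: "(\<Sum>m<N. e (real m * (x - real u / real N))) = (\<Sum>m<N. e (real m * y))" by simp
  show ?thesis
  \<comment> \<open>In these two cells x may be arbitrarily close to \<open>u / N\<close>, where the
    geometric bound blows up; the trivial bound 1 is used instead.\<close>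
  proof (cases "z = 0 \<or> z = N - 1")
    case True
    have "norm (\<Sum>m<N. e (real m * y)) \<le> (\<Sum>m<N. 1)"
      by (rule sum_norm_le) simp
    then have "norm (\<Sum>m<N. e (real m * y)) / real N \<le> 1" using N by simp
    also have "1 \<le> 1 / real (z + 1) + 1 / real (N - z)"
      using True N by auto
    finally show ?thesis by (simp only: eq)
  next
    case False
    with zN have z: "1 \<le> z" "z + 2 \<le> N" by auto
    have y: "0 < y" "y < 1" using z t by (auto simp: y_def field_simps)
    have "norm (\<Sum>m<N. e (real m * y)) / real N \<le> ((1 / y + 1 / (1 - y)) / 2) / real N"
      by (intro divide_right_mono norm_geometric_e_le y) simp
    also have "\<dots> = 1 / (2 * (real z + t)) + 1 / (2 * (real N - real z - t))"
    proof -
      have "real N - real z - t > 0" using z t by simp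
      moreover have "1 - y = (real N - real z - t) / real N" using N by (simp add: y_def field_simps)
      moreover have "((1 / (v / c) + 1 / (w / c)) / 2) / c = 1 / (2 * v) + 1 / (2 * w)"
        if "0 < c" "0 < v" "0 < w" for c v w :: real
        using that by (simp add: field_simps)
      ultimately show ?thesis using N z t by (simp only: y_def)
    qed
    \<comment> \<open>The factor 1/2 of the geometric bound absorbs the offset t in [0, 1):
      \<open>z + 1 \<le> 2 * (z + t)\<close> since z is at least 1, and
      \<open>N - z \<le> 2 * (N - z - t)\<close> since \<open>N - z\<close> is at least 2.\<close>
    also have "\<dots> \<le> 1 / (real z + 1) + 1 / (real N - real z)"
      using z t by (intro add_mono divide_left_mono mult_pos_pos) auto
    finally show ?thesis using zN by (simp add: eq of_nat_diff add.commute)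
  qed
qed

lemma harm_le_one_plus_ln:
  assumes "N > 0"
  shows "(harm N :: real) \<le> 1 + ln (real N)"
proof -
  have "harm N - ln (real N) \<le> harm 1 - ln (real 1)"
    by (rule euler_mascheroni_sequence_decreasing) (use assms in auto)
  then show ?thesis by (simp add: harm_expand)
qed

lemma sum_inverse_Suc_eq_harm: "(\<Sum>z<N. 1 / real (z + 1)) = harm N"
  unfolding harm_def by (rule sum.reindex_bij_witness[of _ "\<lambda>k. k - 1" "\<lambda>z. z + 1"]) (auto simp: field_simps)

text \<open>Each value is interpolated from the grid and the sums are exchanged. For a fixed grid
  point the kernel, summed over points with at most M per cell, is M times two harmonic sums, which
  is the logarithm.\<close>

lemma sum_trig_poly_cells_le:
  assumes N: "N > 0" and F: "\<And>x. F x = (\<Sum>m<N. a m * e (real m * x))"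
    and I: "finite I" and M: "\<And>w. w < N \<Longrightarrow> real (card {i \<in> I. cell N (x i) = w}) \<le> M"
  shows "(\<Sum>i\<in>I. norm (F (x i))) \<le> 2 * M * (1 + ln (real N)) * (\<Sum>u<N. norm (F (real u / real N)))"
proof -
  define \<kappa> where "\<kappa> = (\<lambda>y. norm (\<Sum>m<N. e (real m * y)) / real N)"
  define h where "h = (\<lambda>z. 1 / real (z + 1) + 1 / real (N - z))"
  have sh: "(\<Sum>z<N. h z) \<le> 2 * (1 + ln (real N))"
  proof -
    have "(\<Sum>z<N. 1 / real (N - z)) = (\<Sum>z<N. 1 / real (z + 1))"
      by (rule sum.reindex_bij_witness[of _ "\<lambda>z. N - 1 - z" "\<lambda>z. N - 1 - z"]) auto
    then show ?thesis
      using harm_le_one_plus_ln[OF N] sum_inverse_Suc_eq_harm[of N] by (simp add: h_def sum.distrib)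
  qed
  have \<kappa>: "(\<Sum>i\<in>I. \<kappa> (x i - real u / real N)) \<le> M * (2 * (1 + ln (real N)))" if u: "u < N" for u
  proof -
    have "(\<Sum>i\<in>I. \<kappa> (x i - real u / real N)) \<le> (\<Sum>i\<in>I. h ((cell N (x i) + N - u) mod N))"
      unfolding \<kappa>_def h_def by (intro sum_mono dirichlet_kernel_cell_le N u)
    also have "\<dots> = (\<Sum>w<N. \<Sum>i\<in>{i \<in> I. cell N (x i) = w}. h ((cell N (x i) + N - u) mod N))"
      using I cell_less[OF N] by (intro sum.group[symmetric]) auto
    also have "\<dots> = (\<Sum>w<N. real (card {i \<in> I. cell N (x i) = w}) * h ((w + N - u) mod N))"
      by (intro sum.cong refl) simp
    also have "\<dots> \<le> (\<Sum>w<N. M * h ((w + N - u) mod N))"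
      by (intro sum_mono mult_right_mono M) (auto simp: h_def)
    also have "\<dots> = M * (\<Sum>w<N. h ((w + N - u) mod N))" by (simp add: sum_distrib_left)
    \<comment> \<open>Translation by u permutes the cells, so the kernel sum is the same for every
      grid point.\<close>
    also have "(\<Sum>w<N. h ((w + N - u) mod N)) = (\<Sum>z<N. h z)"
    proof (rule sum.reindex_bij_witness[of _ "\<lambda>z. (z + u) mod N" "\<lambda>w. (w + N - u) mod N"])
      fix w assume "w \<in> {..<N}"
      then have w: "w < N" by simp
      have "((w + N - u) mod N + u) mod N = (w + N - u + u) mod N" by (simp add: mod_add_left_eq)
      then show "((w + N - u) mod N + u) mod N = w" using w u by simp
    next
      fix z assume "z \<in> {..<N}"
      then have z: "z < N" by simp
      show "((z + u) mod N + N - u) mod N = z"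
      proof (cases "z + u < N")
        case True
        then show ?thesis using z by simp
      next
        case False
        then have "(z + u) mod N = z + u - N" using z u by (simp add: mod_if)
        then show ?thesis using z False by simp
      qed
    qed (use N in auto)
    also have "M * (\<Sum>z<N. h z) \<le> M * (2 * (1 + ln (real N)))"
      using M[of 0] N by (intro mult_left_mono sh) auto
    finally show ?thesis .
  qed
  have "(\<Sum>i\<in>I. norm (F (x i))) \<le> (\<Sum>i\<in>I. \<Sum>u<N. norm (F (real u / real N)) * \<kappa> (x i - real u / real N))"
  proof (rule sum_mono)
    fix i
    have "norm (F (x i)) = norm (\<Sum>u<N. F (real u / real N) *
        ((\<Sum>m<N. e (real m * (x i - real u / real N))) / of_nat N))"
      using trig_poly_interpolation[OF N F, of "x i"] by simp
    also have "\<dots> \<le> (\<Sum>u<N. norm (F (real u / real N)) * \<kappa> (x i - real u / real N))"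
      by (rule sum_norm_le) (simp add: norm_mult norm_divide \<kappa>_def)
    finally show "norm (F (x i)) \<le> (\<Sum>u<N. norm (F (real u / real N)) * \<kappa> (x i - real u / real N))" .
  qed
  also have "\<dots> = (\<Sum>u<N. norm (F (real u / real N)) * (\<Sum>i\<in>I. \<kappa> (x i - real u / real N)))"
    by (subst sum.swap) (simp add: sum_distrib_left)
  also have "\<dots> \<le> (\<Sum>u<N. norm (F (real u / real N)) * (M * (2 * (1 + ln (real N)))))"
    by (intro sum_mono mult_left_mono \<kappa>) auto
  also have "\<dots> = 2 * M * (1 + ln (real N)) * (\<Sum>u<N. norm (F (real u / real N)))"
    unfolding sum_distrib_right[symmetric] by (simp add: mult_ac)
  finally show ?thesis .
qed

text \<open>The degree bound is the point: it allows interpolation of a product of n factors from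
  the grid of mesh \<open>1 / b ^ n\<close>, where the L1 bound is given.\<close>

lemma digit_prod_trig_poly:
  "\<exists>a. \<forall>x. (\<Prod>i<n. digit_sum b a0 (real (b ^ i) * x)) = (\<Sum>m<b ^ n. a m * e (real m * x))"
proof (induction n)
  case 0
  then show ?case by (intro exI[of _ "\<lambda>_. 1"]) simp
next
  case (Suc n)
  then obtain a where a: "\<And>x. (\<Prod>i<n. digit_sum b a0 (real (b ^ i) * x)) = (\<Sum>m<b ^ n. a m * e (real m * x))"
    by auto
  define a' where "a' = (\<lambda>m. (if m mod b = a0 then 0 else 1) * a (m div b))"
  have "(\<Prod>i<Suc n. digit_sum b a0 (real (b ^ i) * x)) = (\<Sum>m<b ^ Suc n. a' m * e (real m * x))" for x
  proof -
    have "(\<Prod>i<Suc n. digit_sum b a0 (real (b ^ i) * x)) =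
        digit_sum b a0 x * (\<Prod>i<n. digit_sum b a0 (real (b ^ i) * (real b * x)))"
      unfolding prod.lessThan_Suc_shift by (simp add: mult_ac)
    also have "digit_sum b a0 x = (\<Sum>d<b. (if d = a0 then 0 else 1) * e (real d * x))"
      unfolding digit_sum_def by (rule sum.mono_neutral_cong_left) auto
    also have "\<dots> * (\<Prod>i<n. digit_sum b a0 (real (b ^ i) * (real b * x))) =
        (\<Sum>m<b ^ n. \<Sum>d<b. ((if d = a0 then 0 else 1) * e (real d * x)) * (a m * e (real m * (real b * x))))"
      unfolding a sum_product by (rule sum.swap)
    also have "\<dots> = (\<Sum>m<b ^ n. \<Sum>d<b. a' (d + m * b) * e (real (d + m * b) * x))"
    proof (intro sum.cong refl)
      fix m d assume "d \<in> {..<b}"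
      then have "(d + m * b) mod b = d" "(d + m * b) div b = m" by auto
      moreover have "e (real (d + m * b) * x) = e (real d * x) * e (real m * (real b * x))"
        by (simp add: algebra_simps flip: e_add)
      ultimately show "((if d = a0 then 0 else 1) * e (real d * x)) * (a m * e (real m * (real b * x))) =
          a' (d + m * b) * e (real (d + m * b) * x)"
        by (simp add: a'_def)
    qed
    also have "\<dots> = (\<Sum>m<b ^ Suc n. a' m * e (real m * x))"
      by (simp only: power_Suc2 sum_mult_product)
    finally show ?thesis .
  qed
  then show ?case by blast
qed

text \<open>
  Only the values on the grid of mesh \<open>b\<^sup>-\<^sup>j\<close> enter the hypothesis \<open>L1\<close>; interpolation from
  that grid transfers the bound to any spaced points at the cost of one factor \<open>n\<close>.
\<close>
lemma sum_digit_prod_cells_le: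
  assumes b: "b \<ge> 3" and L: "real b \<le> L" and "K \<ge> 0"
    and L1: "\<And>n. (\<Sum>u<b ^ n. digit_prod b a0 n (real u / real (b ^ n))) \<le> K * L ^ n"
    and I: "finite I" and jn: "j \<le> n"
    and M: "\<And>w. w < b ^ n \<Longrightarrow> real (card {i \<in> I. cell (b ^ n) (x i) = w}) \<le> M"
  shows "(\<Sum>i\<in>I. digit_prod b a0 j (x i)) \<le> 2 * K * real b * M * real (n + 1) * L ^ n"
proof -
  have "real (card {i \<in> I. cell (b ^ n) (x i) = 0}) \<le> M" using M[of 0] b by simp
  then have M0: "0 \<le> M" by (rule order.trans[rotated]) simp
  define N where "N = b ^ j"
  have N: "N > 0" using b by (simp add: N_def)
  obtain a where a: "\<And>x. (\<Prod>i<j. digit_sum b a0 (real (b ^ i) * x)) = (\<Sum>m<N. a m * e (real m * x))"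
    using digit_prod_trig_poly[of b a0 j] unfolding N_def by auto
  \<comment> \<open>A coarse cell is a union of \<open>b ^ (n - j)\<close> fine cells. The shorter
    product thus meets more points per cell, and \<open>b \<le> L\<close> turns this loss into the
    missing powers of L.\<close>
  have card: "real (card {i \<in> I. cell N (x i) = w}) \<le> real b ^ (n - j) * M" if w: "w < N" for w
  proof -
    define N' where "N' = b ^ (n - j)"
    have N': "N' > 0" "N * N' = b ^ n" using b jn power_add[of b j "n - j"] by (simp_all add: N'_def N_def)
    have sub: "{i \<in> I. cell N (x i) = w} \<subseteq> (\<Union>v<N'. {i \<in> I. cell (b ^ n) (x i) = v + w * N'})"
    proof clarsimp
      fix i assume i: "i \<in> I" "w = cell N (x i)"
      have "cell (b ^ n) (x i) = cell (b ^ n) (x i) mod N' + cell N (x i) * N'"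
        using cell_div[OF N'(1), of N "x i"] N'(2) by simp
      then show "\<exists>v\<in>{..<N'}. cell (b ^ n) (x i) = v + cell N (x i) * N'"
        using N'(1) by (intro bexI[of _ "cell (b ^ n) (x i) mod N'"]) auto
    qed
    have "card {i \<in> I. cell N (x i) = w} \<le> card (\<Union>v<N'. {i \<in> I. cell (b ^ n) (x i) = v + w * N'})"
      by (rule card_mono[OF _ sub]) (use I in auto)
    also have "\<dots> \<le> (\<Sum>v<N'. card {i \<in> I. cell (b ^ n) (x i) = v + w * N'})"
      by (rule card_UN_le) simp
    finally have "real (card {i \<in> I. cell N (x i) = w}) \<le>
        real (\<Sum>v<N'. card {i \<in> I. cell (b ^ n) (x i) = v + w * N'})"
      by (rule of_nat_mono)
    also have "\<dots> = (\<Sum>v<N'. real (card {i \<in> I. cell (b ^ n) (x i) = v + w * N'}))"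
      by simp
    also have "\<dots> \<le> (\<Sum>v<N'. M)"
    proof (intro sum_mono M)
      fix v assume "v \<in> {..<N'}"
      then have "v + w * N' < (w + 1) * N'" by simp
      also have "\<dots> \<le> N * N'" using w by (intro mult_right_mono) auto
      finally show "v + w * N' < b ^ n" by (simp add: N'(2))
    qed
    finally show ?thesis by (simp add: N'_def)
  qed
  have "(\<Sum>i\<in>I. digit_prod b a0 j (x i)) \<le>
     2 * (real b ^ (n - j) * M) * (1 + ln (real N)) * (\<Sum>u<N. digit_prod b a0 j (real u / real N))"
    using sum_trig_poly_cells_le[OF N a I card] unfolding digit_prod_def prod_norm .
  also have "\<dots> \<le> 2 * (L ^ (n - j) * M) * (real b * real (n + 1)) * (K * L ^ j)"
  proof -
    have "ln (real N) = real j * ln (real b)" using b by (simp add: N_def ln_realpow)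
    also have "\<dots> \<le> real n * (real b - 1)"
      using b jn ln_le_minus_one[of "real b"] by (intro mult_mono) auto
    finally have "1 + ln (real N) \<le> 1 + real n * (real b - 1)" by simp
    also have "\<dots> \<le> real b * real (n + 1)" using b by (simp add: algebra_simps)
    finally have 1: "1 + ln (real N) \<le> real b * real (n + 1)" .
    have 2: "real b ^ (n - j) \<le> L ^ (n - j)" "0 \<le> L ^ (n - j)"
      using L by (auto intro: power_mono)
    have 3: "(\<Sum>u<N. digit_prod b a0 j (real u / real N)) \<le> K * L ^ j"
      using L1[of j] by (simp only: N_def)
    have 4: "0 \<le> ln (real N)" using N by simp
    show ?thesis
      by (intro mult_mono 1 2 3 sum_nonneg digit_prod_nonneg mult_nonneg_nonneg) (use 4 M0 in simp_all)
  qed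
  also have "\<dots> = 2 * K * real b * M * real (n + 1) * (L ^ (n - j) * L ^ j)" by simp
  also have "L ^ (n - j) * L ^ j = L ^ n" using jn power_add[of L "n - j" j] by simp
  finally show ?thesis .
qed

section \<open>A hybrid large sieve\<close>

lemma card_spaced_le:
  fixes S :: "real set"
  assumes "finite S" and sub: "S \<subseteq> {x..x + l}" and "\<delta> > 0" "l \<ge> 0"
    and spaced: "\<And>y z. y \<in> S \<Longrightarrow> z \<in> S \<Longrightarrow> y \<noteq> z \<Longrightarrow> \<delta> \<le> \<bar>y - z\<bar>"
  shows "real (card S) \<le> 1 + l / \<delta>"
proof -
  define f where "f = (\<lambda>y. nat \<lfloor>(y - x) / \<delta>\<rfloor>)"
  have "inj_on f S"
  proof (rule inj_onI, rule ccontr)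
    fix y z assume yz: "y \<in> S" "z \<in> S" "f y = f z" "y \<noteq> z"
    have "0 \<le> (y - x) / \<delta>" "0 \<le> (z - x) / \<delta>" using yz sub \<open>\<delta> > 0\<close> by auto
    then have "\<lfloor>(y - x) / \<delta>\<rfloor> = \<lfloor>(z - x) / \<delta>\<rfloor>"
      using yz(3) unfolding f_def by (simp add: nat_eq_iff2)
    then have "\<bar>(y - x) / \<delta> - (z - x) / \<delta>\<bar> < 1" by linarith
    also have "(y - x) / \<delta> - (z - x) / \<delta> = (y - z) / \<delta>" by (simp add: diff_divide_distrib)
    finally have "\<bar>y - z\<bar> < \<delta>" using \<open>\<delta> > 0\<close> by (simp add: abs_divide)
    with spaced[OF yz(1,2,4)] show False by simp
  qed
  moreover have "f ` S \<subseteq> {..nat \<lfloor>l / \<delta>\<rfloor>}"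
  proof (rule image_subsetI)
    fix y assume "y \<in> S"
    then have "(y - x) / \<delta> \<le> l / \<delta>" using sub \<open>\<delta> > 0\<close> by (intro divide_right_mono) auto
    then show "f y \<in> {..nat \<lfloor>l / \<delta>\<rfloor>}" unfolding f_def by (simp add: nat_mono floor_mono)
  qed
  ultimately have "card S \<le> card {..nat \<lfloor>l / \<delta>\<rfloor>}"
    by (intro card_inj_on_le) auto
  then have "real (card S) \<le> 1 + real (nat \<lfloor>l / \<delta>\<rfloor>)" by simp
  also have "real (nat \<lfloor>l / \<delta>\<rfloor>) \<le> l / \<delta>"
    using \<open>\<delta> > 0\<close> \<open>l \<ge> 0\<close> by (simp add: of_nat_nat)
  finally show ?thesis by simp
qed

lemma cell_of_nat_div:
  assumes "N > 0"
  shows "cell N (real t / real N) = t mod N"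
proof -
  have "frac (real t / real N) = real (t mod N) / real N"
  proof -
    have "real t = real N * real (t div N) + real (t mod N)"
      by (metis mult_div_mod_eq of_nat_add of_nat_mult)
    then have "real t / real N = real (t mod N) / real N + of_int (int (t div N))"
      using assms by (simp add: field_simps)
    moreover have "real (t mod N) / real N < 1" using assms by simp
    ultimately show ?thesis
      by (simp add: frac_unique_iff)
  qed
  then show ?thesis using assms by (simp add: cell_def)
qed

text \<open>The product is cut into low factors, a middle part bounded trivially, and top factors.
  The last m frequencies start at \<open>b ^ (k - m) * t / b ^ k = t / b ^ m\<close>, so the top
  part depends on t only modulo \<open>b ^ m\<close>. The minimum and the truncated subtraction
  cover products with fewer than \<open>k - 1\<close> factors.\<close>

lemma digit_prod_split_le:
  assumes b: "b \<ge> 2" "a0 < b" and jm: "j + m < k" and n: "n < k"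
  shows "digit_prod b a0 n (real b * (real t / real (b ^ k))) \<le>
    real (b - 1) ^ (k - 1 - j - m) * (digit_prod b a0 (min j n) (real b * (real t / real (b ^ k))) *
      digit_prod b a0 (n + 1 + m - k) (real t / real (b ^ m)))"
proof (cases "n + 1 + m \<le> k")
  case True
  let ?x = "real b * (real t / real (b ^ k))"
  have "digit_prod b a0 n ?x = digit_prod b a0 (min j n) ?x *
      digit_prod b a0 (n - min j n) (real (b ^ min j n) * ?x)"
    using digit_prod_add[of b a0 "min j n" "n - min j n" ?x] by simp
  also have "\<dots> \<le> digit_prod b a0 (min j n) ?x * real (b - 1) ^ (n - min j n)"
    by (intro mult_left_mono digit_prod_le b digit_prod_nonneg)
  also have "\<dots> \<le> digit_prod b a0 (min j n) ?x * real (b - 1) ^ (k - 1 - j - m)"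
    by (intro mult_left_mono power_increasing digit_prod_nonneg) (use True b jm in auto)
  finally show ?thesis using True by (simp add: digit_prod_def[of _ _ 0] mult_ac)
next
  case False
  let ?x = "real b * (real t / real (b ^ k))"
  define m' where "m' = n + 1 + m - k"
  have n_eq: "n = j + ((k - 1 - j - m) + m')" and jn: "min j n = j"
    using False jm n by (auto simp: m'_def)
  have "real (b ^ (k - 1 - j - m)) * (real (b ^ j) * ?x) = real (b ^ (k - 1 - j - m + j + 1)) * real t / real (b ^ k)"
    by (simp add: power_add)
  also have "k - 1 - j - m + j + 1 = k - m" using jm by simp
  also have "real (b ^ (k - m)) * real t / real (b ^ k) = real t / real (b ^ m)"
  proof -
    have "real (b ^ k) = real (b ^ (k - m)) * real (b ^ m)"
      using jm by (simp flip: power_add)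
    then show ?thesis using b by simp
  qed
  finally have x: "real (b ^ (k - 1 - j - m)) * (real (b ^ j) * ?x) = real t / real (b ^ m)" .
  have "digit_prod b a0 n ?x = digit_prod b a0 j ?x *
      (digit_prod b a0 (k - 1 - j - m) (real (b ^ j) * ?x) * digit_prod b a0 m' (real t / real (b ^ m)))"
    by (subst n_eq, subst digit_prod_add, subst digit_prod_add, simp only: x)
  also have "\<dots> \<le> digit_prod b a0 j ?x *
      (real (b - 1) ^ (k - 1 - j - m) * digit_prod b a0 m' (real t / real (b ^ m)))"
    by (intro mult_left_mono mult_right_mono digit_prod_le b digit_prod_nonneg)
  finally show ?thesis by (simp add: jn m'_def mult_ac)
qed

lemma card_residue_in_interval_le:
  assumes "finite T" and N: "N > 0" and l: "l \<ge> 0"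
    and near: "\<And>t. t \<in> T \<Longrightarrow> \<bar>real t - c\<bar> \<le> l"
  shows "real (card {t \<in> T. t mod N = w}) \<le> 1 + 2 * l / real N"
proof -
  let ?S = "real ` {t \<in> T. t mod N = w}"
  have "real (card ?S) \<le> 1 + (2 * l) / real N"
  proof (rule card_spaced_le)
    show "?S \<subseteq> {c - l..c - l + 2 * l}"
    proof clarify
      fix t assume "t \<in> T"
      from near[OF this] show "real t \<in> {c - l..c - l + 2 * l}" by auto
    qed
  next
    fix y z assume "y \<in> ?S" "z \<in> ?S" "y \<noteq> z"
    then obtain t t' where t: "t mod N = w" "t' mod N = w" "y = real t" "z = real t'" "t \<noteq> t'"
      by auto
    have "int t mod int N = int t' mod int N" using t by (simp flip: zmod_int)
    then have "int N dvd int t - int t'" by (simp add: mod_eq_dvd_iff)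
    then have "int N \<le> \<bar>int t - int t'\<bar>" using t by (intro zdvd_imp_le) auto
    then show "real N \<le> \<bar>y - z\<bar>" using t by linarith
  qed (use assms in auto)
  moreover have "card ?S = card {t \<in> T. t mod N = w}" by (intro card_image) auto
  ultimately show ?thesis by simp
qed

text \<open>
  Each multiple \<open>b p\<close> folds \<open>b\<close> translates of an arc on top of each other, whence the factor
  \<open>b\<close> in front of the count of a spaced set.
\<close>
lemma card_near_spaced_cell_le:
  fixes \<tau> :: "real \<Rightarrow> nat"
  assumes b: "b \<ge> 2" and P: "finite P" and \<eta>: "\<eta> \<ge> 0" and \<delta>: "\<delta> > 0"
    and \<tau>: "\<And>p. p \<in> P \<Longrightarrow> \<tau> p < b ^ k" "\<And>p. p \<in> P \<Longrightarrow> \<bar>real (\<tau> p) / real (b ^ k) - p\<bar> \<le> \<eta>"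
    and spaced: "\<And>p p'. p \<in> P \<Longrightarrow> p' \<in> P \<Longrightarrow> p \<noteq> p' \<Longrightarrow> \<delta> \<le> \<bar>p - p'\<bar>"
  shows "real (card {p \<in> P. cell (b ^ j) (real b * (real (\<tau> p) / real (b ^ k))) = u})
    \<le> real b * (1 + (1 / real (b ^ (j + 1)) + 2 * \<eta>) / \<delta>)"
proof -
  define y where "y = (\<lambda>p. real b * (real (\<tau> p) / real (b ^ k)))"
  define l where "l = 1 / real (b ^ (j + 1)) + 2 * \<eta>"
  define lo where "lo = (\<lambda>c. (real c + real u / real (b ^ j)) / real b - \<eta>)"
  have sub: "{p \<in> P. cell (b ^ j) (y p) = u} \<subseteq> (\<Union>c<b. {p \<in> P. p \<in> {lo c..lo c + l}})"
  proof clarsimp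
    fix p assume p: "p \<in> P" and u: "u = cell (b ^ j) (y p)"
    have y0: "0 \<le> y p" by (simp add: y_def)
    have "real (\<tau> p) < real (b ^ k)" using \<tau>(1)[OF p] by (simp only: of_nat_less_iff)
    then have "real (\<tau> p) / real (b ^ k) < 1" using b by (simp add: divide_less_eq)
    then have "real b * (real (\<tau> p) / real (b ^ k)) < real b * 1"
      by (rule mult_strict_left_mono) (use b in simp)
    then have yb: "y p < real b" by (simp add: y_def)
    define c where "c = nat \<lfloor>y p\<rfloor>"
    have c: "c < b" using y0 yb by (simp add: c_def nat_less_iff floor_less_iff)
    have fr: "frac (y p) = y p - real c" using y0 by (simp add: c_def frac_def)
    have bj: "0 < real (b ^ j)" using b by simp
    have "real u \<le> real (b ^ j) * (y p - real c)" "real (b ^ j) * (y p - real c) < real u + 1"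
      using cell_bounds[of "b ^ j" "y p"] unfolding u fr by auto
    then have "real u / real (b ^ j) \<le> y p - real c" "y p - real c \<le> (real u + 1) / real (b ^ j)"
      using bj by (simp_all add: pos_divide_le_eq pos_le_divide_eq mult.commute)
    then have "real c + real u / real (b ^ j) \<le> y p"
        "y p \<le> (real c + real u / real (b ^ j)) + 1 / real (b ^ j)"
      by (simp_all add: add_divide_distrib)
    then have "(real c + real u / real (b ^ j)) / real b \<le> y p / real b"
        "y p / real b \<le> ((real c + real u / real (b ^ j)) + 1 / real (b ^ j)) / real b"
      by (auto intro: divide_right_mono)
    moreover have "y p / real b = real (\<tau> p) / real (b ^ k)" using b by (simp add: y_def)
    moreover have "((real c + real u / real (b ^ j)) + 1 / real (b ^ j)) / real b
        = (real c + real u / real (b ^ j)) / real b + 1 / real (b ^ (j + 1))"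
      by (simp add: add_divide_distrib)
    ultimately have "lo c \<le> p \<and> p \<le> lo c + l"
      using \<tau>(2)[OF p] unfolding lo_def l_def by linarith
    with c show "\<exists>c\<in>{..<b}. lo c \<le> p \<and> p \<le> lo c + l" by auto
  qed
  have "card {p \<in> P. cell (b ^ j) (y p) = u} \<le> card (\<Union>c<b. {p \<in> P. p \<in> {lo c..lo c + l}})"
    by (rule card_mono[OF _ sub]) (use P in auto)
  also have "\<dots> \<le> (\<Sum>c<b. card {p \<in> P. p \<in> {lo c..lo c + l}})"
    by (rule card_UN_le) simp
  finally have "real (card {p \<in> P. cell (b ^ j) (y p) = u}) \<le>
      real (\<Sum>c<b. card {p \<in> P. p \<in> {lo c..lo c + l}})"
    by (rule of_nat_mono)
  also have "\<dots> = (\<Sum>c<b. real (card {p \<in> P. p \<in> {lo c..lo c + l}}))" by simp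
  also have "\<dots> \<le> (\<Sum>c<b. 1 + l / \<delta>)"
    by (intro sum_mono card_spaced_le[where x = "lo _"]) (use P \<delta> \<eta> spaced in \<open>auto simp: l_def\<close>)
  finally show ?thesis by (simp add: y_def l_def)
qed

text \<open>The points of T form clusters around spaced centres \<open>p t\<close>. Inside a cluster
  the coarse factor is replaced by its maximum and the fine factor is summed over residues modulo
  \<open>b ^ l\<close>; then the maxima are summed over the clusters, whose representatives inherit
  enough spacing. The constant is the product of the two losses \<open>2 K b * 4 b^4\<close> and
  \<open>2 K b * 3 b\<close>.\<close>

lemma digit_prod_hybrid_bound:
  assumes b: "b \<ge> 3" "a0 < b" and L: "real b \<le> L" and K: "K \<ge> 0"
    and L1: "\<And>n. (\<Sum>u<b ^ n. digit_prod b a0 n (real u / real (b ^ n))) \<le> K * L ^ n"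
    and k: "k \<ge> 1" "2 * i + 2 * l \<le> k" and n: "n < k"
    and T: "T \<subseteq> {..<b ^ k}"
    and near: "\<And>t. t \<in> T \<Longrightarrow> \<bar>real t / real (b ^ k) - p t\<bar> \<le> real (b ^ (l + 1)) / real (b ^ k)"
    and spaced: "\<And>t t'. t \<in> T \<Longrightarrow> t' \<in> T \<Longrightarrow> p t \<noteq> p t' \<Longrightarrow> 1 / real (b ^ (2 * i + 2)) \<le> \<bar>p t - p t'\<bar>"
  shows "(\<Sum>t\<in>T. digit_prod b a0 n (real b * (real t / real (b ^ k)))) \<le>
    48 * K\<^sup>2 * real b ^ 7 * real k ^ 2 * (real (b - 1) ^ (k - 1 - (2 * i - 1) - l) * L ^ (2 * i - 1 + l))"
proof -
  \<comment> \<open>One below 2 i, so that \<open>j + l < k\<close> holds even when l = 0 and 2 i =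
    k. For i = 0 the subtraction truncates to 0.\<close>
  define j where "j = 2 * i - 1"
  define x where "x = (\<lambda>t. real b * (real t / real (b ^ k)))"
  define j' where "j' = min j n"
  define m' where "m' = n + 1 + l - k"
  define W where "W = real (b - 1) ^ (k - 1 - j - l)"
  define G where "G = (\<lambda>t. digit_prod b a0 j' (x t))"
  define F where "F = (\<lambda>t. digit_prod b a0 m' (real t / real (b ^ l)))"
  have jl: "j + l < k" using k by (auto simp: j_def)
  have fin: "finite T" using T finite_subset by blast
  have b0: "0 < real b" using b by simp
  define Tp where "Tp = (\<lambda>P. {t \<in> T. p t = P})"
  \<comment> \<open>A representative of the cluster at P that maximises the coarse factor, so that
    this factor can be taken out of the sum over the cluster.\<close>
  have "\<exists>t\<in>Tp P. \<forall>t'\<in>Tp P. G t' \<le> G t" if "P \<in> p ` T" for P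
  proof -
    have ne: "finite (G ` Tp P)" "G ` Tp P \<noteq> {}" using that fin by (auto simp: Tp_def)
    then obtain t where "t \<in> Tp P" "G t = Max (G ` Tp P)"
      using Max_in[OF ne] by (metis imageE)
    then show ?thesis using ne by (intro bexI[of _ t]) auto
  qed
  then obtain \<tau> where \<tau>: "\<And>P. P \<in> p ` T \<Longrightarrow> \<tau> P \<in> Tp P"
      "\<And>P t. P \<in> p ` T \<Longrightarrow> t \<in> Tp P \<Longrightarrow> G t \<le> G (\<tau> P)"
    by metis
  have \<tau>T: "\<tau> P \<in> T" "p (\<tau> P) = P" if "P \<in> p ` T" for P
    using \<tau>(1)[OF that] by (auto simp: Tp_def)
  \<comment> \<open>On the grid of mesh \<open>1 / b ^ l\<close> a cell is a residue class modulo
    \<open>b ^ l\<close>. The cluster is an interval of radius \<open>b ^ (l + 1)\<close>, so each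
    class occurs at most \<open>1 + 2 b\<close> times.\<close>
  have fine: "(\<Sum>t\<in>Tp P. F t) \<le> 2 * K * real b * (3 * real b) * real k * L ^ l" for P
  proof -
    have "(\<Sum>t\<in>Tp P. F t) \<le> 2 * K * real b * (1 + 2 * (real b ^ (l + 1)) / real (b ^ l)) * real (l + 1) * L ^ l"
      unfolding F_def
    proof (rule sum_digit_prod_cells_le[OF b(1) L K L1])
      show "m' \<le> l" using n by (simp add: m'_def)
      fix w
      have "{t \<in> Tp P. cell (b ^ l) (real t / real (b ^ l)) = w} = {t \<in> Tp P. t mod b ^ l = w}"
        using b by (simp add: cell_of_nat_div del: of_nat_power)
      moreover have "real (card {t \<in> Tp P. t mod b ^ l = w}) \<le> 1 + 2 * real b ^ (l + 1) / real (b ^ l)"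
      proof (rule card_residue_in_interval_le)
        fix t assume "t \<in> Tp P"
        then have "\<bar>real t / real (b ^ k) - P\<bar> \<le> real (b ^ (l + 1)) / real (b ^ k)"
          using near by (auto simp: Tp_def)
        then have "\<bar>real t / real (b ^ k) - P\<bar> * real (b ^ k) \<le> real (b ^ (l + 1))"
          using b by (simp add: pos_le_divide_eq)
        moreover have "\<bar>real t / real (b ^ k) - P\<bar> * real (b ^ k) = \<bar>real t - P * real (b ^ k)\<bar>"
        proof -
          have "\<bar>real t / real (b ^ k) - P\<bar> * real (b ^ k) = \<bar>(real t / real (b ^ k) - P) * real (b ^ k)\<bar>"
            by (simp only: abs_mult abs_of_nat)
          then show ?thesis using b by (simp add: left_diff_distrib)
        qed
        ultimately show "\<bar>real t - P * real (b ^ k)\<bar> \<le> real b ^ (l + 1)" by simp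
      qed (use fin b in \<open>auto simp: Tp_def\<close>)
      ultimately show "real (card {t \<in> Tp P. cell (b ^ l) (real t / real (b ^ l)) = w})
          \<le> 1 + 2 * real b ^ (l + 1) / real (b ^ l)" by simp
    qed (use fin in \<open>auto simp: Tp_def\<close>)
    also have "1 + 2 * (real b ^ (l + 1)) / real (b ^ l) = 1 + 2 * real b" using b by simp
    also have "2 * K * real b * (1 + 2 * real b) * real (l + 1) * L ^ l \<le>
        2 * K * real b * (3 * real b) * real k * L ^ l"
      by (intro mult_mono mult_nonneg_nonneg) (use b K L jl in auto)
    finally show ?thesis .
  qed
  \<comment> \<open>Measured in units of the spacing \<open>b ^ (- 2 i - 2)\<close>, a cell of mesh
    \<open>b ^ (- j)\<close> pulled back by b has length at most \<open>b^2\<close>, and the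
    displacement of a representative from its centre is at most \<open>b^3\<close>. Together with
    the b translates this gives \<open>4 b^4\<close> centres per cell.\<close>
  have coarse: "(\<Sum>P\<in>p ` T. G (\<tau> P)) \<le> 2 * K * real b * (4 * real b ^ 4) * real k * L ^ j"
  proof -
    let ?\<eta> = "real (b ^ (l + 1)) / real (b ^ k)" and ?\<delta> = "1 / real (b ^ (2 * i + 2))"
    have M: "real b * (1 + (1 / real (b ^ (j + 1)) + 2 * ?\<eta>) / ?\<delta>) \<le> 4 * real b ^ 4"
    proof -
      have "(1 / real (b ^ (j + 1)) + 2 * ?\<eta>) / ?\<delta> =
          real b ^ (2 * i + 2) / real b ^ (j + 1) + 2 * (real b ^ (2 * i + l + 3) / real b ^ k)"
      proof -
        have "real b ^ (2 * i + l + 3) = real b ^ (l + 1) * real b ^ (2 * i + 2)"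
          unfolding power_add[symmetric] by (rule arg_cong[where f = "power (real b)"]) simp
        then show ?thesis using b0 by (simp add: distrib_right del: power_Suc)
      qed
      also have "real b ^ (2 * i + 2) / real b ^ (j + 1) \<le> real b ^ (j + 3) / real b ^ (j + 1)"
        using b by (intro divide_right_mono power_increasing) (auto simp: j_def)
      also have "real b ^ (j + 3) / real b ^ (j + 1) = real b ^ 2"
        using b by (simp add: power_add power2_eq_square power3_eq_cube)
      also have "real b ^ (2 * i + l + 3) / real b ^ k \<le> real b ^ (k + 3) / real b ^ k"
        using b k by (intro divide_right_mono power_increasing) auto
      also have "real b ^ (k + 3) / real b ^ k = real b ^ 3"
        using b by (simp add: power_add power3_eq_cube)
      finally have "(1 / real (b ^ (j + 1)) + 2 * ?\<eta>) / ?\<delta> \<le> real b ^ 2 + 2 * real b ^ 3" by simp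
      moreover have "real b ^ 2 \<le> real b ^ 3" "1 \<le> real b ^ 3" using b by (auto intro: power_increasing)
      ultimately have "1 + (1 / real (b ^ (j + 1)) + 2 * ?\<eta>) / ?\<delta> \<le> 4 * real b ^ 3" by linarith
      then have "real b * (1 + (1 / real (b ^ (j + 1)) + 2 * ?\<eta>) / ?\<delta>) \<le> real b * (4 * real b ^ 3)"
        by (rule mult_left_mono) simp
      also have "\<dots> = 4 * real b ^ 4" by (simp add: power4_eq_xxxx power3_eq_cube)
      finally show ?thesis .
    qed
    have "(\<Sum>P\<in>p ` T. G (\<tau> P)) \<le> 2 * K * real b * (4 * real b ^ 4) * real (j + 1) * L ^ j"
      unfolding G_def
    proof (rule sum_digit_prod_cells_le[OF b(1) L K L1])
      show "j' \<le> j" by (simp add: j'_def)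
      fix w
      have "real (card {P \<in> p ` T. cell (b ^ j) (x (\<tau> P)) = w}) \<le>
          real b * (1 + (1 / real (b ^ (j + 1)) + 2 * ?\<eta>) / ?\<delta>)"
        unfolding x_def
      proof (rule card_near_spaced_cell_le)
        fix P assume P: "P \<in> p ` T"
        show "\<tau> P < b ^ k" using \<tau>T[OF P] T by auto
        show "\<bar>real (\<tau> P) / real (b ^ k) - P\<bar> \<le> ?\<eta>" using near[OF \<tau>T(1)[OF P]] \<tau>T(2)[OF P] by simp
      qed (use b fin spaced in auto)
      with M show "real (card {P \<in> p ` T. cell (b ^ j) (x (\<tau> P)) = w}) \<le> 4 * real b ^ 4" by linarith
    qed (use fin in auto)
    also have "\<dots> \<le> 2 * K * real b * (4 * real b ^ 4) * real k * L ^ j"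
      by (intro mult_right_mono mult_left_mono) (use b K L jl in auto)
    finally show ?thesis .
  qed
  have W0: "0 \<le> W" by (simp add: W_def)
  have "(\<Sum>t\<in>T. digit_prod b a0 n (x t)) \<le> (\<Sum>t\<in>T. W * (G t * F t))"
    unfolding x_def W_def G_def F_def j'_def m'_def
    by (intro sum_mono digit_prod_split_le jl n) (use b in auto)
  also have "\<dots> = W * (\<Sum>t\<in>T. G t * F t)" by (simp add: sum_distrib_left)
  also have "(\<Sum>t\<in>T. G t * F t) = (\<Sum>P\<in>p ` T. \<Sum>t\<in>Tp P. G t * F t)"
    unfolding Tp_def by (intro sum.image_gen fin)
  also have "\<dots> \<le> (\<Sum>P\<in>p ` T. \<Sum>t\<in>Tp P. G (\<tau> P) * F t)"
    by (intro sum_mono mult_right_mono \<tau>) (auto simp: F_def digit_prod_nonneg)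
  also have "\<dots> = (\<Sum>P\<in>p ` T. G (\<tau> P) * (\<Sum>t\<in>Tp P. F t))" by (simp add: sum_distrib_left)
  also have "\<dots> \<le> (\<Sum>P\<in>p ` T. G (\<tau> P) * (2 * K * real b * (3 * real b) * real k * L ^ l))"
    by (intro sum_mono mult_left_mono fine) (auto simp: G_def digit_prod_nonneg)
  also have "\<dots> = (\<Sum>P\<in>p ` T. G (\<tau> P)) * (2 * K * real b * (3 * real b) * real k * L ^ l)"
    by (simp add: sum_distrib_right)
  also have "\<dots> \<le> (2 * K * real b * (4 * real b ^ 4) * real k * L ^ j) *
      (2 * K * real b * (3 * real b) * real k * L ^ l)"
    by (intro mult_right_mono coarse mult_nonneg_nonneg) (use b K L in auto)
  finally have "(\<Sum>t\<in>T. digit_prod b a0 n (x t)) \<le> W * ((2 * K * real b * (4 * real b ^ 4) * real k * L ^ j) *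
      (2 * K * real b * (3 * real b) * real k * L ^ l))"
    using W0 by (simp add: mult_left_mono)
  also have "\<dots> = 48 * K\<^sup>2 * real b ^ 7 * real k ^ 2 * (W * L ^ (j + l))"
    by (simp add: power2_eq_square power4_eq_xxxx eval_nat_numeral power_add)
  finally show ?thesis by (simp only: x_def W_def j_def)
qed

text \<open>\<open>b powr alpha\<close> is the growth per digit in the L1 bound divided by the
  trivial size \<open>b - 1\<close> of one factor: the price of each digit handled by the L1
  bound.\<close>

lemma powr_alpha:
  assumes "b \<ge> 3" "C > 0"
  shows "real b powr alpha b C = C * real b * ln (real b) / real (b - 1)"
proof -
  have "0 < C * (real b * ln (real b) / (real b - 1))" using assms by auto
  then show ?thesis
    using assms by (simp add: alpha_def powr_def of_nat_diff)
qed

text \<open>The L1 bound is spent on \<open>j + l\<close> digits, where j is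
  \<open>2 * i - 1\<close>, each costing \<open>b powr alpha\<close>. Since
  \<open>j + l \<le> 2 (i + l)\<close>, the loss is symmetric in i and l, which lets it be compared
  with a power of q H. The third factor k comes from adding the partial products of all
  lengths.\<close>

lemma missing_digit_hat_hybrid_bound:
  assumes b: "b \<ge> 3" "a0 < b" and r: "r < b" "r \<in> missing_digit b a0"
    and C: "1 / ln (real b) \<le> C" and K: "K \<ge> 0"
    and L1: "\<And>n. (\<Sum>u<b ^ n. digit_prod b a0 n (real u / real (b ^ n))) \<le> K * (C * real b * ln (real b)) ^ n"
    and k: "k \<ge> 1" "2 * i + 2 * l \<le> k"
    and T: "T \<subseteq> {..<b ^ k}"
    and near: "\<And>t. t \<in> T \<Longrightarrow> \<bar>real t / real (b ^ k) - p t\<bar> \<le> real (b ^ (l + 1)) / real (b ^ k)"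
    and spaced: "\<And>t t'. t \<in> T \<Longrightarrow> t' \<in> T \<Longrightarrow> p t \<noteq> p t' \<Longrightarrow> 1 / real (b ^ (2 * i + 2)) \<le> \<bar>p t - p t'\<bar>"
  shows "(\<Sum>t\<in>T. norm (missing_digit_hat b a0 r k (real t / real (b ^ k)))) \<le>
    48 * K\<^sup>2 * real b ^ 7 * real k ^ 3 * real (b - 1) ^ k * real b powr (2 * alpha b C * real (i + l))"
proof -
  define L where "L = C * real b * ln (real b)"
  have lnb: "0 < ln (real b)" using b by simp
  then have C0: "0 < C" using C by (smt (verit) divide_pos_pos)
  have "1 \<le> C * ln (real b)" using C lnb by (simp add: divide_le_eq)
  then have L: "real b \<le> L" using b by (simp add: L_def mult.commute mult.left_commute mult_left_mono)
  define \<Lambda> where "\<Lambda> = real b powr alpha b C"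
  have \<Lambda>: "\<Lambda> = L / real (b - 1)" using powr_alpha[OF b(1) C0] by (simp add: \<Lambda>_def L_def)
  have "1 \<le> \<Lambda>" unfolding \<Lambda> using L b by (simp add: pos_le_divide_eq of_nat_diff)
  define j where "j = 2 * i - 1"
  have jl: "j + l < k" using k by (auto simp: j_def)
  define B where "B = 48 * K\<^sup>2 * real b ^ 7 * real k ^ 2 * (real (b - 1) ^ (k - 1 - j - l) * L ^ (j + l))"
  have hyb: "(\<Sum>t\<in>T. digit_prod b a0 n (real b * (real t / real (b ^ k)))) \<le> B" if "n < k" for n
    unfolding B_def j_def
    by (rule digit_prod_hybrid_bound[OF b L K _ k that T near spaced]) (use L1 in \<open>auto simp: L_def\<close>)
  have "(\<Sum>t\<in>T. norm (missing_digit_hat b a0 r k (real t / real (b ^ k)))) \<le>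
      (\<Sum>t\<in>T. \<Sum>n\<le>k - 1. digit_prod b a0 n (real b * (real t / real (b ^ k))))"
  proof (rule sum_mono)
    fix t
    show "norm (missing_digit_hat b a0 r k (real t / real (b ^ k))) \<le>
        (\<Sum>n\<le>k - 1. digit_prod b a0 n (real b * (real t / real (b ^ k))))"
      using norm_missing_digit_hat_le[of b r a0 "k - 1" "real t / real (b ^ k)"] b r k
      by (simp del: of_nat_power)
  qed
  also have "\<dots> = (\<Sum>n\<le>k - 1. \<Sum>t\<in>T. digit_prod b a0 n (real b * (real t / real (b ^ k))))"
    by (rule sum.swap)
  also have "\<dots> \<le> (\<Sum>n\<le>k - 1. B)" using k by (intro sum_mono hyb) auto
  also have "\<dots> = 48 * K\<^sup>2 * real b ^ 7 * real k ^ 3 * (real (b - 1) ^ (k - 1 - j - l) * L ^ (j + l))"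
    using k by (simp add: B_def power2_eq_square power3_eq_cube)
  also have "real (b - 1) ^ (k - 1 - j - l) * L ^ (j + l) = real (b - 1) ^ (k - 1) * \<Lambda> ^ (j + l)"
  proof -
    have "L = \<Lambda> * real (b - 1)" using b by (simp add: \<Lambda>)
    then have "real (b - 1) ^ (k - 1 - j - l) * L ^ (j + l) =
        real (b - 1) ^ (k - 1 - j - l + (j + l)) * \<Lambda> ^ (j + l)"
      by (simp only: power_mult_distrib power_add mult_ac)
    also have "k - 1 - j - l + (j + l) = k - 1" using jl by simp
    finally show ?thesis .
  qed
  also have "48 * K\<^sup>2 * real b ^ 7 * real k ^ 3 * (real (b - 1) ^ (k - 1) * \<Lambda> ^ (j + l)) \<le>
      48 * K\<^sup>2 * real b ^ 7 * real k ^ 3 * (real (b - 1) ^ k * \<Lambda> ^ (2 * (i + l)))"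
    using b \<open>1 \<le> \<Lambda>\<close> by (intro mult_left_mono mult_mono power_increasing) (auto simp: j_def)
  also have "\<Lambda> ^ (2 * (i + l)) = real b powr (2 * alpha b C * real (i + l))"
    using b by (simp add: \<Lambda>_def powr_powr flip: powr_realpow) (simp add: algebra_simps)
  finally show ?thesis by (simp only: mult.assoc)
qed

section \<open>Small Fourier coefficients and divisor sums\<close>

text \<open>
  Away from the integers two consecutive admissible digits already produce cancellation.
\<close>
definition digit_gap :: "nat \<Rightarrow> real" where
  "digit_gap b = (real b - 3 + 2 * cos (pi / (2 * real b))) / real (b - 1)"

lemma digit_gap_bounds:
  assumes "b \<ge> 4"
  shows "0 < digit_gap b" "digit_gap b < 1"
proof -
  have pb: "0 < pi / (2 * real b)" "pi / (2 * real b) < pi / 2"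
    using assms by (simp_all add: field_simps)
  have "cos (pi / (2 * real b)) < cos 0"
    using pb by (intro cos_monotone_0_pi) auto
  then show "digit_gap b < 1" using assms by (simp add: digit_gap_def of_nat_diff)
  have "0 < cos (pi / (2 * real b))" using pb by (intro cos_gt_zero) auto
  then show "0 < digit_gap b" using assms by (simp add: digit_gap_def)
qed

definition far_from_int :: "nat \<Rightarrow> real \<Rightarrow> bool" where
  "far_from_int b x \<longleftrightarrow> 1 / (2 * real b) \<le> frac x \<and> frac x \<le> 1 - 1 / (2 * real b)"

lemma norm_digit_sum_far_le:
  assumes b: "b \<ge> 4" "a0 < b" and far: "far_from_int b x"
  shows "norm (digit_sum b a0 x) \<le> real (b - 1) * digit_gap b"
proof -
  \<comment> \<open>Two consecutive digits that avoid the forbidden one: 0 and 1, or 2 and 3. They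
    contribute \<open>1 + e x\<close> up to a phase, and the other \<open>b - 3\<close> digits are
    bounded trivially.\<close>
  define d where "d = (if a0 \<ge> 2 then 0 else 2::nat)"
  define S where "S = {..<b} - {a0}"
  have d: "d \<in> S" "Suc d \<in> S" using b by (auto simp: d_def S_def)
  have S: "finite S" "card S = b - 1" using b by (auto simp: S_def)
  define S' where "S' = S - {d} - {Suc d}"
  define F where "F = (\<lambda>i. e (real i * x))"
  have "(\<Sum>i\<in>S. F i) = F d + (\<Sum>i\<in>S - {d}. F i)"
    by (rule sum.remove[OF S(1) d(1)])
  also have "(\<Sum>i\<in>S - {d}. F i) = F (Suc d) + (\<Sum>i\<in>S'. F i)"
    unfolding S'_def by (rule sum.remove) (use S d in auto)
  also have "F (Suc d) = F d * e x" by (simp add: F_def algebra_simps flip: e_add)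
  finally have eq: "digit_sum b a0 x = F d * (1 + e x) + (\<Sum>i\<in>S'. F i)"
    unfolding digit_sum_def S_def[symmetric] F_def[symmetric] by (simp add: distrib_left)
  have "norm (digit_sum b a0 x) \<le> norm (F d * (1 + e x)) + norm (\<Sum>i\<in>S'. F i)"
    unfolding eq by (rule norm_triangle_ineq)
  also have "norm (F d * (1 + e x)) = norm (1 + e x)" by (simp add: norm_mult F_def)
  also have "norm (\<Sum>i\<in>S'. F i) \<le> (\<Sum>i\<in>S'. 1)"
    by (rule sum_norm_le) (simp add: F_def)
  also have "(\<Sum>i\<in>S'. 1) = real b - 3"
  proof -
    have "card S' = b - 1 - 1 - 1" using S d by (simp add: S'_def)
    then show ?thesis using b by (simp add: of_nat_diff)
  qed
  also have "norm (1 + e x) \<le> 2 * cos (pi / (2 * real b))"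
  proof -
    define y where "y = frac x"
    have y: "1 / (2 * real b) \<le> y" "y \<le> 1 - 1 / (2 * real b)"
      using far by (auto simp: far_from_int_def y_def)
    have *: "\<bar>cos (pi * z)\<bar> \<le> cos (pi / (2 * real b))" if "1 / (2 * real b) \<le> z" "z \<le> 1 / 2" for z
    proof -
      have z0: "0 \<le> z" using that(1) by (rule order.trans[rotated]) simp
      have "pi * (1 / (2 * real b)) \<le> pi * z" by (rule mult_left_mono[OF that(1)]) simp
      moreover have "pi * z \<le> pi * (1 / 2)" by (rule mult_left_mono[OF that(2)]) simp
      moreover have "0 \<le> pi / (2 * real b)" by simp
      moreover have "- (pi / 2) \<le> pi * z" by (rule order.trans[of "- (pi / 2)" 0]) (use z0 in auto)
      moreover have "pi * z \<le> pi" using calculation(2) pi_gt_zero by linarith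
      moreover have "pi / (2 * real b) \<le> pi * z" using calculation(1) by simp
      ultimately have "cos (pi * z) \<le> cos (pi / (2 * real b))"
        by (intro cos_monotone_0_pi_le)
      moreover have "0 \<le> cos (pi * z)"
        using \<open>- (pi / 2) \<le> pi * z\<close> \<open>pi * z \<le> pi * (1 / 2)\<close> by (intro cos_ge_zero) simp_all
      ultimately show ?thesis by simp
    qed
    have "\<bar>cos (pi * y)\<bar> \<le> cos (pi / (2 * real b))"
    proof (cases "y \<le> 1 / 2")
      case True
      then show ?thesis using * y by simp
    next
      case False
      have "cos (pi * y) = - cos (pi * (1 - y))"
        using cos_pi_minus[of "pi * (1 - y)"] by (simp add: algebra_simps)
      then show ?thesis using *[of "1 - y"] y False by simp
    qed
    then have "norm (1 + e y) \<le> 2 * cos (pi / (2 * real b))" by (simp add: norm_one_plus_e)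
    then show ?thesis by (simp add: y_def e_frac)
  qed
  finally show ?thesis using b by (simp add: digit_gap_def)
qed

text \<open>A point within \<open>1 / (2 b)\<close> of an integer m' is sent by multiplication by b
  to within 1/2 of \<open>b m'\<close>. Closeness to integers at consecutive scales therefore always
  refers to the same integer, and the bound shrinks by b at each step.\<close>

lemma not_far_near_int:
  assumes b: "b \<ge> 1" and "\<And>i. i < J \<Longrightarrow> \<not> far_from_int b (real (b ^ i) * x)"
  shows "\<exists>m::int. \<bar>x - of_int m\<bar> \<le> 1 / (2 * real (b ^ J))"
  using assms(2)
proof (induction J arbitrary: x)
  case 0
  have "\<bar>x - of_int (round x)\<bar> \<le> 1 / 2"
    using of_int_round_abs_le[of x] by (simp add: abs_minus_commute)
  then show ?case by auto
next
  case (Suc J)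
  have "\<not> far_from_int b (real (b ^ i) * (real b * x))" if "i < J" for i
    using Suc.prems[of "Suc i"] that by (simp add: mult_ac)
  from Suc.IH[OF this] obtain m :: int where m: "\<bar>real b * x - of_int m\<bar> \<le> 1 / (2 * real (b ^ J))"
    by blast
  have "1 / (2 * real (b ^ J)) \<le> 1 / 2" using b by simp
  with m have m': "\<bar>real b * x - of_int m\<bar> \<le> 1 / 2" by linarith
  have nf: "\<not> far_from_int b x" using Suc.prems[of 0] by simp
  have "\<exists>m'::int. \<bar>x - of_int m'\<bar> < 1 / (2 * real b)"
  proof (cases "frac x < 1 / (2 * real b)")
    case True
    then have "\<bar>x - of_int \<lfloor>x\<rfloor>\<bar> < 1 / (2 * real b)" by (simp add: frac_def)
    then show ?thesis by blast
  next
    case False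
    then have "1 - 1 / (2 * real b) < frac x" using nf by (auto simp: far_from_int_def)
    then have "\<bar>x - of_int (\<lfloor>x\<rfloor> + 1)\<bar> < 1 / (2 * real b)"
      using frac_lt_1[of x] by (simp add: frac_def abs_if)
    then show ?thesis by blast
  qed
  then obtain m' :: int where x: "\<bar>x - of_int m'\<bar> < 1 / (2 * real b)" by blast
  have eq: "\<bar>real b * x - of_int (int b * m')\<bar> = real b * \<bar>x - of_int m'\<bar>"
    using b by (simp add: abs_mult flip: right_diff_distrib)
  also have "\<dots> < real b * (1 / (2 * real b))" using x b by (intro mult_strict_left_mono) auto
  also have "\<dots> = 1 / 2" using b by simp
  \<comment> \<open>Both integers lie within 1/2 of \<open>b x\<close>, one of them strictly, so
    they agree.\<close>
  finally have "\<bar>real_of_int m - of_int (int b * m')\<bar> < 1" using m' by linarith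
  then have "m = int b * m'" by linarith
  with m eq have "real b * \<bar>x - of_int m'\<bar> \<le> 1 / (2 * real (b ^ J))" by simp
  then have "\<bar>x - of_int m'\<bar> \<le> 1 / (2 * real (b ^ Suc J))"
    using b by (simp add: field_simps)
  then show ?case by blast
qed

lemma digit_prod_block_le:
  assumes b: "b \<ge> 4" "a0 < b" and x: "\<And>m::int. 1 / (2 * real (b ^ J)) < \<bar>x - of_int m\<bar>"
  shows "digit_prod b a0 J x \<le> real (b - 1) ^ J * digit_gap b"
proof -
  obtain i where i: "i < J" "far_from_int b (real (b ^ i) * x)"
    using not_far_near_int[of b J x] x b by (meson leD le_trans one_le_numeral)
  have "digit_prod b a0 J x = norm (digit_sum b a0 (real (b ^ i) * x)) *
      (\<Prod>l\<in>{..<J} - {i}. norm (digit_sum b a0 (real (b ^ l) * x)))"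
    unfolding digit_prod_def using i by (intro prod.remove) auto
  also have "\<dots> \<le> (real (b - 1) * digit_gap b) * (\<Prod>l\<in>{..<J} - {i}. real (b - 1))"
    using digit_gap_bounds[OF b(1)]
    by (intro mult_mono prod_mono conjI norm_ge_zero norm_digit_sum_far_le[OF b i(2)]
        norm_digit_sum_le[OF b(2)] prod_nonneg) auto
  also have "\<dots> = real (b - 1) ^ J * digit_gap b"
    using i by (simp add: card_Diff_subset power_eq_if mult_ac)
  finally show ?thesis .
qed

lemma digit_prod_blocks_le:
  assumes b: "b \<ge> 4" "a0 < b"
    and x: "\<And>i m. i < c \<Longrightarrow> 1 / (2 * real (b ^ J)) < \<bar>real (b ^ (i * J)) * x - of_int m\<bar>"
  shows "digit_prod b a0 (c * J) x \<le> real (b - 1) ^ (c * J) * digit_gap b ^ c"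
  using x
proof (induction c)
  case 0
  then show ?case by (simp add: digit_prod_def)
next
  case (Suc c)
  have "digit_prod b a0 (Suc c * J) x = digit_prod b a0 (c * J) x * digit_prod b a0 J (real (b ^ (c * J)) * x)"
    using digit_prod_add[of b a0 "c * J" J x] by (simp add: add.commute)
  also have "\<dots> \<le> (real (b - 1) ^ (c * J) * digit_gap b ^ c) * (real (b - 1) ^ J * digit_gap b)"
    using digit_gap_bounds[OF b(1)] Suc
    by (intro mult_mono digit_prod_block_le[OF b] digit_prod_nonneg) auto
  finally show ?case by (simp add: power_add mult_ac)
qed

text \<open>If q does not divide \<open>b ^ k\<close>, no \<open>b ^ i * h / q\<close> with i at
  most k is an integer, so it stays at distance at least \<open>1 / q\<close> from the integers. The
  error in \<theta> is too small to destroy this as long as \<open>i + J \<le> k\<close>, so every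
  block of J digits contains a factor that saves \<open>digit_gap b\<close>.\<close>

lemma missing_digit_hat_minor_le:
  assumes b: "b \<ge> 4" "a0 < b" and r: "r < b" "r \<in> missing_digit b a0"
    and k: "k \<ge> 1" and J: "J \<ge> 1" "J\<^sup>2 \<le> k" and R: "2 * R\<^sup>2 \<le> b ^ J"
    and q: "1 \<le> q" "q \<le> R" "coprime h (int q)" "\<not> q dvd b ^ k"
    and near: "\<bar>\<theta> - of_int h / real q\<bar> \<le> real R / real (b ^ k)"
  shows "norm (missing_digit_hat b a0 r k \<theta>) \<le>
    real k * real (b - 1) ^ k * (digit_gap b ^ (J - 1) + 1 / real (b - 1) ^ J)"
proof -
  have R1: "1 \<le> R" using q by simp
  have far: "1 / (2 * real (b ^ J)) < \<bar>real (b ^ i) * \<theta> - of_int m\<bar>" if i: "i + J \<le> k" for i and m :: int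
  proof -
    have nd: "\<not> int q dvd int (b ^ i) * h"
    proof
      assume "int q dvd int (b ^ i) * h"
      then have "int q dvd int (b ^ i)"
        using q(3) by (simp add: coprime_commute coprime_dvd_mult_left_iff)
      then have "q dvd b ^ i" by (simp only: int_dvd_int_iff)
      then have "q dvd b ^ k" using i by (meson dvd_trans le_add1 le_imp_power_dvd le_trans)
      with q(4) show False by simp
    qed
    have "int (b ^ i) * h - m * int q \<noteq> 0" using nd by (metis dvd_triv_right eq_iff_diff_eq_0)
    then have "1 \<le> \<bar>int (b ^ i) * h - m * int q\<bar>" by linarith
    then have "1 \<le> \<bar>real_of_int (int (b ^ i) * h - m * int q)\<bar>" by linarith
    then have "1 / real q \<le> \<bar>real_of_int (int (b ^ i) * h - m * int q)\<bar> / real q"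
      by (intro divide_right_mono) auto
    also have "\<dots> = \<bar>real_of_int (int (b ^ i) * h - m * int q) / real q\<bar>" by (simp add: abs_divide)
    also have "real_of_int (int (b ^ i) * h - m * int q) / real q =
        real (b ^ i) * (of_int h / real q) - of_int m"
      using q by (simp add: field_simps)
    finally have 1: "1 / real q \<le> \<bar>real (b ^ i) * (of_int h / real q) - of_int m\<bar>" .
    have "1 / real R \<le> 1 / real q" using q by (intro divide_left_mono) auto
    with 1 have 1: "1 / real R \<le> \<bar>real (b ^ i) * (of_int h / real q) - of_int m\<bar>" by linarith
    have "\<bar>real (b ^ i) * \<theta> - real (b ^ i) * (of_int h / real q)\<bar> = real (b ^ i) * \<bar>\<theta> - of_int h / real q\<bar>"
      unfolding right_diff_distrib[symmetric] abs_mult by simp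
    also have "\<dots> \<le> real (b ^ i) * (real R / real (b ^ k))" by (intro mult_left_mono near) simp
    also have "\<dots> \<le> real R / real (b ^ J)"
    proof -
      have "real b ^ (i + J) \<le> real b ^ k" using i b by (intro power_increasing) auto
      then show ?thesis using b R1 by (simp add: field_simps power_add mult_left_mono)
    qed
    finally have 2: "\<bar>real (b ^ i) * \<theta> - real (b ^ i) * (of_int h / real q)\<bar> \<le> real R / real (b ^ J)" .
    have "real (2 * R\<^sup>2) \<le> real (b ^ J)" using R by (simp only: of_nat_le_iff)
    then have R': "2 * (real R)\<^sup>2 \<le> real (b ^ J)" by simp
    have bJ: "0 < real (b ^ J)" using b by simp
    \<comment> \<open>\<open>2 R^2 \<le> b ^ J\<close> keeps the perturbation at most half of
      \<open>1 / R\<close>, and the other half still exceeds \<open>1 / (2 b ^ J)\<close>.\<close>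
    have "real R / real (b ^ J) \<le> 1 / (2 * real R)"
      using R' R1 bJ by (simp add: divide_le_eq pos_le_divide_eq power2_eq_square mult_ac del: of_nat_power)
    moreover have "1 / (2 * real (b ^ J)) < 1 / (2 * real R)"
    proof -
      have "real R * 1 \<le> real R * real R" using R1 by (intro mult_left_mono) auto
      then have "real R < 2 * (real R)\<^sup>2" using R1 by (simp add: power2_eq_square)
      then have "real R < real (b ^ J)" using R' by linarith
      then show ?thesis using R1 b by (intro divide_strict_left_mono) auto
    qed
    moreover have "1 / real R = 1 / (2 * real R) + 1 / (2 * real R)" by (simp add: field_simps)
    moreover have "v < \<bar>x - z\<bar>" if "\<bar>x - y\<bar> \<le> w" "w \<le> u" "v < u" "u' \<le> \<bar>y - z\<bar>" "u' = u + u"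
      for u u' v w x y z :: real
      using that by linarith
    ultimately show ?thesis using 1 2 by blast
  qed
  \<comment> \<open>Using only \<open>J - 1\<close> of the J blocks that fit into k digits leaves
    room for the shift by the fixed last digit. It also makes every product with fewer than N
    factors fall short of k by at least J.\<close>
  define N where "N = (J - 1) * J"
  have Nk: "N + J \<le> k" using J by (cases J) (auto simp: N_def power2_eq_square)
  have DN: "digit_prod b a0 N (real b * \<theta>) \<le> real (b - 1) ^ N * digit_gap b ^ (J - 1)"
    unfolding N_def
  proof (rule digit_prod_blocks_le[OF b])
    fix i and m :: int assume i: "i < J - 1"
    then have "(i + 1) * J \<le> (J - 1) * J" by (intro mult_right_mono) auto
    then have "(1 + i * J) + J \<le> k" using Nk J i unfolding N_def by (simp add: algebra_simps)
    from far[OF this, of m] show "1 / (2 * real (b ^ J)) < \<bar>real (b ^ (i * J)) * (real b * \<theta>) - of_int m\<bar>"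
      by (simp add: mult_ac)
  qed
  have b1: "1 \<le> real (b - 1)" using b by simp
  note gap = digit_gap_bounds[OF b(1)]
  \<comment> \<open>A product containing all blocks gains the power of the gap; a shorter one is
    smaller than \<open>(b - 1) ^ k\<close> by \<open>(b - 1) ^ J\<close> simply because of its
    length.\<close>
  have D: "digit_prod b a0 n (real b * \<theta>) \<le>
      real (b - 1) ^ k * (digit_gap b ^ (J - 1) + 1 / real (b - 1) ^ J)" if n: "n \<le> k - 1" for n
  proof (cases "N \<le> n")
    case True
    have "digit_prod b a0 n (real b * \<theta>) =
        digit_prod b a0 N (real b * \<theta>) * digit_prod b a0 (n - N) (real (b ^ N) * (real b * \<theta>))"
      using digit_prod_add[of b a0 N "n - N"] True by simp
    also have "\<dots> \<le> (real (b - 1) ^ N * digit_gap b ^ (J - 1)) * real (b - 1) ^ (n - N)"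
      using gap by (intro mult_mono DN digit_prod_le b digit_prod_nonneg mult_nonneg_nonneg) auto
    also have "\<dots> = real (b - 1) ^ n * digit_gap b ^ (J - 1)"
      using True by (simp add: mult_ac flip: power_add)
    also have "\<dots> \<le> real (b - 1) ^ k * digit_gap b ^ (J - 1)"
      using gap b1 n by (intro mult_right_mono power_increasing) auto
    also have "\<dots> \<le> real (b - 1) ^ k * (digit_gap b ^ (J - 1) + 1 / real (b - 1) ^ J)"
      by (intro mult_left_mono) auto
    finally show ?thesis .
  next
    case False
    have "digit_prod b a0 n (real b * \<theta>) \<le> real (b - 1) ^ n" by (intro digit_prod_le b)
    also have "\<dots> \<le> real (b - 1) ^ (k - J)" using b1 Nk False by (intro power_increasing) auto
    also have "\<dots> = real (b - 1) ^ k * (1 / real (b - 1) ^ J)"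
      using b1 Nk by (simp add: power_diff)
    also have "\<dots> \<le> real (b - 1) ^ k * (digit_gap b ^ (J - 1) + 1 / real (b - 1) ^ J)"
      using gap by (intro mult_left_mono) auto
    finally show ?thesis .
  qed
  have "norm (missing_digit_hat b a0 r k \<theta>) \<le> (\<Sum>n\<le>k - 1. digit_prod b a0 n (real b * \<theta>))"
    using norm_missing_digit_hat_le[of b r a0 "k - 1" \<theta>] b r k by simp
  also have "\<dots> \<le> (\<Sum>n\<le>k - 1. real (b - 1) ^ k * (digit_gap b ^ (J - 1) + 1 / real (b - 1) ^ J))"
    by (intro sum_mono D) simp
  also have "\<dots> = real k * real (b - 1) ^ k * (digit_gap b ^ (J - 1) + 1 / real (b - 1) ^ J)"
    using k by (simp add: of_nat_diff mult.assoc)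
  finally show ?thesis .
qed

text \<open>Summation by parts: consecutive powers of z differ by \<open>norm (1 - z)\<close>. A
  slowly rotating phase is thus removed at the price of bounding all partial sums.\<close>

lemma norm_sum_power_le:
  fixes a :: "nat \<Rightarrow> complex"
  assumes z: "norm z = 1" and M: "\<And>n. n \<le> N \<Longrightarrow> norm (\<Sum>i<n. a i) \<le> M"
  shows "norm (\<Sum>n<N. a n * z ^ n) \<le> M * (1 + real N * norm (1 - z))"
proof -
  define A where "A = (\<lambda>n. \<Sum>i<n. a i)"
  have eq: "(\<Sum>n<N. a n * z ^ n) = A N * z ^ N + (\<Sum>n<N. A (Suc n) * (z ^ n * (1 - z)))"
    by (induction N) (simp_all add: A_def algebra_simps)
  have "norm (\<Sum>n<N. A (Suc n) * (z ^ n * (1 - z))) \<le> (\<Sum>n<N. M * norm (1 - z))"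
    by (intro sum_norm_le) (auto simp: norm_mult norm_power z A_def intro!: mult_right_mono M simp del: sum.lessThan_Suc)
  moreover have "norm (A N * z ^ N) \<le> M" using M[of N] by (simp add: norm_mult norm_power z A_def)
  ultimately show ?thesis
    unfolding eq by (intro order.trans[OF norm_triangle_ineq]) (simp add: algebra_simps)
qed

section \<open>Divisor sums and integers close to fractions with small denominator\<close>

lemma divisor_fun_mult_le:
  assumes "x > 0" "y > 0"
  shows "divisor_fun (x * y) \<le> divisor_fun x * divisor_fun y"
proof -
  have "{d. d dvd x * y} \<subseteq> (\<lambda>(u, v). u * v) ` ({d. d dvd x} \<times> {d. d dvd y})"
  proof
    fix d assume "d \<in> {d. d dvd x * y}"
    then obtain u v where "d = u * v" "u dvd x" "v dvd y" using division_decomp by blast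
    then show "d \<in> (\<lambda>(u, v). u * v) ` ({d. d dvd x} \<times> {d. d dvd y})" by force
  qed
  then have "card {d. d dvd x * y} \<le> card ({d. d dvd x} \<times> {d. d dvd y})"
    using assms by (intro surj_card_le finite_cartesian_product) auto
  then show ?thesis by (simp add: divisor_fun_def card_cartesian_product)
qed

lemma divisor_fun_ge_1:
  assumes "n > 0"
  shows "1 \<le> divisor_fun n"
proof -
  have "card {1::nat} \<le> card {d. d dvd n}" using assms by (intro card_mono) auto
  then show ?thesis by (simp add: divisor_fun_def)
qed

text \<open>One factor of the divisor function is opened as a sum over factorisations d = x y, and
  submultiplicativity separates the remaining weight. Each step therefore squares the bound.\<close>

lemma sum_divisor_fun_power_le:
  "(\<Sum>d\<in>{1..n}. real (divisor_fun d) ^ m / real d) \<le> harm n ^ (2 ^ m)"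
proof (induction m)
  case 0
  then show ?case by (simp add: harm_def inverse_eq_divide)
next
  case (Suc m)
  define H where "H = (\<lambda>d. real (divisor_fun d) ^ m / real d)"
  have "(\<Sum>d\<in>{1..n}. real (divisor_fun d) ^ Suc m / real d) = (\<Sum>d\<in>{1..n}. \<Sum>x | x dvd d. H d)"
    by (intro sum.cong refl) (simp add: H_def divisor_fun_def)
  also have "\<dots> = (\<Sum>(d, x)\<in>(SIGMA d:{1..n}. {x. x dvd d}). H d)"
    by (intro sum.Sigma) auto
  also have "\<dots> \<le> (\<Sum>(x, y)\<in>{1..n} \<times> {1..n}. H x * H y)"
  proof (rule sum_le_included[where i = "\<lambda>(x, y). (x * y, x)"])
    show "\<forall>z\<in>SIGMA d:{1..n}. {x. x dvd d}. \<exists>w\<in>{1..n} \<times> {1..n}.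
        (\<lambda>(x, y). (x * y, x)) w = z \<and> (case z of (d, x) \<Rightarrow> H d) \<le> (case w of (x, y) \<Rightarrow> H x * H y)"
    proof clarsimp
      fix d x assume d: "Suc 0 \<le> d" "d \<le> n" and "x dvd d"
      then obtain y where y: "d = x * y" by auto
      have xy: "0 < x" "0 < y" using d y by auto
      have le: "x \<le> n" "y \<le> n" using d xy y by (auto intro: dvd_imp_le order.trans[of _ d])
      have "real (divisor_fun d) \<le> real (divisor_fun x * divisor_fun y)"
        unfolding y using divisor_fun_mult_le[OF xy] by (simp only: of_nat_le_iff)
      then have "real (divisor_fun d) ^ m / real d \<le> real (divisor_fun x * divisor_fun y) ^ m / real d"
        by (intro divide_right_mono power_mono) auto
      also have "\<dots> = H x * H y" by (simp add: H_def y power_mult_distrib)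
      finally have "H d \<le> H x * H y" by (simp add: H_def)
      then show "\<exists>xa\<in>{Suc 0..n}. \<exists>y\<in>{Suc 0..n}. xa * y = d \<and> xa = x \<and> H d \<le> H xa * H y"
        using le xy y by (intro bexI[of _ x] bexI[of _ y]) auto
    qed
  qed (auto simp: H_def)
  also have "\<dots> = (\<Sum>x\<in>{1..n}. H x) * (\<Sum>y\<in>{1..n}. H y)"
    by (simp add: sum_product sum.cartesian_product)
  also have "\<dots> \<le> harm n ^ 2 ^ m * harm n ^ 2 ^ m"
    using Suc by (intro mult_mono) (auto simp: H_def sum_nonneg harm_nonneg)
  finally show ?case by (simp add: mult_2 power_add)
qed

text \<open>In the identity expressing d as the sum of the totients of its divisors, no term exceeds
  the totient of d. So \<open>1 / totient d\<close> costs one more divisor function, which the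
  weighted sums can afford.\<close>

lemma le_totient_mult_divisor_fun:
  assumes "d > 0"
  shows "d \<le> totient d * divisor_fun d"
proof -
  have "d = (\<Sum>c | c dvd d. totient c)" by (simp add: totient_divisor_sum)
  also have "\<dots> \<le> (\<Sum>c | c dvd d. totient d)"
    using assms by (intro sum_mono totient_dvd_mono) auto
  finally show ?thesis by (simp add: divisor_fun_def mult.commute)
qed

text \<open>t is determined by q, h and its offset from the integer part of \<open>h X / q\<close>.
  The fraction lies in [-1, 2], which leaves \<open>3 R + 1\<close> values of h, and there are
  \<open>2 R + 2\<close> offsets.\<close>

lemma card_near_fractions_le:
  assumes X: "X > 0" and R: "1 \<le> R" "R \<le> X"
  shows "card {t. t < X \<and> (\<exists>h q. 1 \<le> q \<and> q \<le> R \<and>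
    \<bar>real t / real X - of_int h / real q\<bar> \<le> real R / real X)} \<le> 16 * R ^ 3"
proof -
  let ?M = "{t. t < X \<and> (\<exists>(h::int) (q::nat). 1 \<le> q \<and> q \<le> R \<and>
    \<bar>real t / real X - of_int h / real q\<bar> \<le> real R / real X)}"
  let ?S = "{1..R} \<times> {- int R..2 * int R} \<times> {- int R..int R + 1}"
  let ?f = "\<lambda>(q, h, z). nat (\<lfloor>of_int h * real X / real q\<rfloor> + z)"
  have "?M \<subseteq> ?f ` ?S"
  proof clarify
    fix t h q assume t: "t < X" and q: "1 \<le> q" "q \<le> R"
      and near: "\<bar>real t / real X - of_int h / real q\<bar> \<le> real R / real X"
    have "real R / real X \<le> 1" using R X by simp
    moreover have "0 \<le> real t / real X" "real t / real X \<le> 1" using t by auto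
    ultimately have "- 1 \<le> of_int h / real q" "of_int h / real q \<le> 2"
      using near by linarith+
    then have "- real q \<le> of_int h" "of_int h \<le> 2 * real q"
      using q by (simp_all add: pos_le_divide_eq pos_divide_le_eq)
    then have h: "- int R \<le> h" "h \<le> 2 * int R" using q by linarith+
    have "\<bar>real t / real X - of_int h / real q\<bar> * real X \<le> real R"
      using near X by (simp add: pos_le_divide_eq)
    moreover have "\<bar>real t / real X - of_int h / real q\<bar> * real X = \<bar>(real t / real X - of_int h / real q) * real X\<bar>"
      by (simp add: abs_mult)
    moreover have "(real t / real X - of_int h / real q) * real X = real t - of_int h * real X / real q"
      using X by (simp add: field_simps)
    ultimately have "\<bar>real t - of_int h * real X / real q\<bar> \<le> real R" by simp
    then have z: "- int R \<le> int t - \<lfloor>of_int h * real X / real q\<rfloor>"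
        "int t - \<lfloor>of_int h * real X / real q\<rfloor> \<le> int R + 1"
      by linarith+
    have "t = ?f (q, h, int t - \<lfloor>of_int h * real X / real q\<rfloor>)" by simp
    moreover have "(q, h, int t - \<lfloor>of_int h * real X / real q\<rfloor>) \<in> ?S" using q h z by auto
    ultimately show "t \<in> ?f ` ?S" by blast
  qed
  then have "card ?M \<le> card ?S" by (intro surj_card_le) auto
  also have "\<dots> = R * ((3 * R + 1) * (2 * R + 2))"
    by (simp add: card_cartesian_product nat_add_distrib nat_mult_distrib)
  also have "\<dots> \<le> R * ((4 * R) * (4 * R))" using R by (intro mult_mono) auto
  also have "\<dots> = 16 * R ^ 3" by (simp add: power3_eq_cube)
  finally show ?thesis .
qed

section \<open>Fourier expansion of the discrepancy\<close>

lemma card_residue_class_bounds: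
  assumes "m < q"
  shows "\<bar>real (card {n. n < y \<and> n mod q = m}) - real y / real q\<bar> \<le> 1"
proof -
  have q0: "q > 0" using assms by simp
  have "real (card {n. n < y \<and> n mod q = m}) \<le> real y / real q + 1"
  proof -
    have "real (card {n \<in> {..<y}. n mod q = m}) \<le> 1 + 2 * (real y / 2) / real q"
    proof (rule card_residue_in_interval_le)
      fix n assume "n \<in> {..<y}"
      then have "real n \<le> real y" by simp
      then show "\<bar>real n - real y / 2\<bar> \<le> real y / 2" by (simp add: abs_if)
    qed (use q0 in auto)
    then show ?thesis by simp
  qed
  moreover have "real y / real q - 1 \<le> real (card {n. n < y \<and> n mod q = m})"
  proof -
    have sub: "(\<lambda>i. m + i * q) ` {..<y div q} \<subseteq> {n. n < y \<and> n mod q = m}"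
    proof (rule image_subsetI)
      fix i assume "i \<in> {..<y div q}"
      then have "(i + 1) * q \<le> (y div q) * q" by (intro mult_right_mono) auto
      also have "\<dots> \<le> y" by simp
      finally have "m + i * q < y" using assms by simp
      then show "m + i * q \<in> {n. n < y \<and> n mod q = m}" using assms by simp
    qed
    have "inj_on (\<lambda>i. m + i * q) {..<y div q}" using q0 by (intro inj_onI) simp
    then have "card {..<y div q} \<le> card {n. n < y \<and> n mod q = m}"
      by (rule card_inj_on_le[OF _ sub]) simp
    then have "real (y div q) \<le> real (card {n. n < y \<and> n mod q = m})" by simp
    moreover have "real y / real q - 1 \<le> real (y div q)"
    proof -
      have "y = q * (y div q) + y mod q" by simp
      then have "y \<le> q * (y div q) + q" using mod_less_divisor[OF q0, of y] by linarith
      then have "real y \<le> real (q * (y div q) + q)" by (simp only: of_nat_le_iff)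
      then show ?thesis using q0 by (simp add: field_simps)
    qed
    ultimately show ?thesis by linarith
  qed
  ultimately show ?thesis by linarith
qed

section \<open>The data of the problem, with the implied constants kept explicit\<close>

locale missing_digit_setting =
  fixes b k a0 r s X :: nat and D Kf Kl :: real
    and f \<sigma> lam :: "nat \<Rightarrow> complex" and c :: "nat \<Rightarrow> nat"
  assumes b: "b \<ge> 10" and k: "k \<ge> 1" and X: "X = b ^ k"
    and D: "1 \<le> D" "D < real X powr (1/2)"
    and a0: "a0 < b" and r: "r \<in> missing_digit b a0" "r < b"
    and rs: "coprime (int r - int s) (int b)"
    and f_coprime: "\<And>n. f n \<noteq> 0 \<Longrightarrow> coprime n b"
    and f_1: "norm (f 1) \<le> Kf" and f_le: "\<And>n. n \<ge> 2 \<Longrightarrow> norm (f n) \<le> Kf * ln (real n)"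
    and \<sigma>: "\<And>d. norm (\<sigma> d) \<le> real (divisor_fun d)"
    and c: "\<And>d. \<sigma> d \<noteq> 0 \<Longrightarrow> coprime (c d) d"
    and lam: "\<And>d. 1 \<le> d \<Longrightarrow> d < X \<Longrightarrow> norm (lam d) \<le> Kl * ln (real X)"
begin

lemma X_ge: "X \<ge> 10"
  using power_increasing[of 1 k b] b k by (simp add: X)

lemma ln_X: "ln (real X) = real k * ln (real b)"
  using b by (simp add: X ln_realpow)

lemma ln_X_ge_1: "1 \<le> ln (real X)"
proof -
  have "exp 1 \<le> real X" using X_ge exp_le by linarith
  then show ?thesis using X_ge by (subst ln_ge_iff) auto
qed

lemma f_0: "f 0 = 0"
  using f_coprime[of 0] b by auto

lemma Kf_nonneg: "0 \<le> Kf"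
  using f_1 norm_ge_zero order.trans by blast

lemma Kl_nonneg: "0 \<le> Kl"
proof -
  have "0 \<le> Kl * ln (real X)" using lam[of 1] X_ge by (intro order.trans[OF norm_ge_zero]) auto
  then show ?thesis using ln_X_ge_1 by (simp add: zero_le_mult_iff)
qed

lemma norm_f_le:
  assumes "n \<le> X"
  shows "norm (f n) \<le> Kf * ln (real X)"
proof (cases "n \<ge> 2")
  case True
  have "norm (f n) \<le> Kf * ln (real n)" by (rule f_le[OF True])
  also have "\<dots> \<le> Kf * ln (real X)"
    using True assms Kf_nonneg by (intro mult_left_mono) auto
  finally show ?thesis .
next
  case False
  have "Kf * 1 \<le> Kf * ln (real X)"
    by (rule mult_left_mono[OF ln_X_ge_1 Kf_nonneg])
  moreover from this have "0 \<le> Kf * ln (real X)" using Kf_nonneg by linarith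
  moreover from False have "n = 0 \<or> n = 1" by auto
  ultimately show ?thesis using f_0 f_1 by auto
qed

abbreviation Dmod :: "nat set" where "Dmod \<equiv> moduli b D"

lemma Dmod_less:
  assumes "d \<in> Dmod"
  shows "1 \<le> d" "real d \<le> real X powr (1/2)" "d < X" "coprime d b"
proof -
  show "1 \<le> d" "coprime d b" using assms by (auto simp: moduli_def)
  have d: "real d < real X powr (1/2)" using assms D by (auto simp: moduli_def)
  then show "real d \<le> real X powr (1/2)" by simp
  have "real X powr (1/2) \<le> real X powr 1" using X_ge by (intro powr_mono) auto
  with d show "d < X" using X_ge by simp
qed

lemma Dmod_subset: "Dmod \<subseteq> {1..nat \<lfloor>D\<rfloor>}"
  by (auto simp: moduli_def le_nat_floor)

lemma sum_Dmod_divisor_fun_le: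
  "(\<Sum>d\<in>Dmod. real (divisor_fun d) ^ m / real d) \<le> (1 + ln (real X)) ^ (2 ^ m)"
proof -
  have "(\<Sum>d\<in>Dmod. real (divisor_fun d) ^ m / real d) \<le> (\<Sum>d\<in>{1..nat \<lfloor>D\<rfloor>}. real (divisor_fun d) ^ m / real d)"
    by (rule sum_mono2) (use Dmod_subset in auto)
  also have "\<dots> \<le> harm (nat \<lfloor>D\<rfloor>) ^ (2 ^ m)" by (rule sum_divisor_fun_power_le)
  also have "\<dots> \<le> (1 + ln (real X)) ^ (2 ^ m)"
  proof (intro power_mono harm_nonneg)
    have n: "1 \<le> nat \<lfloor>D\<rfloor>" using D(1) by (simp add: le_nat_iff le_floor_iff)
    have "real (nat \<lfloor>D\<rfloor>) \<le> D" using D(1) by simp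
    also have "D \<le> real X powr 1" using D(2) X_ge powr_mono[of "1/2" 1 "real X"] by linarith
    finally have "real (nat \<lfloor>D\<rfloor>) \<le> real X" using X_ge by simp
    then have "ln (real (nat \<lfloor>D\<rfloor>)) \<le> ln (real X)" using n X_ge D(1) by (subst ln_le_cancel_iff) auto
    then show "harm (nat \<lfloor>D\<rfloor>) \<le> 1 + ln (real X)"
      using harm_le_one_plus_ln[of "nat \<lfloor>D\<rfloor>"] n by linarith
  qed
  finally show ?thesis .
qed

lemma norm_lam_div_totient_le:
  assumes "d \<in> Dmod"
  shows "norm (lam d) / real (totient d) \<le> Kl * ln (real X) * (real (divisor_fun d) / real d)"
proof -
  note d = Dmod_less[OF assms]
  have "real d \<le> real (totient d * divisor_fun d)"
    using le_totient_mult_divisor_fun[of d] d by (simp only: of_nat_le_iff)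
  then have "1 / real (totient d) \<le> real (divisor_fun d) / real d"
    using d by (simp add: field_simps)
  then have "norm (lam d) * (1 / real (totient d)) \<le> Kl * ln (real X) * (real (divisor_fun d) / real d)"
    using lam[OF d(1,3)] Kl_nonneg ln_X_ge_1 by (intro mult_mono) auto
  then show ?thesis by simp
qed

lemma card_residue_less_le:
  assumes "d \<ge> 1"
  shows "real (card {n. n < y \<and> [n = a] (mod d)}) \<le> real y / real d + 1"
  using card_residue_class_bounds[of "a mod d" d y] assms by (simp add: cong_def)

lemma norm_sum_f_residue_le:
  assumes "d \<ge> 1" "y \<le> X + 1"
  shows "(\<Sum>n | n < y \<and> [n = a] (mod d). norm (f n)) \<le> Kf * ln (real X) * (real y / real d + 1)"
proof -
  have "(\<Sum>n | n < y \<and> [n = a] (mod d). norm (f n)) \<le> (\<Sum>n | n < y \<and> [n = a] (mod d). Kf * ln (real X))"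
    by (intro sum_mono norm_f_le) (use assms in auto)
  also have "\<dots> = Kf * ln (real X) * real (card {n. n < y \<and> [n = a] (mod d)})" by simp
  also have "\<dots> \<le> Kf * ln (real X) * (real y / real d + 1)"
    using Kf_nonneg ln_X_ge_1 by (intro mult_left_mono card_residue_less_le assms) auto
  finally show ?thesis .
qed

definition main_coeff :: "nat \<Rightarrow> complex" where
  "main_coeff d = lam d / of_nat (totient d) * (of_nat b / of_nat (totient b))"

text \<open>
  The main term is \<open>main_coeff d\<close> times a sum over the \<open>n\<close> prime to \<open>b\<close> with \<open>n + s\<close> in the digit
  set, because \<open>n + s \<equiv> r\<close> already forces \<open>n\<close> to be prime to \<open>b\<close>.
\<close>
definition balanced :: "nat \<Rightarrow> nat \<Rightarrow> complex" where
  "balanced d n = (if [n = c d] (mod d) then f n else 0) - (if coprime n b then main_coeff d else 0)"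

definition balanced_sum :: "nat \<Rightarrow> complex" where
  "balanced_sum n = (\<Sum>d\<in>Dmod. \<sigma> d * balanced d n)"

definition balanced_hat :: "nat \<Rightarrow> complex" where
  "balanced_hat t = (\<Sum>n<X. balanced_sum n * e (- (real n * (real t / real X))))"

abbreviation digit_hat :: "nat \<Rightarrow> complex" where
  "digit_hat t \<equiv> missing_digit_hat b a0 r k (real t / real X)"

text \<open>The cyclic form of the shifted indicator. Reduction modulo X makes the Fourier expansion
  exact, and it changes values only for the at most s integers n with
  \<open>n + s \<ge> X\<close>.\<close>

definition wrapped :: "nat \<Rightarrow> complex" where
  "wrapped n = indicator (missing_digit_class b a0 r) ((n + s) mod X)"

lemma norm_main_coeff_le:
  assumes "d \<in> Dmod"
  shows "norm (main_coeff d) \<le> real b * Kl * ln (real X) * (real (divisor_fun d) / real d)"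
proof -
  have "norm (main_coeff d) = (norm (lam d) / real (totient d)) * (real b / real (totient b))"
    by (simp add: main_coeff_def norm_mult norm_divide)
  also have "\<dots> \<le> (Kl * ln (real X) * (real (divisor_fun d) / real d)) * real b"
  proof (intro mult_mono norm_lam_div_totient_le assms)
    have "1 \<le> real (totient b)" using b by (simp add: Suc_le_eq)
    then show "real b / real (totient b) \<le> real b"
      using divide_left_mono[of 1 "real (totient b)" "real b"] b by simp
  qed (use Kl_nonneg ln_X_ge_1 in auto)
  finally show ?thesis by (simp add: mult_ac)
qed

lemma coprime_if_shift_cong:
  assumes "[n + s = r] (mod b)"
  shows "coprime n b"
proof -
  have "[int n + int s = int r] (mod int b)" using assms by (simp flip: cong_int_iff)
  then have "[int n = int r - int s] (mod int b)"
    using cong_diff[of "int n + int s" "int r" "int b" "int s" "int s"] by simp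
  then have "coprime (int n) (int b)" using rs cong_imp_coprime cong_sym by blast
  then show ?thesis by simp
qed

lemma wrapped_coprime:
  assumes "wrapped n \<noteq> 0"
  shows "coprime n b"
proof -
  have "[(n + s) mod X = r] (mod b)"
    using assms by (auto simp: wrapped_def missing_digit_class_def indicator_def split: if_splits)
  moreover have "b dvd X" using k by (simp add: X dvd_power)
  then have "[n + s = (n + s) mod X] (mod b)" by (simp add: cong_def mod_mod_cancel)
  ultimately show ?thesis using coprime_if_shift_cong cong_trans by blast
qed

text \<open>Translation by s permutes the residues modulo X, so the main term is reproduced without
  any error.\<close>

lemma sum_wrapped:
  "(\<Sum>n<X. if coprime n b then wrapped n else 0) = (\<Sum>n<X. indicator (missing_digit_class b a0 r) n)"
proof -
  have X0: "X > 0" using X_ge by simp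
  have "(\<Sum>n<X. if coprime n b then wrapped n else 0) = (\<Sum>n<X. wrapped n)"
    using wrapped_coprime by (intro sum.cong refl) auto
  also have "\<dots> = (\<Sum>n<X. indicator (missing_digit_class b a0 r) n)"
    unfolding wrapped_def
  proof (rule sum.reindex_bij_betw)
    have "inj_on (\<lambda>n. (n + s) mod X) {..<X}"
    proof (rule inj_onI)
      fix n n' assume n: "n \<in> {..<X}" "n' \<in> {..<X}" "(n + s) mod X = (n' + s) mod X"
      then have "[n + s = n' + s] (mod X)" by (simp add: cong_def)
      then have "[n = n'] (mod X)" by (simp add: cong_add_rcancel_nat)
      then show "n = n'" using n by (simp add: cong_def)
    qed
    moreover have "(\<lambda>n. (n + s) mod X) ` {..<X} \<subseteq> {..<X}" using X0 by auto
    ultimately show "bij_betw (\<lambda>n. (n + s) mod X) {..<X} {..<X}"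
      unfolding bij_betw_def using endo_inj_surj by blast
  qed
  finally show ?thesis .
qed

lemma wrapped_fourier:
  "of_nat X * wrapped n = (\<Sum>t<X. digit_hat t * e (- (real t / real X) * real (n + s)))"
proof -
  have X0: "X > 0" using X_ge by simp
  let ?I = "indicator (missing_digit_class b a0 r) :: nat \<Rightarrow> complex"
  have "(\<Sum>t<X. digit_hat t * e (- (real t / real X) * real (n + s))) =
      (\<Sum>t<X. \<Sum>m<X. ?I m * e (real t * (of_int (int m - int (n + s)) / real X)))"
    unfolding missing_digit_hat_def X[symmetric] sum_distrib_right
  proof (intro sum.cong refl)
    fix t m
    have "real m * (real t / real X) + - (real t / real X) * real (n + s) =
        real t * (of_int (int m - int (n + s)) / real X)"
      by (simp add: algebra_simps diff_divide_distrib add_divide_distrib)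
    then show "?I m * e (real m * (real t / real X)) * e (- (real t / real X) * real (n + s)) =
        ?I m * e (real t * (of_int (int m - int (n + s)) / real X))"
      by (simp only: mult.assoc e_add[symmetric])
  qed
  also have "\<dots> = (\<Sum>m<X. ?I m * (\<Sum>t<X. e (real t * (of_int (int m - int (n + s)) / real X))))"
    by (subst sum.swap) (simp only: sum_distrib_left)
  also have "\<dots> = (\<Sum>m<X. if m = (n + s) mod X then of_nat X * ?I m else 0)"
  proof (intro sum.cong refl)
    fix m assume "m \<in> {..<X}"
    then have "int X dvd int m - int (n + s) \<longleftrightarrow> m = (n + s) mod X"
      unfolding mod_eq_dvd_iff[symmetric] zmod_int[symmetric] of_nat_eq_iff by simp
    then show "?I m * (\<Sum>t<X. e (real t * (of_int (int m - int (n + s)) / real X))) =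
        (if m = (n + s) mod X then of_nat X * ?I m else 0)"
      unfolding sum_e_orthogonality[OF X0] by simp
  qed
  also have "\<dots> = of_nat X * wrapped n" using X0 by (simp add: wrapped_def)
  finally show ?thesis by simp
qed

definition discrepancy :: complex where
  "discrepancy = (\<Sum>d\<in>Dmod. \<sigma> d *
     ((\<Sum>n | n < X \<and> [n = c d] (mod d). f n * indicator (missing_digit_class b a0 r) (n + s))
      - lam d / of_nat (totient d) * (of_nat b / of_nat (totient b)) *
        (\<Sum>n<X. indicator (missing_digit_class b a0 r) n)))"

lemma discrepancy_split:
  "discrepancy = (\<Sum>n<X. balanced_sum n * wrapped n) +
    (\<Sum>d\<in>Dmod. \<sigma> d * (\<Sum>n | n < X \<and> [n = c d] (mod d).
       f n * (indicator (missing_digit_class b a0 r) (n + s) - wrapped n)))"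
proof -
  let ?I = "indicator (missing_digit_class b a0 r) :: nat \<Rightarrow> complex"
  have bal: "(\<Sum>n<X. balanced d n * wrapped n) =
      (\<Sum>n | n < X \<and> [n = c d] (mod d). f n * wrapped n) - main_coeff d * (\<Sum>n<X. ?I n)" for d
  proof -
    have "(\<Sum>n<X. balanced d n * wrapped n) =
        (\<Sum>n<X. if [n = c d] (mod d) then f n * wrapped n else 0)
        - (\<Sum>n<X. main_coeff d * (if coprime n b then wrapped n else 0))"
      unfolding sum_subtractf[symmetric]
      by (intro sum.cong refl) (auto simp: balanced_def algebra_simps)
    also have "(\<Sum>n<X. if [n = c d] (mod d) then f n * wrapped n else 0) =
        (\<Sum>n | n < X \<and> [n = c d] (mod d). f n * wrapped n)"
      by (rule sum.mono_neutral_cong_right) auto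
    also have "(\<Sum>n<X. main_coeff d * (if coprime n b then wrapped n else 0)) = main_coeff d * (\<Sum>n<X. ?I n)"
      by (simp only: sum_wrapped flip: sum_distrib_left)
    finally show ?thesis .
  qed
  have "(\<Sum>n<X. balanced_sum n * wrapped n) = (\<Sum>d\<in>Dmod. \<sigma> d * (\<Sum>n<X. balanced d n * wrapped n))"
    unfolding balanced_sum_def sum_distrib_right
    by (subst sum.swap) (simp only: sum_distrib_left mult.assoc)
  then show ?thesis
    unfolding bal discrepancy_def main_coeff_def[symmetric] sum.distrib[symmetric]
    by (simp add: sum_subtractf right_diff_distrib)
qed

lemma sum_balanced_wrapped:
  "of_nat X * (\<Sum>n<X. balanced_sum n * wrapped n) =
    (\<Sum>t<X. digit_hat t * e (- (real t / real X) * real s) * balanced_hat t)"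
proof -
  have "of_nat X * (\<Sum>n<X. balanced_sum n * wrapped n) =
      (\<Sum>n<X. balanced_sum n * (of_nat X * wrapped n))"
    by (simp add: sum_distrib_left mult_ac)
  also have "\<dots> = (\<Sum>n<X. \<Sum>t<X. digit_hat t * e (- (real t / real X) * real s) *
      (balanced_sum n * e (- (real n * (real t / real X)))))"
    unfolding wrapped_fourier sum_distrib_left
  proof (intro sum.cong refl)
    fix n t
    have "- (real t / real X) * real (n + s) = - (real t / real X) * real s + - (real n * (real t / real X))"
      by (simp add: algebra_simps add_divide_distrib)
    then show "balanced_sum n * (digit_hat t * e (- (real t / real X) * real (n + s))) =
        digit_hat t * e (- (real t / real X) * real s) * (balanced_sum n * e (- (real n * (real t / real X))))"
      by (simp only: e_add mult_ac)
  qed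
  also have "\<dots> = (\<Sum>t<X. digit_hat t * e (- (real t / real X) * real s) * balanced_hat t)"
    unfolding balanced_hat_def sum_distrib_left by (rule sum.swap)
  finally show ?thesis .
qed

lemma sum_Dmod_divisor_fun_sqrt_le:
  "(\<Sum>d\<in>Dmod. real (divisor_fun d)) \<le> real X powr (1/2) * (1 + ln (real X)) ^ 2"
proof -
  have "(\<Sum>d\<in>Dmod. real (divisor_fun d)) \<le> (\<Sum>d\<in>Dmod. real X powr (1/2) * (real (divisor_fun d) / real d))"
  proof (rule sum_mono)
    fix d assume "d \<in> Dmod"
    note d = Dmod_less[OF this]
    have "real d * (real (divisor_fun d) / real d) \<le> real X powr (1/2) * (real (divisor_fun d) / real d)"
      by (intro mult_right_mono d) simp
    then show "real (divisor_fun d) \<le> real X powr (1/2) * (real (divisor_fun d) / real d)" using d by simp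
  qed
  also have "\<dots> \<le> real X powr (1/2) * (1 + ln (real X)) ^ 2"
    using sum_Dmod_divisor_fun_le[of 1] unfolding sum_distrib_left[symmetric]
    by (intro mult_left_mono) auto
  finally show ?thesis .
qed

text \<open>Only the last s integers below X can wrap around, and they are bounded trivially for
  each d. The square root of X comes from summing the divisor function over d up to D; it is
  negligible because \<open>sqrt b < b - 1\<close>.\<close>

lemma norm_wrap_error_le:
  "norm (\<Sum>d\<in>Dmod. \<sigma> d * (\<Sum>n | n < X \<and> [n = c d] (mod d).
       f n * (indicator (missing_digit_class b a0 r) (n + s) - wrapped n)))
   \<le> real s * Kf * ln (real X) * (real X powr (1/2) * (1 + ln (real X)) ^ 2)"
proof -
  let ?I = "indicator (missing_digit_class b a0 r) :: nat \<Rightarrow> complex"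
  have inner: "norm (\<Sum>n | n < X \<and> [n = c d] (mod d). f n * (?I (n + s) - wrapped n)) \<le> real s * (Kf * ln (real X))" for d
  proof -
    have "norm (\<Sum>n | n < X \<and> [n = c d] (mod d). f n * (?I (n + s) - wrapped n))
        \<le> (\<Sum>n | n < X \<and> [n = c d] (mod d). norm (f n * (?I (n + s) - wrapped n)))"
      by (rule norm_sum)
    also have "\<dots> \<le> (\<Sum>n<X. norm (f n * (?I (n + s) - wrapped n)))"
      by (rule sum_mono2) auto
    also have "\<dots> = (\<Sum>n\<in>{X - s..<X}. norm (f n * (?I (n + s) - wrapped n)))"
    proof (rule sum.mono_neutral_right)
      show "\<forall>n\<in>{..<X} - {X - s..<X}. norm (f n * (?I (n + s) - wrapped n)) = 0"
      proof
        fix n assume "n \<in> {..<X} - {X - s..<X}"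
        then have "n + s < X" by auto
        then show "norm (f n * (?I (n + s) - wrapped n)) = 0" by (simp add: wrapped_def)
      qed
    qed auto
    also have "\<dots> \<le> (\<Sum>n\<in>{X - s..<X}. Kf * ln (real X))"
    proof (rule sum_mono)
      fix n assume "n \<in> {X - s..<X}"
      then have "norm (f n) * norm (?I (n + s) - wrapped n) \<le> Kf * ln (real X) * 1"
        using Kf_nonneg ln_X_ge_1
        by (intro mult_mono norm_f_le) (auto simp: wrapped_def indicator_def)
      then show "norm (f n * (?I (n + s) - wrapped n)) \<le> Kf * ln (real X)"
        by (simp add: norm_mult)
    qed
    also have "\<dots> = real (X - (X - s)) * (Kf * ln (real X))" by simp
    also have "\<dots> \<le> real s * (Kf * ln (real X))"
      using Kf_nonneg ln_X_ge_1 by (intro mult_right_mono) auto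
    finally show ?thesis .
  qed
  have "norm (\<Sum>d\<in>Dmod. \<sigma> d * (\<Sum>n | n < X \<and> [n = c d] (mod d). f n * (?I (n + s) - wrapped n)))
      \<le> (\<Sum>d\<in>Dmod. real (divisor_fun d) * (real s * (Kf * ln (real X))))"
    by (rule sum_norm_le) (unfold norm_mult, intro mult_mono \<sigma> inner, auto)
  also have "\<dots> = (\<Sum>d\<in>Dmod. real (divisor_fun d)) * (real s * (Kf * ln (real X)))"
    by (simp add: sum_distrib_right)
  also have "\<dots> \<le> (real X powr (1/2) * (1 + ln (real X)) ^ 2) * (real s * (Kf * ln (real X)))"
    using Kf_nonneg ln_X_ge_1 by (intro mult_right_mono sum_Dmod_divisor_fun_sqrt_le) auto
  finally show ?thesis by (simp only: mult_ac)
qed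

lemma norm_discrepancy_le:
  "norm discrepancy \<le> real s * Kf * ln (real X) * (real X powr (1/2) * (1 + ln (real X)) ^ 2)
    + (\<Sum>t<X. norm (digit_hat t) * norm (balanced_hat t)) / real X"
proof -
  have "real X * norm (\<Sum>n<X. balanced_sum n * wrapped n) =
      norm (\<Sum>t<X. digit_hat t * e (- (real t / real X) * real s) * balanced_hat t)"
    unfolding sum_balanced_wrapped[symmetric] by (simp add: norm_mult)
  also have "\<dots> \<le> (\<Sum>t<X. norm (digit_hat t) * norm (balanced_hat t))"
    by (rule sum_norm_le) (simp add: norm_mult)
  finally have "norm (\<Sum>n<X. balanced_sum n * wrapped n) \<le> (\<Sum>t<X. norm (digit_hat t) * norm (balanced_hat t)) / real X"
    using X_ge by (simp add: field_simps)
  with norm_wrap_error_le show ?thesis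
    unfolding discrepancy_split by (intro order.trans[OF norm_triangle_ineq]) linarith
qed

text \<open>This loses only powers of ln X. It serves where the digit coefficient is itself small,
  and again for the finitely many small k.\<close>

lemma norm_balanced_hat_trivial_le:
  "norm (balanced_hat t) \<le> (2 * Kf + real b * Kl) * (real X * ln (real X) * (1 + ln (real X)) ^ 4)"
proof -
  have "norm (balanced_hat t) \<le> (\<Sum>n<X. norm (balanced_sum n))"
    unfolding balanced_hat_def by (rule sum_norm_le) (simp add: norm_mult)
  also have "\<dots> \<le> (\<Sum>n<X. \<Sum>d\<in>Dmod. real (divisor_fun d) * norm (balanced d n))"
    unfolding balanced_sum_def by (intro sum_mono sum_norm_le) (auto simp: norm_mult intro!: mult_right_mono \<sigma>)
  also have "\<dots> = (\<Sum>d\<in>Dmod. real (divisor_fun d) * (\<Sum>n<X. norm (balanced d n)))"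
    by (subst sum.swap) (simp add: sum_distrib_left)
  also have "\<dots> \<le> (\<Sum>d\<in>Dmod. (2 * Kf + real b * Kl) * (real X * ln (real X)) * (real (divisor_fun d) ^ 2 / real d))"
  proof (rule sum_mono)
    fix d assume dD: "d \<in> Dmod"
    note d = Dmod_less[OF dD]
    have \<tau>: "1 \<le> real (divisor_fun d)" using divisor_fun_ge_1[of d] d by simp
    have "(\<Sum>n<X. norm (balanced d n)) \<le>
        (\<Sum>n<X. (if [n = c d] (mod d) then norm (f n) else 0) + norm (main_coeff d))"
      by (intro sum_mono) (auto simp: balanced_def intro: order.trans[OF norm_triangle_ineq4])
    also have "\<dots> = (\<Sum>n<X. if [n = c d] (mod d) then norm (f n) else 0) + real X * norm (main_coeff d)"
      by (simp add: sum.distrib)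
    also have "(\<Sum>n<X. if [n = c d] (mod d) then norm (f n) else 0) = (\<Sum>n | n < X \<and> [n = c d] (mod d). norm (f n))"
      by (rule sum.mono_neutral_cong_right) auto
    also have "\<dots> \<le> Kf * ln (real X) * (real X / real d + 1)"
      by (rule norm_sum_f_residue_le) (use d in auto)
    also have "real X / real d + 1 \<le> 2 * (real X / real d)" using d by (simp add: field_simps)
    also have "2 * (real X / real d) \<le> 2 * (real X * (real (divisor_fun d) / real d))"
      using \<tau> d by (simp add: field_simps)
    also have "Kf * ln (real X) * (2 * (real X * (real (divisor_fun d) / real d))) + real X * norm (main_coeff d)
      \<le> Kf * ln (real X) * (2 * (real X * (real (divisor_fun d) / real d)))
        + real X * (real b * Kl * ln (real X) * (real (divisor_fun d) / real d))"
      by (intro add_left_mono mult_left_mono norm_main_coeff_le dD) simp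
    finally have "(\<Sum>n<X. norm (balanced d n)) \<le>
        Kf * ln (real X) * (2 * (real X * (real (divisor_fun d) / real d)))
        + real X * (real b * Kl * ln (real X) * (real (divisor_fun d) / real d))"
      using Kf_nonneg ln_X_ge_1 by (simp add: mult_left_mono)
    then have "real (divisor_fun d) * (\<Sum>n<X. norm (balanced d n)) \<le> real (divisor_fun d) *
        (Kf * ln (real X) * (2 * (real X * (real (divisor_fun d) / real d)))
        + real X * (real b * Kl * ln (real X) * (real (divisor_fun d) / real d)))"
      by (rule mult_left_mono) simp
    also have "\<dots> = (2 * Kf + real b * Kl) * (real X * ln (real X)) * (real (divisor_fun d) ^ 2 / real d)"
      by (simp add: algebra_simps power2_eq_square add_divide_distrib)
    finally show "real (divisor_fun d) * (\<Sum>n<X. norm (balanced d n)) \<le>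
        (2 * Kf + real b * Kl) * (real X * ln (real X)) * (real (divisor_fun d) ^ 2 / real d)" .
  qed
  also have "\<dots> = (2 * Kf + real b * Kl) * (real X * ln (real X)) * (\<Sum>d\<in>Dmod. real (divisor_fun d) ^ 2 / real d)"
    by (simp add: sum_distrib_left)
  also have "\<dots> \<le> (2 * Kf + real b * Kl) * (real X * ln (real X)) * (1 + ln (real X)) ^ 4"
    using sum_Dmod_divisor_fun_le[of 2] Kf_nonneg Kl_nonneg ln_X_ge_1 by (intro mult_left_mono) auto
  finally show ?thesis by (simp only: mult.assoc)
qed

end

section \<open>Minor arcs\<close>

lemma ex_power_bracket:
  fixes x :: real
  assumes "b \<ge> 2" "x \<ge> 1"
  shows "\<exists>l. real b ^ l \<le> x \<and> x < real b ^ (l + 1)"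
proof -
  define m where "m = \<lfloor>log (real b) x\<rfloor>"
  have m: "real b powr of_int m \<le> x" "x < real b powr (of_int m + 1)"
    using floor_log_eq_powr_iff[of x "real b" m] assms by (auto simp: m_def)
  have "0 \<le> log (real b) x" using assms by simp
  then have "0 \<le> m" by (simp add: m_def)
  then obtain l where l: "m = int l" using nonneg_int_cases by blast
  have e: "of_int m = real l" "of_int m + 1 = real (l + 1)" by (simp_all add: l)
  have pw: "real b powr real n = real b ^ n" for n using assms by (intro powr_realpow) simp
  show ?thesis using m(1)[unfolded e pw] m(2)[unfolded e(2) pw] by blast
qed

lemma coprime_fraction_exists:
  fixes h :: int and q :: nat
  assumes "q \<ge> 1"
  obtains h' q' where "coprime h' (int q')" "1 \<le> q'" "q' \<le> q" "real_of_int h' / real q' = of_int h / real q" "q' dvd q"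
proof -
  define g where "g = gcd h (int q)"
  have g: "g > 0" using assms by (simp add: g_def)
  obtain h' where h': "h = g * h'" using gcd_dvd1[of h "int q"] unfolding g_def[symmetric] by blast
  obtain q0 where q0: "int q = g * q0" using gcd_dvd2[of h "int q"] unfolding g_def[symmetric] by blast
  have q0_pos: "q0 > 0" using q0 g assms by (metis of_nat_0_less_iff zero_less_mult_pos less_le_trans zero_less_one)
  define q' where "q' = nat q0"
  have q': "int q' = q0" using q0_pos by (simp add: q'_def)
  have "h div g = h'" "int q div g = q0" using g unfolding h' q0 by auto
  then have cop: "coprime h' (int q')"
    using div_gcd_coprime[of h "int q"] assms unfolding g_def[symmetric] q' by auto
  have dvd: "q' dvd q" using q0 q' by (metis dvd_triv_right int_dvd_int_iff)
  have le: "q' \<le> q" using dvd assms by (intro dvd_imp_le) auto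
  have "real q = of_int g * real q'"
  proof -
    have "real_of_int (int q) = of_int (g * int q')" using q0 q' by simp
    then show ?thesis by simp
  qed
  then have "real_of_int h' / real q' = of_int h / real q" using g by (simp add: h')
  moreover have "1 \<le> q'" using q' q0_pos by linarith
  ultimately show ?thesis using that cop le dvd by blast
qed

context missing_digit_setting
begin

text \<open>The same R bounds the denominator and, divided by X, the distance. Hence any
  approximation of a t outside this set has q H > R.\<close>

definition major :: "nat \<Rightarrow> nat set" where
  "major R = {t. t < X \<and> (\<exists>(h::int) (q::nat). 1 \<le> q \<and> q \<le> R \<and> coprime h (int q) \<and>
     \<bar>real t / real X - of_int h / real q\<bar> \<le> real R / real X)}"

lemma card_major_le:
  assumes "1 \<le> R" "R \<le> X"
  shows "card (major R) \<le> 16 * R ^ 3"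
proof -
  have "card (major R) \<le> card {t. t < X \<and> (\<exists>h q. 1 \<le> q \<and> q \<le> R \<and>
      \<bar>real t / real X - of_int h / real q\<bar> \<le> real R / real X)}"
    unfolding major_def by (intro card_mono) auto
  also have "\<dots> \<le> 16 * R ^ 3" using X_ge assms by (intro card_near_fractions_le) auto
  finally show ?thesis .
qed

text \<open>Being prime to b depends only on n modulo b, so the sum over each residue class is a
  complete geometric sum with \<open>b ^ (k - 1)\<close> terms. The exceptional frequencies are
  \<open>t / X = a / b\<close>, whose denominators divide b; they are major once R is at least
  b.\<close>

lemma sum_coprime_e_eq_0:
  assumes "\<not> b ^ (k - 1) dvd t"
  shows "(\<Sum>n<X. if coprime n b then e (- (real n * (real t / real X))) else 0) = 0"
proof -
  define A where "A = b ^ (k - 1)"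
  have XA: "X = A * b" using k by (cases k) (auto simp: X A_def)
  have A0: "A > 0" using b by (simp add: A_def)
  have "(\<Sum>n<X. if coprime n b then e (- (real n * (real t / real X))) else 0) =
      (\<Sum>i<A. \<Sum>j<b. if coprime (j + i * b) b then e (- (real (j + i * b) * (real t / real X))) else 0)"
    unfolding XA by (rule sum_mult_product)
  also have "\<dots> = (\<Sum>i<A. \<Sum>j<b. (if coprime j b then e (- (real j * (real t / real X))) else 0) *
      e (real i * (of_int (- int t) / real A)))"
  proof (intro sum.cong refl)
    fix i j
    have "coprime (j + i * b) b \<longleftrightarrow> coprime j b"
      using coprime_mod_left_iff[of b "j + i * b"] coprime_mod_left_iff[of b j] b by simp
    moreover have "- (real (j + i * b) * (real t / real X)) =
        - (real j * (real t / real X)) + real i * (of_int (- int t) / real A)"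
      using b A0 by (simp add: XA field_simps)
    ultimately show "(if coprime (j + i * b) b then e (- (real (j + i * b) * (real t / real X))) else 0) =
        (if coprime j b then e (- (real j * (real t / real X))) else 0) * e (real i * (of_int (- int t) / real A))"
      by (simp only: e_add) simp
  qed
  also have "\<dots> = (\<Sum>j<b. if coprime j b then e (- (real j * (real t / real X))) else 0) *
      (\<Sum>i<A. e (real i * (of_int (- int t) / real A)))"
    unfolding sum_product by (rule sum.swap)
  also have "(\<Sum>i<A. e (real i * (of_int (- int t) / real A))) = 0"
  proof -
    have "\<not> int A dvd - int t" using assms unfolding A_def dvd_minus_iff int_dvd_int_iff .
    then show ?thesis unfolding sum_e_orthogonality[OF A0] by (simp only: if_False)
  qed
  finally show ?thesis by simp
qed

lemma multiple_in_major:
  assumes "t < X" "b ^ (k - 1) dvd t" "b \<le> R"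
  shows "t \<in> major R"
proof -
  obtain a where a: "t = b ^ (k - 1) * a" using assms(2) by auto
  have "X = b ^ (k - 1) * b" using k by (cases k) (auto simp: X)
  then have "real t / real X = of_int (int a) / real b" using b by (simp add: a)
  moreover obtain h q where hq: "coprime h (int q)" "1 \<le> q" "q \<le> b" "real_of_int h / real q = of_int (int a) / real b"
    by (rule coprime_fraction_exists[of b "int a"]) (use b in auto)
  ultimately have "\<bar>real t / real X - of_int h / real q\<bar> \<le> real R / real X" by simp
  moreover have "q \<le> R" using hq assms by simp
  ultimately show ?thesis using hq assms(1) unfolding major_def by blast
qed

lemma balanced_hat_minor:
  assumes "t < X" "t \<notin> major R" "b \<le> R"
  shows "balanced_hat t = (\<Sum>d\<in>Dmod. \<sigma> d *
    (\<Sum>n | n < X \<and> [n = c d] (mod d). f n * e (real n * (- (real t / real X)))))"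
proof -
  have nd: "\<not> b ^ (k - 1) dvd t" using multiple_in_major assms by blast
  have "balanced_hat t = (\<Sum>d\<in>Dmod. \<sigma> d * (\<Sum>n<X. balanced d n * e (- (real n * (real t / real X)))))"
    unfolding balanced_hat_def balanced_sum_def sum_distrib_right
    by (subst sum.swap) (simp only: sum_distrib_left mult.assoc)
  also have "\<dots> = (\<Sum>d\<in>Dmod. \<sigma> d *
    (\<Sum>n | n < X \<and> [n = c d] (mod d). f n * e (real n * (- (real t / real X)))))"
  proof (rule sum.cong[OF refl])
    fix d
    have "(\<Sum>n<X. balanced d n * e (- (real n * (real t / real X)))) =
        (\<Sum>n<X. if [n = c d] (mod d) then f n * e (real n * (- (real t / real X))) else 0)
        - main_coeff d * (\<Sum>n<X. if coprime n b then e (- (real n * (real t / real X))) else 0)"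
      unfolding sum_distrib_left sum_subtractf[symmetric]
      by (intro sum.cong refl) (auto simp: balanced_def left_diff_distrib)
    also have "\<dots> = (\<Sum>n<X. if [n = c d] (mod d) then f n * e (real n * (- (real t / real X))) else 0)"
      unfolding sum_coprime_e_eq_0[OF nd] by simp
    also have "\<dots> = (\<Sum>n | n < X \<and> [n = c d] (mod d). f n * e (real n * (- (real t / real X))))"
      by (rule sum.mono_neutral_cong_right) auto
    finally show "\<sigma> d * (\<Sum>n<X. balanced d n * e (- (real n * (real t / real X)))) =
        \<sigma> d * (\<Sum>n | n < X \<and> [n = c d] (mod d). f n * e (real n * (- (real t / real X))))"
      by (rule arg_cong)
  qed
  finally show ?thesis .
qed

text \<open>
  Dirichlet's theorem with denominators up to the square root of \<open>X\<close> puts \<open>q H\<close> below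
  \<open>3 X\<^sup>1\<^sup>/\<^sup>2\<close>, so the first term of the exponential sum bound is absorbed by the second.
\<close>
definition dirichlet_approx :: "nat \<Rightarrow> int \<Rightarrow> nat \<Rightarrow> bool" where
  "dirichlet_approx t h q \<longleftrightarrow> coprime h (int q) \<and> 1 \<le> q \<and>
     \<bar>real t / real X - of_int h / real q\<bar> < 1 / (real q)\<^sup>2 \<and>
     (real q * (1 + \<bar>real t / real X - of_int h / real q\<bar> * real X))\<^sup>2 \<le> 9 * real X"

lemma ex_dirichlet_approx: "\<exists>h q. dirichlet_approx t h q"
proof -
  \<comment> \<open>With q at most N and \<open>q * \<bar>\<beta>\<bar> < 1 / N\<close>, the product
    q H is at most \<open>N + X / N\<close>, hence at most \<open>sqrt X + 2 * sqrt X\<close>. This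
    is the origin of the constant 9.\<close>
  define N where "N = nat \<lfloor>sqrt (real X)\<rfloor>"
  have s3: "3 \<le> sqrt (real X)" using X_ge by (intro real_le_rsqrt) auto
  have N: "real N \<le> sqrt (real X)" "sqrt (real X) \<le> 2 * real N"
    using s3 unfolding N_def by linarith+
  have N0: "N > 0" using N s3 by linarith
  obtain h k' where hk: "coprime h k'" "0 < k'" "k' \<le> int N" "\<bar>of_int k' * (real t / real X) - of_int h\<bar> < 1 / real N"
    using Dirichlet_approx_coprime[OF N0, of "real t / real X"] by blast
  define q where "q = nat k'"
  have q: "int q = k'" "1 \<le> q" "q \<le> N" using hk by (auto simp: q_def)
  define \<beta> where "\<beta> = real t / real X - of_int h / real q"
  have qb: "real q * \<bar>\<beta>\<bar> < 1 / real N"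
  proof -
    have "real q * \<bar>\<beta>\<bar> = \<bar>real q * \<beta>\<bar>" by (simp add: abs_mult)
    also have "real q * \<beta> = of_int k' * (real t / real X) - of_int h"
      using q by (simp add: \<beta>_def right_diff_distrib flip: q(1))
    finally show ?thesis using hk(4) by simp
  qed
  have "real q * \<bar>\<beta>\<bar> < 1 / real q"
    using qb q N0 by (intro less_le_trans[OF qb] divide_left_mono) auto
  then have 1: "\<bar>\<beta>\<bar> < 1 / (real q)\<^sup>2"
    using q by (simp add: power2_eq_square pos_less_divide_eq mult_ac)
  have "real q * (1 + \<bar>\<beta>\<bar> * real X) = real q + (real q * \<bar>\<beta>\<bar>) * real X" by (simp add: algebra_simps)
  also have "\<dots> \<le> real N + (1 / real N) * real X"
    using q qb by (intro add_mono mult_right_mono) auto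
  also have "(1 / real N) * real X \<le> 2 * sqrt (real X)"
  proof -
    have "real X = sqrt (real X) * sqrt (real X)" by simp
    also have "\<dots> \<le> sqrt (real X) * (2 * real N)" by (intro mult_left_mono N) simp
    finally show ?thesis using N0 by (simp add: pos_divide_le_eq mult_ac)
  qed
  finally have "real q * (1 + \<bar>\<beta>\<bar> * real X) \<le> 3 * sqrt (real X)" using N by linarith
  then have "(real q * (1 + \<bar>\<beta>\<bar> * real X))\<^sup>2 \<le> (3 * sqrt (real X))\<^sup>2"
    by (intro power_mono) auto
  then have 2: "(real q * (1 + \<bar>\<beta>\<bar> * real X))\<^sup>2 \<le> 9 * real X" by (simp add: power_mult_distrib)
  have "dirichlet_approx t h q" using hk(1) q 1 2 unfolding \<beta>_def dirichlet_approx_def by simp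
  then show ?thesis by blast
qed

lemma norm_exponential_sum_le:
  assumes hyp: "exponential_sum_hyp b X D f \<sigma> c \<omega> C' K" and \<omega>: "0 < \<omega>" "\<omega> < 1"
    and t: "t < X" "t \<notin> major R" "b \<le> R"
    and hq: "coprime h (int q)" "1 \<le> q" "\<bar>real t / real X - of_int h / real q\<bar> < 1 / (real q)\<^sup>2"
    and H: "H = 1 + \<bar>real t / real X - of_int h / real q\<bar> * real X"
    and qH: "(real q * H)\<^sup>2 \<le> 9 * real X"
  shows "norm (balanced_hat t) \<le> 10 * \<bar>K\<bar> * real X * ln (real X) powr C' * (real q * H) powr (- \<omega>)"
proof -
  have H1: "1 \<le> H" using H by simp
  have qH1: "1 \<le> real q * H"
  proof -
    have "1 * 1 \<le> real q * H" using hq(2) H1 by (intro mult_mono) auto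
    then show ?thesis by simp
  qed
  have X0: "0 < real X" using X_ge by simp
  have qHX: "real q * H \<le> real X"
  proof (rule power2_le_imp_le)
    have "9 * real X \<le> real X * real X" using X_ge by (intro mult_right_mono) auto
    then show "(real q * H)\<^sup>2 \<le> (real X)\<^sup>2" using qH by (simp add: power2_eq_square)
  qed simp
  \<comment> \<open>\<open>balanced_hat\<close> carries the phase at \<open>- t / X\<close>, so the
    hypothesis is used with the negatives of h and of the remainder; H depends only on the absolute
    value of the latter.\<close>
  have "norm (\<Sum>d\<in>moduli b D. \<sigma> d *
          (\<Sum>n | n < X \<and> [n = c d] (mod d). f n * e (real n * (- (real t / real X)))))
      \<le> K * (real X * ((real q * H) powr \<omega> / real X powr \<omega> + 1 / (real q * H) powr \<omega>) * ln (real X) powr C')"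
    using hyp[unfolded exponential_sum_hyp_def, rule_format,
        of q "- h" "- (real t / real X)" "- (real t / real X - of_int h / real q)" H]
      hq qH1 qHX H by (simp add: abs_minus_commute)
  also have "\<dots> \<le> \<bar>K\<bar> * (real X * (10 * (real q * H) powr (- \<omega>)) * ln (real X) powr C')"
  proof (intro mult_mono order.refl)
    have "real q * H / real X \<le> 9 / (real q * H)"
      using qH qH1 X0 by (simp add: power2_eq_square field_simps)
    then have "(real q * H / real X) powr \<omega> \<le> (9 / (real q * H)) powr \<omega>"
      using qH1 X0 \<omega> by (intro powr_mono2) auto
    also have "\<dots> = 9 powr \<omega> * (real q * H) powr (- \<omega>)"
      using qH1 by (simp add: powr_divide powr_minus_divide)
    also have "\<dots> \<le> 9 powr 1 * (real q * H) powr (- \<omega>)"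
      using \<omega> by (intro mult_right_mono powr_mono) auto
    finally have "(real q * H) powr \<omega> / real X powr \<omega> \<le> 9 * (real q * H) powr (- \<omega>)"
      using qH1 X0 by (simp add: powr_divide)
    then show "(real q * H) powr \<omega> / real X powr \<omega> + 1 / (real q * H) powr \<omega> \<le> 10 * (real q * H) powr (- \<omega>)"
      by (simp add: powr_minus_divide)
  qed (use X0 in auto)
  finally show ?thesis unfolding balanced_hat_minor[OF t] by (simp add: mult_ac)
qed

text \<open>The frequencies are sorted by the b-adic sizes i of q and l of H. In one class the
  hybrid bound loses \<open>b ^ (i + l)\<close> to the power 2 \<alpha> while the hypothesis saves
  the power \<omega>. The exponent left over is negative, so what counts is the lower bound q H > R.
  The quantity k^5 combines k^3 from one class with the number of classes.\<close>

lemma minor_arcs_le: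
  assumes hyp: "exponential_sum_hyp b X D f \<sigma> c \<omega> C' Kc" and \<omega>: "0 < \<omega>" "\<omega> < 1"
    and C: "1 / ln (real b) \<le> C" and \<alpha>: "alpha b C < \<omega> / 2" and K: "K \<ge> 0"
    and L1: "\<And>n. (\<Sum>u<b ^ n. digit_prod b a0 n (real u / real (b ^ n))) \<le> K * (C * real b * ln (real b)) ^ n"
    and R: "b \<le> R"
  shows "(\<Sum>t\<in>{..<X} - major R. norm (digit_hat t) * norm (balanced_hat t)) \<le>
    1920 * \<bar>Kc\<bar> * K\<^sup>2 * real b ^ 9 * real k ^ 5 * real (b - 1) ^ k * real X * ln (real X) powr C'
      * real R powr (- (\<omega> - 2 * alpha b C))"
proof -
  define \<eta> where "\<eta> = \<omega> - 2 * alpha b C"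
  have C0: "0 < C"
  proof -
    have "0 < 1 / ln (real b)" using b by simp
    with C show ?thesis by linarith
  qed
  have \<alpha>0: "0 \<le> alpha b C"
  proof -
    have "1 \<le> C * ln (real b)" using C b by (simp add: pos_divide_le_eq)
    then have "1 * (real b / (real b - 1)) \<le> (C * ln (real b)) * (real b / (real b - 1))"
      using b by (intro mult_right_mono) auto
    moreover have "1 \<le> real b / (real b - 1)" using b by simp
    ultimately have "1 \<le> C * (real b * ln (real b) / (real b - 1))" by (simp add: mult_ac)
    then show ?thesis unfolding alpha_def using b by simp
  qed
  have \<eta>: "0 < \<eta>" "\<eta> \<le> 1" using \<alpha> \<alpha>0 \<omega> by (auto simp: \<eta>_def)
  define S where "S = {..<X} - major R"
  have "\<forall>t. \<exists>h. \<exists>q. dirichlet_approx t h q" using ex_dirichlet_approx by blast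
  from choice[OF this] obtain h where "\<forall>t. \<exists>q. dirichlet_approx t (h t) q" by blast
  from choice[OF this] obtain q where hq: "\<And>t. dirichlet_approx t (h t) (q t)" by blast
  define p where "p = (\<lambda>t. of_int (h t) / real (q t) :: real)"
  define H where "H = (\<lambda>t. 1 + \<bar>real t / real X - p t\<bar> * real X)"
  have hq: "coprime (h t) (int (q t))" "1 \<le> q t" "\<bar>real t / real X - p t\<bar> < 1 / (real (q t))\<^sup>2"
      "(real (q t) * H t)\<^sup>2 \<le> 9 * real X" for t
    using hq[of t] by (simp_all add: dirichlet_approx_def p_def H_def)
  have H1: "1 \<le> H t" for t by (simp add: H_def)
  have b2: "b \<ge> 2" using b by simp
  have "\<exists>i. real b ^ i \<le> real (q t) \<and> real (q t) < real b ^ (i + 1)" for t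
    using hq(2)[of t] by (intro ex_power_bracket b2) simp
  then have "\<forall>t. \<exists>i. real b ^ i \<le> real (q t) \<and> real (q t) < real b ^ (i + 1)" by blast
  from choice[OF this] obtain I where I: "\<And>t. real b ^ I t \<le> real (q t) \<and> real (q t) < real b ^ (I t + 1)"
    by blast
  have "\<forall>t. \<exists>l. real b ^ l \<le> H t \<and> H t < real b ^ (l + 1)"
    using ex_power_bracket[OF b2 H1] by blast
  from choice[OF this] obtain L where L: "\<And>t. real b ^ L t \<le> H t \<and> H t < real b ^ (L t + 1)"
    by blast
  have qH_gt: "real R < real (q t) * H t" if t: "t \<in> S" for t
  proof (rule ccontr)
    assume "\<not> real R < real (q t) * H t"
    then have le: "real (q t) * H t \<le> real R" by simp
    have q1: "1 \<le> real (q t)" using hq(2) by simp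
    have "real (q t) * 1 \<le> real (q t) * H t" by (intro mult_left_mono H1) simp
    with le have "q t \<le> R" by simp
    moreover have "1 * (\<bar>real t / real X - p t\<bar> * real X) \<le> real (q t) * H t"
      using q1 H1[of t] by (intro mult_mono) (auto simp: H_def)
    with le have "\<bar>real t / real X - p t\<bar> * real X \<le> real R" by linarith
    then have "\<bar>real t / real X - p t\<bar> \<le> real R / real X" using X_ge by (simp add: pos_le_divide_eq)
    ultimately have "t \<in> major R"
      using hq[of t] t unfolding major_def p_def S_def by blast
    with t show False by (simp add: S_def)
  qed
  define W where "W = 10 * \<bar>Kc\<bar> * real X * ln (real X) powr C'"
  have W0: "0 \<le> W" by (simp add: W_def)
  \<comment> \<open>The factor \<open>b ^ 2\<close> pays for replacing \<open>b ^ (i + l)\<close> by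
    R: within a class q H is below \<open>b ^ (i + l + 2)\<close>, and \<eta> is at most 1.\<close>
  define Z where "Z = W * (48 * K\<^sup>2 * real b ^ 7 * real k ^ 3 * real (b - 1) ^ k) * (real b ^ 2 * real R powr (- \<eta>))"
  have Z0: "0 \<le> Z" using W0 K by (simp add: Z_def)
  have class_le: "(\<Sum>t\<in>{t \<in> S. I t = i \<and> L t = l}. norm (digit_hat t) * norm (balanced_hat t)) \<le> Z" for i l
  proof (cases "{t \<in> S. I t = i \<and> L t = l} = {}")
    case True
    then show ?thesis using Z0 by (simp only: sum.empty)
  next
    case False
    define T where "T = {t \<in> S. I t = i \<and> L t = l}"
    have T: "t \<in> S" "real b ^ i \<le> real (q t)" "real (q t) < real b ^ (i + 1)"
        "real b ^ l \<le> H t" "H t < real b ^ (l + 1)" if "t \<in> T" for t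
      using that I[of t] L[of t] by (auto simp: T_def)
    have qH_ge: "real b ^ (i + l) \<le> real (q t) * H t" if "t \<in> T" for t
      unfolding power_add using T[OF that] by (intro mult_mono) auto
    from False obtain t0 where t0: "t0 \<in> T" by (auto simp: T_def)
    have "(real b ^ (i + l))\<^sup>2 \<le> (real (q t0) * H t0)\<^sup>2"
      by (intro power_mono qH_ge t0) simp
    also have "\<dots> \<le> 9 * real X" by (rule hq)
    \<comment> \<open>Because b exceeds 9, the bound \<open>(q H)^2 \<le> 9 X\<close> stays below
      \<open>b ^ (k + 1)\<close>. This forces \<open>2 (i + l) \<le> k\<close>, as the hybrid bound
      requires.\<close>
    also have "\<dots> < real b * real X" using b X_ge by (intro mult_strict_right_mono) auto
    also have "\<dots> = real b ^ (k + 1)" by (simp add: X)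
    finally have "real b ^ (2 * (i + l)) < real b ^ (k + 1)" by (simp only: power_mult[symmetric] mult.commute)
    then have "2 * (i + l) < k + 1" using b by (subst (asm) power_strict_increasing_iff) auto
    then have il: "2 * i + 2 * l \<le> k" by simp
    have Rlt: "real R < real b ^ (i + l) * real b ^ 2"
    proof -
      have "real R < real (q t0) * H t0" by (intro qH_gt T t0)
      also have "\<dots> \<le> real b ^ (i + 1) * real b ^ (l + 1)"
        using T[OF t0] H1[of t0] by (intro mult_mono) auto
      also have "\<dots> = real b ^ (i + l) * real b ^ 2" by (simp add: power_add power2_eq_square)
      finally show ?thesis .
    qed
    have hyb: "(\<Sum>t\<in>T. norm (digit_hat t)) \<le>
        48 * K\<^sup>2 * real b ^ 7 * real k ^ 3 * real (b - 1) ^ k * real b powr (2 * alpha b C * real (i + l))"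
      unfolding X
    proof (rule missing_digit_hat_hybrid_bound[OF _ a0 r(2,1) C K L1 k il, where p = p])
      show "T \<subseteq> {..<b ^ k}" by (auto simp: T_def S_def X)
      fix t assume t: "t \<in> T"
      have "\<bar>real t / real X - p t\<bar> * real X \<le> real b ^ (l + 1)" using T(5)[OF t] by (simp add: H_def)
      then have "\<bar>real t / real X - p t\<bar> \<le> real b ^ (l + 1) / real X" using X_ge by (simp add: pos_le_divide_eq)
      then show "\<bar>real t / real (b ^ k) - p t\<bar> \<le> real (b ^ (l + 1)) / real (b ^ k)"
        unfolding X by simp
      fix t' assume t': "t' \<in> T" and ne: "p t \<noteq> p t'"
      have q0: "0 < real (q t)" "0 < real (q t')" using hq(2) by (simp_all add: Suc_le_eq)
      have eq: "p t - p t' = of_int (h t * int (q t') - h t' * int (q t)) / (real (q t) * real (q t'))"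
        using q0 by (simp add: p_def field_simps)
      have "h t * int (q t') - h t' * int (q t) \<noteq> 0"
      proof
        assume "h t * int (q t') - h t' * int (q t) = 0"
        then have "p t - p t' = 0" unfolding eq by (simp only: of_int_0 div_0)
        with ne show False by simp
      qed
      then have "1 \<le> \<bar>h t * int (q t') - h t' * int (q t)\<bar>" by linarith
      then have "1 \<le> \<bar>real_of_int (h t * int (q t') - h t' * int (q t))\<bar>" by linarith
      then have "1 / (real (q t) * real (q t')) \<le> \<bar>p t - p t'\<bar>"
        unfolding eq abs_divide using q0 by (intro frac_le) auto
      moreover have "1 / (real b ^ (i + 1) * real b ^ (i + 1)) \<le> 1 / (real (q t) * real (q t'))"
        using q0 T(3)[OF t] T(3)[OF t'] b by (intro divide_left_mono mult_mono) auto
      ultimately have "1 / (real b ^ (i + 1) * real b ^ (i + 1)) \<le> \<bar>p t - p t'\<bar>" by linarith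
      moreover have "real b ^ (i + 1) * real b ^ (i + 1) = real (b ^ (2 * i + 2))"
        by (simp add: mult_2 flip: power_add)
      ultimately show "1 / real (b ^ (2 * i + 2)) \<le> \<bar>p t - p t'\<bar>" by (simp only:)
    qed (use b in auto)
    have bil: "0 < real b ^ (i + l)" using b by simp
    have "(\<Sum>t\<in>T. norm (digit_hat t) * norm (balanced_hat t)) \<le>
        (\<Sum>t\<in>T. norm (digit_hat t) * (W * (real b ^ (i + l)) powr (- \<omega>)))"
    proof (intro sum_mono mult_left_mono)
      fix t assume t: "t \<in> T"
      have tS: "t < X" "t \<notin> major R" using T(1)[OF t] by (auto simp: S_def)
      have "norm (balanced_hat t) \<le> W * (real (q t) * H t) powr (- \<omega>)"
        unfolding W_def
        by (rule norm_exponential_sum_le[OF hyp \<omega> tS R hq(1,2)])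
          (use hq(3,4)[of t] in \<open>auto simp: p_def H_def\<close>)
      also have "\<dots> \<le> W * (real b ^ (i + l)) powr (- \<omega>)"
        using qH_ge[OF t] bil \<omega> W0 by (intro mult_left_mono powr_mono2') auto
      finally show "norm (balanced_hat t) \<le> W * (real b ^ (i + l)) powr (- \<omega>)" .
    qed simp
    also have "\<dots> = (\<Sum>t\<in>T. norm (digit_hat t)) * (W * (real b ^ (i + l)) powr (- \<omega>))"
      by (simp add: sum_distrib_right)
    also have "\<dots> \<le> (48 * K\<^sup>2 * real b ^ 7 * real k ^ 3 * real (b - 1) ^ k * real b powr (2 * alpha b C * real (i + l)))
        * (W * (real b ^ (i + l)) powr (- \<omega>))"
      using W0 by (intro mult_right_mono hyb) auto
    also have "\<dots> = W * (48 * K\<^sup>2 * real b ^ 7 * real k ^ 3 * real (b - 1) ^ k) * (real b ^ (i + l)) powr (- \<eta>)"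
    proof -
      have "real b powr (2 * alpha b C * real (i + l)) = (real b ^ (i + l)) powr (2 * alpha b C)"
        using b by (simp add: powr_powr mult_ac flip: powr_realpow)
      moreover have "(real b ^ (i + l)) powr (2 * alpha b C) * (real b ^ (i + l)) powr (- \<omega>) = (real b ^ (i + l)) powr (- \<eta>)"
        by (simp add: \<eta>_def flip: powr_add)
      ultimately show ?thesis by (simp only: mult_ac)
    qed
    also have "\<dots> \<le> Z"
      unfolding Z_def
    proof (intro mult_left_mono)
      have "(real b ^ (i + l)) powr (- \<eta>) \<le> (real R / real b ^ 2) powr (- \<eta>)"
        using Rlt R b \<eta> by (intro powr_mono2') (auto simp: pos_divide_le_eq)
      also have "\<dots> = real R powr (- \<eta>) * (real b ^ 2) powr \<eta>"
        using R b by (simp add: powr_divide powr_minus_divide)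
      also have "\<dots> \<le> real R powr (- \<eta>) * (real b ^ 2) powr 1"
        using \<eta> b by (intro mult_left_mono powr_mono) auto
      finally show "(real b ^ (i + l)) powr (- \<eta>) \<le> real b ^ 2 * real R powr (- \<eta>)"
        using b by (simp add: mult.commute)
    qed (use W0 K in simp)
    finally show ?thesis by (simp add: T_def)
  qed
  have IL: "I t \<le> k \<and> L t \<le> k" if t: "t \<in> S" for t
  proof -
    have "real b ^ (I t + L t) \<le> real (q t) * H t"
      unfolding power_add using I[of t] L[of t] by (intro mult_mono) auto
    then have "(real b ^ (I t + L t))\<^sup>2 \<le> (real (q t) * H t)\<^sup>2" by (intro power_mono) auto
    also have "\<dots> \<le> 9 * real X" by (rule hq)
    also have "\<dots> < real b * real X" using b X_ge by (intro mult_strict_right_mono) auto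
    also have "\<dots> = real b ^ (k + 1)" by (simp add: X)
    finally have "real b ^ (2 * (I t + L t)) < real b ^ (k + 1)" by (simp only: power_mult[symmetric] mult.commute)
    then have "2 * (I t + L t) < k + 1" using b by (subst (asm) power_strict_increasing_iff) auto
    then show ?thesis by simp
  qed
  have "(\<Sum>t\<in>S. norm (digit_hat t) * norm (balanced_hat t)) =
      (\<Sum>il\<in>{..k} \<times> {..k}. \<Sum>t\<in>{t \<in> S. (I t, L t) = il}. norm (digit_hat t) * norm (balanced_hat t))"
    using IL by (intro sum.group[symmetric]) (auto simp: S_def)
  also have "\<dots> \<le> (\<Sum>il\<in>{..k} \<times> {..k}. Z)"
    by (intro sum_mono) (use class_le in \<open>auto split: prod.splits\<close>)
  also have "\<dots> = real (k + 1) * real (k + 1) * Z" by (simp add: card_cartesian_product algebra_simps)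
  also have "\<dots> \<le> (2 * real k) * (2 * real k) * Z"
    using k Z0 by (intro mult_right_mono mult_mono) auto
  also have "\<dots> = 1920 * \<bar>Kc\<bar> * K\<^sup>2 * real b ^ 9 * real k ^ 5 * real (b - 1) ^ k * real X * ln (real X) powr C'
      * real R powr (- \<eta>)"
    by (simp add: Z_def W_def eval_nat_numeral mult_ac)
  finally show ?thesis by (simp only: S_def \<eta>_def)
qed

end

section \<open>Major arcs\<close>

text \<open>The ratio of the totient of n to n depends only on the primes dividing n, and q has
  exactly those of b.\<close>

lemma totient_same_prime_factors:
  assumes "b > 0" "k > 0" "b dvd q" "q dvd b ^ k"
  shows "real (totient q) * real b = real (totient b) * real q"
proof -
  have "q \<noteq> 0" using assms by (cases "q = 0") auto
  then have "prime_factors b \<subseteq> prime_factors q" "prime_factors q \<subseteq> prime_factors (b ^ k)"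
    using assms dvd_prime_factors[of q b] dvd_prime_factors[of "b ^ k" q] by simp_all
  moreover have "prime_factors (b ^ k) = prime_factors b" using assms by (simp add: prime_factors_power)
  ultimately have "prime_factors q = prime_factors b" by auto
  then show ?thesis by (simp add: totient_formula2)
qed

section \<open>Errors in arithmetic progressions\<close>

context missing_digit_setting
begin

definition prog_dev :: "nat \<Rightarrow> nat \<Rightarrow> nat \<Rightarrow> nat \<Rightarrow> real \<Rightarrow> real" where
  "prog_dev d q a m y = norm ((\<Sum>n | 1 \<le> n \<and> real n \<le> y \<and> [n = a] (mod d) \<and> [n = m] (mod q). f n)
     - of_real y * lam d / of_nat (totient (d * q)))"

lemma progression_error_eq:
  "progression_error X f lam d q = (MAX a\<in>{a. a < d \<and> coprime a d}. MAX m\<in>{m. m < q \<and> coprime m q}.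
     SUP y\<in>{real X powr (3/4)..real X}. prog_dev d q a m y)"
  by (simp add: progression_error_def prog_dev_def)

definition dev_bound :: "nat \<Rightarrow> real" where
  "dev_bound d = (3 * Kf + Kl) * (real X * ln (real X)) * (real (divisor_fun d) / real d)"

text \<open>A trivial bound with two uses: it makes the supremum in the progression error a supremum
  of a bounded set, and it lets the divisor weight be removed from the level of
  distribution.\<close>

lemma prog_dev_le:
  assumes dD: "d \<in> Dmod" and q: "q \<ge> 1" and y: "0 \<le> y" "y \<le> real X"
  shows "prog_dev d q a m y \<le> dev_bound d"
proof -
  note d = Dmod_less[OF dD]
  have \<tau>: "1 \<le> real (divisor_fun d)" using divisor_fun_ge_1[of d] d by simp
  have "norm (\<Sum>n | 1 \<le> n \<and> real n \<le> y \<and> [n = a] (mod d) \<and> [n = m] (mod q). f n)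
      \<le> (\<Sum>n | 1 \<le> n \<and> real n \<le> y \<and> [n = a] (mod d) \<and> [n = m] (mod q). norm (f n))"
    by (rule norm_sum)
  also have "\<dots> \<le> (\<Sum>n | n < X + 1 \<and> [n = a] (mod d). norm (f n))"
    by (rule sum_mono2) (use y in auto)
  also have "\<dots> \<le> Kf * ln (real X) * (real (X + 1) / real d + 1)"
    by (rule norm_sum_f_residue_le) (use d in auto)
  also have "\<dots> \<le> Kf * ln (real X) * (3 * real X * (real (divisor_fun d) / real d))"
  proof (intro mult_left_mono)
    have "real (X + 1) / real d + 1 = (real (X + 1) + real d) / real d"
      using d by (simp add: add_divide_distrib)
    also have "\<dots> \<le> 3 * real X / real d" using d X_ge by (intro divide_right_mono) auto
    finally have "real (X + 1) / real d + 1 \<le> 3 * real X / real d" .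
    also have "3 * real X / real d = 3 * real X * (1 / real d)" by simp
    also have "\<dots> \<le> 3 * real X * (real (divisor_fun d) / real d)"
      using \<tau> by (intro mult_left_mono divide_right_mono) auto
    finally show "real (X + 1) / real d + 1 \<le> 3 * real X * (real (divisor_fun d) / real d)" .
  qed (use Kf_nonneg ln_X_ge_1 in auto)
  finally have 1: "norm (\<Sum>n | 1 \<le> n \<and> real n \<le> y \<and> [n = a] (mod d) \<and> [n = m] (mod q). f n) \<le>
      Kf * ln (real X) * (3 * real X * (real (divisor_fun d) / real d))" .
  have tot: "real (totient d) \<le> real (totient (d * q))"
    using d q by (simp add: totient_dvd_mono)
  have "norm (of_real y * lam d / of_nat (totient (d * q))) = y * norm (lam d) / real (totient (d * q))"
    using y by (simp add: norm_mult norm_divide)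
  also have "\<dots> \<le> real X * norm (lam d) / real (totient d)"
    using y tot d by (intro frac_le mult_right_mono) (auto simp: Suc_le_eq)
  also have "\<dots> = real X * (norm (lam d) / real (totient d))" by simp
  also have "\<dots> \<le> real X * (Kl * ln (real X) * (real (divisor_fun d) / real d))"
    by (intro mult_left_mono norm_lam_div_totient_le dD) simp
  finally have 2: "norm (of_real y * lam d / of_nat (totient (d * q)))
      \<le> real X * (Kl * ln (real X) * (real (divisor_fun d) / real d))" .
  have "prog_dev d q a m y \<le> Kf * ln (real X) * (3 * real X * (real (divisor_fun d) / real d)) +
      real X * (Kl * ln (real X) * (real (divisor_fun d) / real d))"
    unfolding prog_dev_def by (intro order.trans[OF norm_triangle_ineq4] add_mono 1 2)
  also have "\<dots> = dev_bound d" by (simp add: dev_bound_def algebra_simps)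
  finally show ?thesis .
qed

lemma powr_34_le: "1 \<le> real X powr (3/4)" "real X powr (3/4) \<le> real X"
proof -
  show "1 \<le> real X powr (3/4)" using X_ge by (intro ge_one_powr_ge_zero) auto
  have "real X powr (3/4) \<le> real X powr 1" using X_ge by (intro powr_mono) auto
  then show "real X powr (3/4) \<le> real X" by simp
qed

lemma prog_dev_le_error:
  assumes dD: "d \<in> Dmod" and q: "q \<ge> 1" and a: "a < d" "coprime a d" and m: "m < q" "coprime m q"
    and y: "real X powr (3/4) \<le> y" "y \<le> real X"
  shows "prog_dev d q a m y \<le> progression_error X f lam d q"
proof -
  let ?S = "\<lambda>a m. SUP y\<in>{real X powr (3/4)..real X}. prog_dev d q a m y"
  have y0: "0 \<le> y" if "y \<in> {real X powr (3/4)..real X}" for y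
    using that powr_34_le(1) unfolding atLeastAtMost_iff by linarith
  have "bdd_above (prog_dev d q a m ` {real X powr (3/4)..real X})"
    using prog_dev_le[OF dD q] y0 by (intro bdd_aboveI[of _ "dev_bound d"]) auto
  then have "prog_dev d q a m y \<le> ?S a m"
    using y by (intro cSUP_upper) auto
  also have "\<dots> \<le> (MAX m\<in>{m. m < q \<and> coprime m q}. ?S a m)"
    using m by (intro Max_ge) auto
  also have "\<dots> \<le> progression_error X f lam d q"
    unfolding progression_error_eq using a by (intro Max_ge) auto
  finally show ?thesis .
qed

lemma ex_coprime_less:
  fixes d :: nat
  assumes "d \<ge> 1"
  shows "\<exists>a<d. coprime a d"
proof (cases "d = 1")
  case False
  with assms show ?thesis by (intro exI[of _ 1]) auto
qed (auto intro: exI[of _ 0])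

lemma progression_error_le:
  assumes dD: "d \<in> Dmod" and q: "q \<ge> 1"
  shows "progression_error X f lam d q \<le> dev_bound d"
proof -
  note d = Dmod_less[OF dD]
  have ne: "{real X powr (3/4)..real X} \<noteq> {}" using powr_34_le by simp
  have y0: "0 \<le> y" if "y \<in> {real X powr (3/4)..real X}" for y
    using that powr_34_le(1) unfolding atLeastAtMost_iff by linarith
  have S: "(SUP y\<in>{real X powr (3/4)..real X}. prog_dev d q a m y) \<le> dev_bound d" for a m
    using y0 by (intro cSUP_least ne prog_dev_le[OF dD q]) auto
  have M: "(MAX m\<in>{m. m < q \<and> coprime m q}.
      SUP y\<in>{real X powr (3/4)..real X}. prog_dev d q a m y) \<le> dev_bound d" for a
    using ex_coprime_less[OF q] S by (intro Max.boundedI) auto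
  show ?thesis
    unfolding progression_error_eq using ex_coprime_less[OF d(1)] M by (intro Max.boundedI) auto
qed

lemma progression_error_nonneg:
  assumes dD: "d \<in> Dmod" and q: "q \<ge> 1"
  shows "0 \<le> progression_error X f lam d q"
proof -
  obtain a where a: "a < d" "coprime a d" using ex_coprime_less Dmod_less(1)[OF dD] by blast
  obtain m where m: "m < q" "coprime m q" using ex_coprime_less[OF q] by blast
  have "0 \<le> prog_dev d q a m (real X)" by (simp add: prog_dev_def)
  also have "\<dots> \<le> progression_error X f lam d q"
    by (rule prog_dev_le_error[OF dD q a m powr_34_le(2)]) simp
  finally show ?thesis .
qed

text \<open>All terms are nonnegative, so the hypothesis for the double sum bounds the errors for a
  single q.\<close>

lemma sum_progression_error_le:
  assumes hyp: "level_of_distribution_hyp b X D f lam K" and "A > 0" "B > 0"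
    and q: "q dvd X" "real q \<le> ln (real X) powr B"
  shows "(\<Sum>d\<in>Dmod. progression_error X f lam d q) \<le> K A B * (real X / ln (real X) powr A)"
proof -
  let ?Q = "{q. q dvd X \<and> real q \<le> ln (real X) powr B}"
  have Xn0: "X \<noteq> 0" using X_ge by simp
  then have fin: "finite ?Q" by (auto intro: finite_subset[OF _ finite_divisors_nat])
  have "(\<Sum>d\<in>Dmod. progression_error X f lam d q) \<le> (\<Sum>d\<in>Dmod. \<Sum>q\<in>?Q. progression_error X f lam d q)"
  proof (rule sum_mono)
    fix d assume dD: "d \<in> Dmod"
    show "progression_error X f lam d q \<le> (\<Sum>q\<in>?Q. progression_error X f lam d q)"
    proof (rule member_le_sum)
      fix q' assume "q' \<in> ?Q - {q}"
      then have "q' \<ge> 1" using Xn0 by (auto simp: Suc_le_eq intro: Nat.gr0I)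
      then show "0 \<le> progression_error X f lam d q'" by (rule progression_error_nonneg[OF dD])
    qed (use q fin in auto)
  qed
  also have "\<dots> \<le> K A B * (real X / ln (real X) powr A)"
    using hyp assms(2,3) unfolding level_of_distribution_hyp_def by blast
  finally show ?thesis .
qed

lemma coprime_modulus_iff:
  assumes "b dvd q" "q dvd X"
  shows "coprime n q \<longleftrightarrow> coprime n b"
proof
  assume "coprime n q"
  then show "coprime n b" using assms(1) coprime_divisors[of n n b q] by simp
next
  assume "coprime n b"
  then have "coprime n X" by (simp add: X)
  then show "coprime n q" using assms(2) coprime_divisors[of n n q X] by simp
qed

text \<open>The second summand pays for initial segments too short for the hypothesis, of length up
  to about X^(3/4), and for rounding when a residue class is counted.\<close>

definition class_bound :: "nat \<Rightarrow> nat \<Rightarrow> real" where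
  "class_bound d q = progression_error X f lam d q +
     (3 * Kf + 2 * real b * Kl) * (ln (real X) * real X powr (3/4)) * (real (divisor_fun d) / real d)"

lemma class_bound_nonneg:
  assumes "d \<in> Dmod" "q \<ge> 1"
  shows "0 \<le> class_bound d q"
  using progression_error_nonneg[OF assms] Kf_nonneg Kl_nonneg ln_X_ge_1
  by (simp add: class_bound_def)

text \<open>On one residue class modulo q the density of the main term is the predicted one, because
  \<open>b / totient b = q / totient q\<close> and d is prime to q.\<close>

lemma main_coeff_eq:
  assumes dD: "d \<in> Dmod" and q: "b dvd q" "q dvd X"
  shows "main_coeff d * (of_real y / of_nat q) = of_real y * lam d / of_nat (totient (d * q))"
proof -
  note d = Dmod_less[OF dD]
  have q0: "q \<noteq> 0" using q X_ge by (cases "q = 0") auto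
  have "coprime d q" using coprime_modulus_iff[OF q] d by blast
  then have tot: "totient (d * q) = totient d * totient q" by (rule totient_mult_coprime)
  have "real (totient q) * real b = real (totient b) * real q"
    using totient_same_prime_factors[of b k q] b k q by (simp add: X)
  then have "real (totient q * b) = real (totient b * q)" by simp
  then have "totient q * b = totient b * q" by (simp only: of_nat_eq_iff)
  then have "(of_nat (totient q * b) :: complex) = of_nat (totient b * q)" by (rule arg_cong)
  then have "of_nat (totient q) * of_nat b = (of_nat (totient b) * of_nat q :: complex)"
    by (simp only: of_nat_mult)
  moreover have "(of_nat (totient q) :: complex) \<noteq> 0" "(of_nat (totient b) :: complex) \<noteq> 0"
      "(of_nat (totient d) :: complex) \<noteq> 0" "(of_nat q :: complex) \<noteq> 0"
    using q0 b d by (auto simp: totient_0_iff)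
  ultimately show ?thesis
    unfolding main_coeff_def tot of_nat_mult by (simp add: field_simps)
qed

lemma norm_class_sum_le:
  assumes dD: "d \<in> Dmod" and cd: "coprime (c d) d" and q: "b dvd q" "q dvd X"
    and m: "m < q" and y: "y \<le> X"
  shows "norm (\<Sum>n<y. if n mod q = m then balanced d n else 0) \<le> class_bound d q"
proof -
  note d = Dmod_less[OF dD]
  have q1: "q \<ge> 1" using m by simp
  have \<tau>: "1 \<le> real (divisor_fun d)" using divisor_fun_ge_1[of d] d by simp
  have lx: "0 \<le> ln (real X)" using ln_X_ge_1 by simp
  have main: "norm (main_coeff d) \<le> real b * Kl * ln (real X) * (real (divisor_fun d) / real d)"
    by (rule norm_main_coeff_le[OF dD])
  define P where "P = real X powr (3/4)"
  have P1: "1 \<le> P" using powr_34_le by (simp add: P_def)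
  have PE: "0 \<le> progression_error X f lam d q" by (rule progression_error_nonneg[OF dD q1])
  have cb: "class_bound d q = progression_error X f lam d q +
      Kf * ln (real X) * (3 * P * (real (divisor_fun d) / real d)) +
      2 * P * (real b * Kl * ln (real X) * (real (divisor_fun d) / real d))"
    by (simp add: class_bound_def P_def algebra_simps)
  have f_part: "0 \<le> Kf * ln (real X) * (3 * P * (real (divisor_fun d) / real d))"
    using Kf_nonneg lx P1 by simp
  have m_part: "2 * P * norm (main_coeff d) \<le> 2 * P * (real b * Kl * ln (real X) * (real (divisor_fun d) / real d))"
    using main P1 by (intro mult_left_mono) auto
  show ?thesis
  proof (cases "coprime m q")
    \<comment> \<open>A class not prime to q contains no n prime to b, so both parts of
      \<open>balanced\<close> vanish on it.\<close>
    case False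
    have "(if n mod q = m then balanced d n else 0) = 0" for n
    proof (cases "n mod q = m")
      case True
      then have "\<not> coprime n q" using False q1 coprime_mod_left_iff[of q n] by auto
      then have "\<not> coprime n b" using coprime_modulus_iff[OF q] by simp
      then have "balanced d n = 0" using f_coprime[of n] by (auto simp: balanced_def)
      then show ?thesis by simp
    qed simp
    then have "(\<Sum>n<y. if n mod q = m then balanced d n else 0) = 0" by simp
    moreover have "0 \<le> 2 * P * norm (main_coeff d)" using P1 by simp
    ultimately show ?thesis using PE f_part m_part unfolding cb by simp
  next
    case True
    define G where "G = (\<Sum>n | n < y \<and> [n = c d] (mod d) \<and> n mod q = m. f n)"
    define N where "N = card {n. n < y \<and> n mod q = m}"
    have cop: "coprime n b" if "n mod q = m" for n
    proof -
      have "coprime n q" using True that q1 coprime_mod_left_iff[of q n] by auto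
      then show ?thesis using coprime_modulus_iff[OF q] by simp
    qed
    have "(\<Sum>n<y. if n mod q = m then balanced d n else 0) =
        (\<Sum>n<y. if [n = c d] (mod d) \<and> n mod q = m then f n else 0)
        - (\<Sum>n<y. if n mod q = m then main_coeff d else 0)"
      unfolding sum_subtractf[symmetric]
    proof (rule sum.cong[OF refl])
      fix n
      show "(if n mod q = m then balanced d n else 0) =
          (if [n = c d] (mod d) \<and> n mod q = m then f n else 0) - (if n mod q = m then main_coeff d else 0)"
        by (cases "n mod q = m") (simp_all add: balanced_def cop)
    qed
    also have "(\<Sum>n<y. if [n = c d] (mod d) \<and> n mod q = m then f n else 0) = G"
      unfolding G_def by (rule sum.mono_neutral_cong_right) auto
    also have "(\<Sum>n<y. if n mod q = m then main_coeff d else 0) = (\<Sum>n | n < y \<and> n mod q = m. main_coeff d)"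
      by (rule sum.mono_neutral_cong_right) auto
    also have "\<dots> = of_nat N * main_coeff d" by (simp add: N_def)
    finally have eq: "(\<Sum>n<y. if n mod q = m then balanced d n else 0) = G - of_nat N * main_coeff d" .
    show ?thesis
    proof (cases "P \<le> real y - 1")
      case large: True
      have y1: "y \<ge> 1" using large P1 by linarith
      \<comment> \<open>The sum runs over n < y, the hypothesis over n at most z; for z = y - 1
        these are the same integers, apart from n = 0 where f vanishes.\<close>
      define z where "z = real y - 1"
      have "c d mod d < d" using d by simp
      moreover have "coprime (c d mod d) d" using cd d coprime_mod_left_iff[of d "c d"] by simp
      ultimately have "prog_dev d q (c d mod d) m z \<le> progression_error X f lam d q"
        using large y unfolding P_def z_def
        by (intro prog_dev_le_error[OF dD q1 _ _ m True]) auto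
      moreover have "(\<Sum>n | 1 \<le> n \<and> real n \<le> z \<and> [n = c d mod d] (mod d) \<and> [n = m] (mod q). f n) = G"
        unfolding G_def
      proof (rule sum.mono_neutral_left)
        have z: "real n \<le> z \<longleftrightarrow> n < y" for n unfolding z_def using y1 by linarith
        have residue: "[n = c d mod d] (mod d) \<and> [n = m] (mod q) \<longleftrightarrow> [n = c d] (mod d) \<and> n mod q = m" for n
          unfolding cong_def using m by simp
        show "{n. 1 \<le> n \<and> real n \<le> z \<and> [n = c d mod d] (mod d) \<and> [n = m] (mod q)}
            \<subseteq> {n. n < y \<and> [n = c d] (mod d) \<and> n mod q = m}"
          unfolding z residue by blast
        show "\<forall>i\<in>{n. n < y \<and> [n = c d] (mod d) \<and> n mod q = m} -
            {n. 1 \<le> n \<and> real n \<le> z \<and> [n = c d mod d] (mod d) \<and> [n = m] (mod q)}. f i = 0"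
        proof
          fix i assume "i \<in> {n. n < y \<and> [n = c d] (mod d) \<and> n mod q = m} -
            {n. 1 \<le> n \<and> real n \<le> z \<and> [n = c d mod d] (mod d) \<and> [n = m] (mod q)}"
          then have "\<not> 1 \<le> i" unfolding z residue by blast
          then have "i = 0" by simp
          then show "f i = 0" using f_0 by simp
        qed
      qed simp
      ultimately have dev: "norm (G - main_coeff d * (of_real z / of_nat q)) \<le> progression_error X f lam d q"
        unfolding prog_dev_def main_coeff_eq[OF dD q] by simp
      have "norm (main_coeff d * (of_real z / of_nat q) - of_nat N * main_coeff d)
          = norm (main_coeff d * of_real (z / real q - real N))"
        by (simp add: algebra_simps)
      also have "\<dots> = norm (main_coeff d) * \<bar>z / real q - real N\<bar>"
        by (simp only: norm_mult norm_of_real)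
      also have "\<dots> \<le> norm (main_coeff d) * 2"
      proof (rule mult_left_mono)
        have "\<bar>real N - real y / real q\<bar> \<le> 1" unfolding N_def by (rule card_residue_class_bounds[OF m])
        moreover have "real y / real q - z / real q = 1 / real q" by (simp add: z_def diff_divide_distrib)
        moreover have "0 \<le> 1 / real q" "1 / real q \<le> 1" using q1 by auto
        ultimately show "\<bar>z / real q - real N\<bar> \<le> 2" by linarith
      qed simp
      also have "\<dots> \<le> 2 * P * norm (main_coeff d)" using P1 mult_right_mono[OF P1, of "norm (main_coeff d)"] by simp
      finally have rest: "norm (main_coeff d * (of_real z / of_nat q) - of_nat N * main_coeff d) \<le> 2 * P * norm (main_coeff d)" .
      have "norm (G - of_nat N * main_coeff d) \<le>
          norm (G - main_coeff d * (of_real z / of_nat q)) +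
          norm (main_coeff d * (of_real z / of_nat q) - of_nat N * main_coeff d)"
        using norm_triangle_ineq[of "G - main_coeff d * (of_real z / of_nat q)"
            "main_coeff d * (of_real z / of_nat q) - of_nat N * main_coeff d"] by simp
      then show ?thesis unfolding eq cb using dev rest m_part f_part by linarith
    next
      case small: False
      have yP: "real y \<le> 2 * P" using small P1 by linarith
      \<comment> \<open>Below the range of the hypothesis the trivial bound is used. Its term
        \<open>+ 1\<close> is absorbed into \<open>P / d\<close>, since d is at most
        X^(1/2).\<close>
      have dP: "real d \<le> P"
      proof -
        have "real d \<le> real X powr (1/2)" by (rule d)
        also have "\<dots> \<le> P" unfolding P_def using X_ge by (intro powr_mono) auto
        finally show ?thesis .
      qed
      have "norm G \<le> (\<Sum>n | n < y \<and> [n = c d] (mod d) \<and> n mod q = m. norm (f n))"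
        unfolding G_def by (rule norm_sum)
      also have "\<dots> \<le> (\<Sum>n | n < y \<and> [n = c d] (mod d). norm (f n))"
        by (rule sum_mono2) auto
      also have "\<dots> \<le> Kf * ln (real X) * (real y / real d + 1)"
        by (rule norm_sum_f_residue_le) (use d y in auto)
      also have "\<dots> \<le> Kf * ln (real X) * (3 * P * (real (divisor_fun d) / real d))"
      proof (intro mult_left_mono)
        have "real y / real d + 1 = (real y + real d) / real d" using d by (simp add: add_divide_distrib)
        also have "\<dots> \<le> 3 * P / real d" using yP dP by (intro divide_right_mono) auto
        finally have "real y / real d + 1 \<le> 3 * P / real d" .
        also have "3 * P / real d = 3 * P * (1 / real d)" by simp
        also have "\<dots> \<le> 3 * P * (real (divisor_fun d) / real d)"
          using \<tau> P1 by (intro mult_left_mono divide_right_mono) auto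
        finally show "real y / real d + 1 \<le> 3 * P * (real (divisor_fun d) / real d)" .
      qed (use Kf_nonneg lx in auto)
      finally have G: "norm G \<le> Kf * ln (real X) * (3 * P * (real (divisor_fun d) / real d))" .
      have "N \<le> card {..<y}" unfolding N_def by (intro card_mono) auto
      then have "real N \<le> 2 * P" using yP by simp
      then have "norm (of_nat N * main_coeff d) \<le> 2 * P * norm (main_coeff d)"
        unfolding norm_mult norm_of_nat by (intro mult_right_mono) auto
      then show ?thesis unfolding eq cb using G m_part PE
        by (intro order.trans[OF norm_triangle_ineq4]) linarith
    qed
  qed
qed

text \<open>Passing from u to \<open>lcm u b\<close> makes both the phase \<open>e (h n / u)\<close>
  and the condition of being prime to b constant on residue classes. What remains of the phase
  rotates by at most about \<open>R / X\<close> per step and is removed by partial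
  summation.\<close>

lemma norm_balanced_hat_major_le:
  assumes t: "t < X" and u: "1 \<le> u" "u \<le> R" "u dvd X"
    and near: "\<bar>real t / real X - of_int h / real u\<bar> \<le> real R / real X"
  shows "norm (balanced_hat t) \<le> real R * real b * (1 + 2 * pi * real R) *
    (\<Sum>d\<in>Dmod. real (divisor_fun d) * class_bound d (lcm u b))"
proof -
  define q where "q = lcm u b"
  have q0: "q > 0" using u b by (auto simp: q_def lcm_pos_nat)
  have bq: "b dvd q" and qX: "q dvd X" using u(3) k by (auto simp: q_def X intro!: dvd_power)
  have "q \<le> u * b"
    unfolding q_def using u b by (intro dvd_imp_le lcm_least) auto
  also have "\<dots> \<le> R * b" using u by simp
  finally have qR: "real q \<le> real R * real b" by (simp flip: of_nat_mult)
  obtain j where j: "q = u * j" unfolding q_def by (meson dvd_lcm1 dvdE)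
  define h' where "h' = h * int j"
  have j0: "j > 0" using q0 j by simp
  have hq: "of_int h / real u = of_int h' / real q" using j0 u by (simp add: h'_def j)
  define \<beta> where "\<beta> = real t / real X - of_int h' / real q"
  have \<beta>: "\<bar>\<beta>\<bar> \<le> real R / real X" using near by (simp add: \<beta>_def hq)
  define z where "z = e (- \<beta>)"
  have z: "norm z = 1" by (simp add: z_def)
  have z1: "1 + real X * norm (1 - z) \<le> 1 + 2 * pi * real R"
  proof -
    have "norm (1 - z) \<le> 2 * pi * \<bar>\<beta>\<bar>" using norm_one_minus_e_le[of "- \<beta>"] by (simp add: z_def)
    also have "\<dots> \<le> 2 * pi * (real R / real X)" by (intro mult_left_mono \<beta>) simp
    finally have "real X * norm (1 - z) \<le> real X * (2 * pi * (real R / real X))"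
      by (intro mult_left_mono) auto
    also have "\<dots> = 2 * pi * real R" using X_ge by simp
    finally show ?thesis by simp
  qed
  have phase: "e (- (real n * (real t / real X))) = e (- (real (n mod q) * (of_int h' / real q))) * z ^ n" for n
  proof -
    have "n = q * (n div q) + n mod q" by simp
    then have "real n = real (q * (n div q) + n mod q)" by (rule arg_cong)
    then have "real n = real (q * (n div q)) + real (n mod q)" by (simp only: of_nat_add)
    then have "real n * (of_int h' / real q) = real (n mod q) * (of_int h' / real q) + of_int (int (n div q) * h')"
      using q0 by (simp add: field_simps)
    then have "- (real n * (real t / real X)) =
        (- (real (n mod q) * (of_int h' / real q)) + real n * (- \<beta>)) + of_int (- (int (n div q) * h'))"
      by (simp add: \<beta>_def algebra_simps)
    then have "e (- (real n * (real t / real X))) =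
        e (- (real (n mod q) * (of_int h' / real q)) + real n * (- \<beta>))"
      by (simp only: e_add_of_int)
    then show ?thesis by (simp only: e_add e_of_nat_mult z_def)
  qed
  have single: "norm (\<sigma> d) * norm (\<Sum>n<X. balanced d n * e (- (real n * (real t / real X)))) \<le>
      real (divisor_fun d) * (real R * real b * (1 + 2 * pi * real R) * class_bound d q)" if dD: "d \<in> Dmod" for d
  proof (cases "\<sigma> d = 0")
    case True
    then show ?thesis using class_bound_nonneg[OF dD] q0 by simp
  next
    case False
    then have cd: "coprime (c d) d" by (rule c)
    have CB: "0 \<le> class_bound d q" using class_bound_nonneg[OF dD] q0 by simp
    let ?a = "\<lambda>m n. if n mod q = m then balanced d n else 0"
    have "(\<Sum>n<X. balanced d n * e (- (real n * (real t / real X)))) =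
        (\<Sum>n<X. \<Sum>m<q. e (- (real m * (of_int h' / real q))) * (?a m n * z ^ n))"
    proof (rule sum.cong[OF refl])
      fix n
      have "(\<Sum>m<q. e (- (real m * (of_int h' / real q))) * (?a m n * z ^ n)) =
          (\<Sum>m<q. if m = n mod q then e (- (real m * (of_int h' / real q))) * (balanced d n * z ^ n) else 0)"
        by (intro sum.cong refl) auto
      also have "\<dots> = e (- (real (n mod q) * (of_int h' / real q))) * (balanced d n * z ^ n)"
        using q0 by simp
      finally show "balanced d n * e (- (real n * (real t / real X))) =
          (\<Sum>m<q. e (- (real m * (of_int h' / real q))) * (?a m n * z ^ n))"
        unfolding phase by (simp only: mult_ac)
    qed
    also have "\<dots> = (\<Sum>m<q. e (- (real m * (of_int h' / real q))) * (\<Sum>n<X. ?a m n * z ^ n))"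
      by (subst sum.swap) (simp only: sum_distrib_left)
    finally have "norm (\<Sum>n<X. balanced d n * e (- (real n * (real t / real X)))) \<le>
        (\<Sum>m<q. norm (\<Sum>n<X. ?a m n * z ^ n))"
      by (simp only:) (rule sum_norm_le, simp add: norm_mult)
    also have "\<dots> \<le> (\<Sum>m<q. class_bound d q * (1 + real X * norm (1 - z)))"
      by (intro sum_mono norm_sum_power_le z norm_class_sum_le[OF dD cd bq qX]) auto
    also have "\<dots> = real q * class_bound d q * (1 + real X * norm (1 - z))" by simp
    also have "\<dots> \<le> (real R * real b) * class_bound d q * (1 + 2 * pi * real R)"
      by (intro mult_mono qR z1 mult_nonneg_nonneg CB order.refl) auto
    finally show ?thesis
      by (intro mult_mono \<sigma>) (simp_all add: mult_ac)
  qed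
  have "balanced_hat t = (\<Sum>d\<in>Dmod. \<sigma> d * (\<Sum>n<X. balanced d n * e (- (real n * (real t / real X)))))"
    unfolding balanced_hat_def balanced_sum_def sum_distrib_right
    by (subst sum.swap) (simp only: sum_distrib_left mult.assoc)
  then have "norm (balanced_hat t) \<le> (\<Sum>d\<in>Dmod. real (divisor_fun d) *
      (real R * real b * (1 + 2 * pi * real R) * class_bound d q))"
    by (simp only:) (rule sum_norm_le, simp only: norm_mult single)
  then show ?thesis by (simp add: q_def sum_distrib_left mult_ac)
qed

text \<open>
  The weight \<open>\<tau>(d)\<close> is removed by \<open>\<tau> \<le> \<tau>\<^sup>2 / V + V\<close>, using the trivial bound for the first part.
\<close>
lemma sum_class_bound_le:
  assumes hyp: "level_of_distribution_hyp b X D f lam K" and A: "A > 0" "B > 0"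
    and q: "q dvd X" "real q \<le> ln (real X) powr B" "q \<ge> 1" and V: "V > 0"
  shows "(\<Sum>d\<in>Dmod. real (divisor_fun d) * class_bound d q) \<le>
    (3 * Kf + Kl) * (real X * ln (real X)) * (1 + ln (real X)) ^ 8 / V
    + V * (K A B * (real X / ln (real X) powr A))
    + (3 * Kf + 2 * real b * Kl) * (ln (real X) * real X powr (3/4)) * (1 + ln (real X)) ^ 4"
proof -
  let ?\<tau> = "\<lambda>d. real (divisor_fun d)"
  let ?E = "\<lambda>d. progression_error X f lam d q"
  let ?W = "(3 * Kf + 2 * real b * Kl) * (ln (real X) * real X powr (3/4))"
  have W: "0 \<le> ?W" using Kf_nonneg Kl_nonneg ln_X_ge_1 by simp
  have "(\<Sum>d\<in>Dmod. ?\<tau> d * class_bound d q) \<le>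
      (\<Sum>d\<in>Dmod. (3 * Kf + Kl) * (real X * ln (real X)) / V * (?\<tau> d ^ 3 / real d) + V * ?E d + ?W * (?\<tau> d ^ 2 / real d))"
  proof (rule sum_mono)
    fix d assume dD: "d \<in> Dmod"
    have E: "0 \<le> ?E d" "?E d \<le> dev_bound d"
      using progression_error_nonneg[OF dD q(3)] progression_error_le[OF dD q(3)] by auto
    have "?\<tau> d * V \<le> ?\<tau> d ^ 2 + V ^ 2"
    proof -
      have "0 \<le> (?\<tau> d - V) ^ 2" "0 \<le> ?\<tau> d * V" using V by simp_all
      then show ?thesis unfolding power2_diff by linarith
    qed
    then have "?\<tau> d \<le> ?\<tau> d ^ 2 / V + V" using V by (simp add: field_simps power2_eq_square)
    then have "?\<tau> d * ?E d \<le> (?\<tau> d ^ 2 / V + V) * ?E d" using E by (intro mult_right_mono) auto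
    also have "\<dots> = ?\<tau> d ^ 2 / V * ?E d + V * ?E d" by (simp add: distrib_right)
    also have "?\<tau> d ^ 2 / V * ?E d \<le> ?\<tau> d ^ 2 / V * dev_bound d"
      using E V by (intro mult_left_mono) auto
    also have "?\<tau> d ^ 2 / V * dev_bound d = (3 * Kf + Kl) * (real X * ln (real X)) / V * (?\<tau> d ^ 3 / real d)"
      by (simp add: dev_bound_def power2_eq_square power3_eq_cube)
    finally have "?\<tau> d * ?E d \<le> (3 * Kf + Kl) * (real X * ln (real X)) / V * (?\<tau> d ^ 3 / real d) + V * ?E d" by simp
    moreover have "?\<tau> d * class_bound d q = ?\<tau> d * ?E d + ?W * (?\<tau> d ^ 2 / real d)"
      by (simp add: class_bound_def distrib_left power2_eq_square)
    ultimately show "?\<tau> d * class_bound d q \<le> (3 * Kf + Kl) * (real X * ln (real X)) / V * (?\<tau> d ^ 3 / real d)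
        + V * ?E d + ?W * (?\<tau> d ^ 2 / real d)" by linarith
  qed
  also have "\<dots> = (3 * Kf + Kl) * (real X * ln (real X)) / V * (\<Sum>d\<in>Dmod. ?\<tau> d ^ 3 / real d)
      + V * (\<Sum>d\<in>Dmod. ?E d) + ?W * (\<Sum>d\<in>Dmod. ?\<tau> d ^ 2 / real d)"
    by (simp only: sum.distrib sum_distrib_left)
  also have "\<dots> \<le> (3 * Kf + Kl) * (real X * ln (real X)) / V * (1 + ln (real X)) ^ 8
      + V * (K A B * (real X / ln (real X) powr A)) + ?W * (1 + ln (real X)) ^ 4"
    using sum_Dmod_divisor_fun_le[of 3] sum_Dmod_divisor_fun_le[of 2]
      sum_progression_error_le[OF hyp A q(1,2)] W V Kf_nonneg Kl_nonneg ln_X_ge_1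
    by (intro add_mono mult_left_mono) auto
  finally show ?thesis by simp
qed

lemma norm_digit_hat_le: "norm (digit_hat t) \<le> real (b - 1) ^ k"
  using norm_missing_digit_hat_le_power[of b a0 r "k - 1" "real t / real X"] b a0 r k by simp

lemma norm_discrepancy_trivial_le:
  "norm discrepancy \<le> real s * Kf * ln (real X) * (real X powr (1/2) * (1 + ln (real X)) ^ 2)
    + real (b - 1) ^ k * ((2 * Kf + real b * Kl) * (real X * ln (real X) * (1 + ln (real X)) ^ 4))"
proof -
  let ?U = "(2 * Kf + real b * Kl) * (real X * ln (real X) * (1 + ln (real X)) ^ 4)"
  have "(\<Sum>t<X. norm (digit_hat t) * norm (balanced_hat t)) \<le> (\<Sum>t<X. real (b - 1) ^ k * ?U)"
    by (intro sum_mono mult_mono norm_digit_hat_le norm_balanced_hat_trivial_le) auto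
  also have "\<dots> = real X * (real (b - 1) ^ k * ?U)" by simp
  finally have "(\<Sum>t<X. norm (digit_hat t) * norm (balanced_hat t)) / real X \<le> real (b - 1) ^ k * ?U"
    using X_ge by (simp add: pos_divide_le_eq mult_ac)
  then show ?thesis using norm_discrepancy_le by linarith
qed

text \<open>\<open>E1\<close> belongs to the denominators dividing X, where
  \<open>balanced_hat\<close> is small, and \<open>E2\<close> to the others, where the digit
  coefficient is small. Together with the count of frequencies the first costs R^5, which the
  savings have to beat.\<close>

lemma major_arcs_le:
  assumes hyp: "level_of_distribution_hyp b X D f lam K" and AB: "A > 0" "B > 0"
    and R: "1 \<le> R" "R \<le> X" "2 * R\<^sup>2 \<le> b ^ J" "real R * real b \<le> ln (real X) powr B"
    and J: "J \<ge> 1" "J\<^sup>2 \<le> k" and V: "V > 0"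
  defines "E1 \<equiv> real R * real b * (1 + 2 * pi * real R) *
      ((3 * Kf + Kl) * (real X * ln (real X)) * (1 + ln (real X)) ^ 8 / V
       + V * (\<bar>K A B\<bar> * (real X / ln (real X) powr A))
       + (3 * Kf + 2 * real b * Kl) * (ln (real X) * real X powr (3/4)) * (1 + ln (real X)) ^ 4)"
    and "E2 \<equiv> real k * (digit_gap b ^ (J - 1) + 1 / real (b - 1) ^ J) *
      ((2 * Kf + real b * Kl) * (real X * ln (real X) * (1 + ln (real X)) ^ 4))"
  shows "(\<Sum>t\<in>major R. norm (digit_hat t) * norm (balanced_hat t)) \<le>
    16 * real R ^ 3 * (real (b - 1) ^ k * (E1 + E2))"
proof -
  have lx: "0 < ln (real X)" using ln_X_ge_1 by simp
  have E1: "0 \<le> E1" unfolding E1_def using Kf_nonneg Kl_nonneg lx V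
    by (intro mult_nonneg_nonneg add_nonneg_nonneg divide_nonneg_nonneg) auto
  have gap: "0 \<le> digit_gap b" using digit_gap_bounds[of b] b by simp
  have E2: "0 \<le> E2" unfolding E2_def using Kf_nonneg Kl_nonneg lx gap
    by (intro mult_nonneg_nonneg add_nonneg_nonneg divide_nonneg_nonneg) auto
  have single: "norm (digit_hat t) * norm (balanced_hat t) \<le> real (b - 1) ^ k * (E1 + E2)" if t: "t \<in> major R" for t
  proof -
    obtain h q where tX: "t < X" and q: "1 \<le> q" "q \<le> R" "coprime h (int q)"
      and near: "\<bar>real t / real X - of_int h / real q\<bar> \<le> real R / real X"
      using t unfolding major_def by blast
    show ?thesis
    proof (cases "q dvd X")
      case True
      define Q where "Q = lcm q b"
      have Q1: "Q \<ge> 1" using q b by (simp add: Q_def Suc_le_eq lcm_pos_nat)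
      have QX: "Q dvd X" using True k by (auto simp: Q_def X intro!: dvd_power)
      have "Q \<le> q * b" unfolding Q_def using q b by (intro dvd_imp_le lcm_least) auto
      also have "\<dots> \<le> R * b" using q by simp
      finally have "real Q \<le> real R * real b" by (simp flip: of_nat_mult)
      then have QB: "real Q \<le> ln (real X) powr B" using R(4) by linarith
      have "norm (balanced_hat t) \<le> real R * real b * (1 + 2 * pi * real R) *
          (\<Sum>d\<in>Dmod. real (divisor_fun d) * class_bound d Q)"
        unfolding Q_def by (rule norm_balanced_hat_major_le[OF tX q(1,2) True near])
      also have "\<dots> \<le> real R * real b * (1 + 2 * pi * real R) *
        ((3 * Kf + Kl) * (real X * ln (real X)) * (1 + ln (real X)) ^ 8 / V
       + V * (K A B * (real X / ln (real X) powr A))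
       + (3 * Kf + 2 * real b * Kl) * (ln (real X) * real X powr (3/4)) * (1 + ln (real X)) ^ 4)"
        by (intro mult_left_mono sum_class_bound_le[OF hyp AB QX QB Q1 V] mult_nonneg_nonneg add_nonneg_nonneg) auto
      also have "\<dots> \<le> E1"
        unfolding E1_def using V lx
        by (intro mult_left_mono add_mono order.refl mult_right_mono mult_nonneg_nonneg add_nonneg_nonneg) auto
      finally have "norm (balanced_hat t) \<le> E1 + E2" using E2 by linarith
      then show ?thesis by (intro mult_mono norm_digit_hat_le) auto
    next
      case False
      have "norm (digit_hat t) \<le> real k * real (b - 1) ^ k * (digit_gap b ^ (J - 1) + 1 / real (b - 1) ^ J)"
        by (rule missing_digit_hat_minor_le[OF _ a0 r(2,1) k J R(3) q])
          (use b False near in \<open>simp_all add: X\<close>)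
      then have "norm (digit_hat t) * norm (balanced_hat t) \<le>
          (real k * real (b - 1) ^ k * (digit_gap b ^ (J - 1) + 1 / real (b - 1) ^ J)) *
          ((2 * Kf + real b * Kl) * (real X * ln (real X) * (1 + ln (real X)) ^ 4))"
        using gap by (intro mult_mono norm_balanced_hat_trivial_le mult_nonneg_nonneg add_nonneg_nonneg) auto
      also have "\<dots> = real (b - 1) ^ k * E2" by (simp add: E2_def)
      also have "\<dots> \<le> real (b - 1) ^ k * (E1 + E2)" using E1 by (intro mult_left_mono) auto
      finally show ?thesis .
    qed
  qed
  have "(\<Sum>t\<in>major R. norm (digit_hat t) * norm (balanced_hat t)) \<le> (\<Sum>t\<in>major R. real (b - 1) ^ k * (E1 + E2))"
    by (intro sum_mono single)
  also have "\<dots> = real (card (major R)) * (real (b - 1) ^ k * (E1 + E2))" by simp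
  also have "\<dots> \<le> real (16 * R ^ 3) * (real (b - 1) ^ k * (E1 + E2))"
    using E1 E2 by (intro mult_right_mono of_nat_mono card_major_le R) auto
  finally show ?thesis by simp
qed

section \<open>Combining the arcs with the wrapping error\<close>

lemma norm_discrepancy_arcs_le:
  assumes hyp: "exponential_sum_hyp b X D f \<sigma> c \<omega> C' Kc" and \<omega>: "0 < \<omega>" "\<omega> < 1"
    and C: "1 / ln (real b) \<le> C" and \<alpha>: "alpha b C < \<omega> / 2" and K: "K \<ge> 0"
    and L1: "\<And>n. (\<Sum>u<b ^ n. digit_prod b a0 n (real u / real (b ^ n))) \<le> K * (C * real b * ln (real b)) ^ n"
    and lhyp: "level_of_distribution_hyp b X D f lam Kb" and AB: "A > 0" "B > 0"
    and R: "b \<le> R" "R \<le> X" "2 * R\<^sup>2 \<le> b ^ J" "real R * real b \<le> ln (real X) powr B"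
    and J: "J \<ge> 1" "J\<^sup>2 \<le> k" and V: "V > 0"
  shows "norm discrepancy \<le>
    real s * Kf * ln (real X) * (1 + ln (real X)) ^ 2 * real X powr (1/2)
    + real (b - 1) ^ k * (1920 * \<bar>Kc\<bar> * K\<^sup>2 * real b ^ 9 * real k ^ 5 * ln (real X) powr C'
        * real R powr (- (\<omega> - 2 * alpha b C)))
    + real (b - 1) ^ k * (16 * real R ^ 3 * (real R * real b * (1 + 2 * pi * real R) *
      ((3 * Kf + Kl) * ln (real X) * (1 + ln (real X)) ^ 8 / V
       + V * \<bar>Kb A B\<bar> / ln (real X) powr A
       + (3 * Kf + 2 * real b * Kl) * ln (real X) * (1 + ln (real X)) ^ 4 * real X powr (- 1/4))))
    + real (b - 1) ^ k * (16 * real R ^ 3 * (real k * (digit_gap b ^ (J - 1) + 1 / real (b - 1) ^ J) *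
      ((2 * Kf + real b * Kl) * ln (real X) * (1 + ln (real X)) ^ 4)))"
proof -
  have X0: "0 < real X" using X_ge by simp
  have R1: "1 \<le> R" using R(1) b by simp
  have P: "real X powr (3/4) = real X * real X powr (- 1/4)"
    using X0 powr_add[of "real X" 1 "- 1/4"] by simp
  have "{..<X} = ({..<X} - major R) \<union> major R" by (auto simp: major_def)
  then have "(\<Sum>t<X. norm (digit_hat t) * norm (balanced_hat t)) =
      (\<Sum>t\<in>({..<X} - major R) \<union> major R. norm (digit_hat t) * norm (balanced_hat t))" by (rule arg_cong)
  also have "\<dots> = (\<Sum>t\<in>{..<X} - major R. norm (digit_hat t) * norm (balanced_hat t)) +
      (\<Sum>t\<in>major R. norm (digit_hat t) * norm (balanced_hat t))"
    by (rule sum.union_disjoint) (auto simp: major_def)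
  also have "\<dots> \<le> (1920 * \<bar>Kc\<bar> * K\<^sup>2 * real b ^ 9 * real k ^ 5 * real (b - 1) ^ k * real X * ln (real X) powr C'
      * real R powr (- (\<omega> - 2 * alpha b C))) +
    16 * real R ^ 3 * (real (b - 1) ^ k * (real R * real b * (1 + 2 * pi * real R) *
      ((3 * Kf + Kl) * (real X * ln (real X)) * (1 + ln (real X)) ^ 8 / V
       + V * (\<bar>Kb A B\<bar> * (real X / ln (real X) powr A))
       + (3 * Kf + 2 * real b * Kl) * (ln (real X) * real X powr (3/4)) * (1 + ln (real X)) ^ 4)
      + real k * (digit_gap b ^ (J - 1) + 1 / real (b - 1) ^ J) *
      ((2 * Kf + real b * Kl) * (real X * ln (real X) * (1 + ln (real X)) ^ 4))))"
    by (intro add_mono minor_arcs_le[OF hyp \<omega> C \<alpha> K L1 R(1)] major_arcs_le[OF lhyp AB R1 R(2-4) J V])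
  finally have S: "(\<Sum>t<X. norm (digit_hat t) * norm (balanced_hat t)) \<le> \<dots>" .
  define x Y where "x = real X" and "Y = real X powr (- 1/4)"
  from S have "(\<Sum>t<X. norm (digit_hat t) * norm (balanced_hat t)) / real X \<le>
    real (b - 1) ^ k * (1920 * \<bar>Kc\<bar> * K\<^sup>2 * real b ^ 9 * real k ^ 5 * ln (real X) powr C'
        * real R powr (- (\<omega> - 2 * alpha b C)))
    + real (b - 1) ^ k * (16 * real R ^ 3 * (real R * real b * (1 + 2 * pi * real R) *
      ((3 * Kf + Kl) * ln (real X) * (1 + ln (real X)) ^ 8 / V
       + V * \<bar>Kb A B\<bar> / ln (real X) powr A
       + (3 * Kf + 2 * real b * Kl) * ln (real X) * (1 + ln (real X)) ^ 4 * Y)))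
    + real (b - 1) ^ k * (16 * real R ^ 3 * (real k * (digit_gap b ^ (J - 1) + 1 / real (b - 1) ^ J) *
      ((2 * Kf + real b * Kl) * ln (real X) * (1 + ln (real X)) ^ 4)))"
    unfolding P pos_divide_le_eq[OF X0] Y_def[symmetric]
    by (rule order.trans) (rule order.eq_iff[THEN iffD1, THEN conjunct1], simp add: algebra_simps)
  then show ?thesis
    using norm_discrepancy_le unfolding Y_def by (simp add: mult_ac)
qed

end

section \<open>Choice of parameters\<close>

lemma power_times_geometric_bounded:
  fixes \<rho> :: real
  assumes "0 < \<rho>" "\<rho> < 1"
  obtains M where "\<And>k::nat. real k ^ n * \<rho> ^ k \<le> M"
proof -
  define \<gamma> where "\<gamma> = - ln \<rho>"
  have \<gamma>: "\<gamma> > 0" using assms by (simp add: \<gamma>_def)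
  have "filterlim (\<lambda>k. \<gamma> * real k) at_top sequentially"
    by (rule filterlim_tendsto_pos_mult_at_top[OF tendsto_const \<gamma> filterlim_real_sequentially])
  then have "(\<lambda>k. (\<gamma> * real k) ^ n / exp (\<gamma> * real k)) \<longlonglongrightarrow> 0"
    by (rule filterlim_compose[OF tendsto_power_div_exp_0])
  then have "Bseq (\<lambda>k. (\<gamma> * real k) ^ n / exp (\<gamma> * real k))"
    using convergentI convergent_imp_Bseq by blast
  then obtain M where M: "\<And>k. norm ((\<gamma> * real k) ^ n / exp (\<gamma> * real k)) \<le> M"
    by (auto simp: Bseq_def)
  have "real k ^ n * \<rho> ^ k \<le> M / \<gamma> ^ n" for k
  proof -
    have "\<rho> ^ k = exp (real k * ln \<rho>)" using assms by (simp add: exp_of_nat_mult)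
    also have "\<dots> = 1 / exp (\<gamma> * real k)" by (simp add: \<gamma>_def exp_minus inverse_eq_divide mult.commute)
    finally have "\<gamma> ^ n * (real k ^ n * \<rho> ^ k) = (\<gamma> * real k) ^ n / exp (\<gamma> * real k)"
      by (simp add: power_mult_distrib)
    also have "\<dots> \<le> M" by (rule order.trans[OF abs_ge_self M[of k, unfolded real_norm_def]])
    finally show ?thesis using \<gamma> by (simp add: pos_le_divide_eq mult.commute)
  qed
  then show ?thesis by (rule that)
qed

lemma nat_floor_sqrt_bounds:
  defines "J \<equiv> \<lambda>k. nat \<lfloor>sqrt (real k)\<rfloor>"
  shows "(J k)\<^sup>2 \<le> k" "real k \<le> (real (J k) + 1)\<^sup>2" "k \<ge> 1 \<Longrightarrow> J k \<ge> 1" "J k \<le> k"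
proof -
  have J: "real (J k) \<le> sqrt (real k)" "sqrt (real k) \<le> real (J k) + 1"
    unfolding J_def by (simp_all add: of_nat_nat)
  have "(real (J k))\<^sup>2 \<le> (sqrt (real k))\<^sup>2" by (intro power_mono J) simp
  then have "real ((J k)\<^sup>2) \<le> real k" by simp
  then show J2: "(J k)\<^sup>2 \<le> k" by (simp only: of_nat_le_iff)
  have "(sqrt (real k))\<^sup>2 \<le> (real (J k) + 1)\<^sup>2" by (intro power_mono J) simp
  then show "real k \<le> (real (J k) + 1)\<^sup>2" by simp
  show "J k \<ge> 1" if "k \<ge> 1"
  proof -
    have "1 \<le> sqrt (real k)" using that by simp
    then show ?thesis unfolding J_def by (simp add: le_nat_iff le_floor_iff)
  qed
  have "J k * 1 \<le> J k * J k" by (cases "J k") auto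
  then show "J k \<le> k" using J2 unfolding power2_eq_square by linarith
qed

text \<open>With J the integer part of sqrt k one has \<open>k \<le> (J + 1)^2\<close>, so a power
  k^n is at most a power of J + 1 of degree 2 n, and decay geometric in J still wins. The shift from
  \<open>J - 1\<close> to \<open>J + 1\<close> costs the constant factor \<rho>^2.\<close>

lemma power_times_geometric_sqrt_bounded:
  fixes \<rho> :: real
  assumes "0 < \<rho>" "\<rho> < 1"
  obtains M where "\<And>k::nat. k \<ge> 1 \<Longrightarrow> real k ^ n * \<rho> ^ (nat \<lfloor>sqrt (real k)\<rfloor> - 1) \<le> M"
proof -
  obtain M where M: "\<And>k::nat. real k ^ (2 * n) * \<rho> ^ k \<le> M"
    using power_times_geometric_bounded[OF assms] by blast
  have "real k ^ n * \<rho> ^ (nat \<lfloor>sqrt (real k)\<rfloor> - 1) \<le> M / \<rho> ^ 2" if k: "k \<ge> 1" for k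
  proof -
    define J where "J = nat \<lfloor>sqrt (real k)\<rfloor>"
    have J: "real k \<le> (real J + 1)\<^sup>2" "J \<ge> 1" using nat_floor_sqrt_bounds[of k] k by (auto simp: J_def)
    have "real k ^ n \<le> ((real J + 1)\<^sup>2) ^ n" by (intro power_mono J) simp
    then have "real k ^ n * \<rho> ^ (J - 1) \<le> real (J + 1) ^ (2 * n) * \<rho> ^ (J - 1)"
      using assms by (intro mult_right_mono) (auto simp: power_mult add.commute)
    also have "\<dots> = real (J + 1) ^ (2 * n) * \<rho> ^ (J + 1) / \<rho> ^ 2"
    proof -
      have "\<rho> ^ (J + 1) = \<rho> ^ (J - 1) * \<rho> ^ 2" using J by (simp flip: power_add)
      then show ?thesis using assms by simp
    qed
    also have "\<dots> \<le> M / \<rho> ^ 2" using M[of "J + 1"] by (intro divide_right_mono) auto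
    finally show ?thesis by (simp add: J_def)
  qed
  then show ?thesis by (rule that)
qed

section \<open>The bound for large k\<close>

context missing_digit_setting
begin

lemma ln_X_bounds: "real k \<le> ln (real X)" "ln (real X) \<le> real b * real k"
proof -
  have "exp 1 \<le> real b" using b exp_le by linarith
  then have "1 \<le> ln (real b)" using b by (subst ln_ge_iff) auto
  then show "real k \<le> ln (real X)" using mult_left_mono[of 1 "ln (real b)" "real k"] by (simp add: ln_X)
  have "ln (real b) \<le> real b" using ln_le_minus_one[of "real b"] b by linarith
  then have "real k * ln (real b) \<le> real k * real b" by (intro mult_left_mono) auto
  then show "ln (real X) \<le> real b * real k" by (simp add: ln_X mult.commute)
qed

text \<open>Everything is measured in powers of k, with target \<open>(b - 1) ^ k / k ^ n1\<close>.
  The cut-off is \<open>R = k ^ E\<close>, with E so large that the saving on the minor arcs beats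
  \<open>k ^ (n1 + n2 + 5)\<close>. The parameter V is \<open>k ^ v\<close>: the terms of
  \<open>v = n1 + 5 * E + 9\<close> are the target, the factor R^5 and the nine logarithms. Since V
  multiplies the distribution error, the hypothesis is used with the exponent 2 v, and with moduli
  up to \<open>(ln X) ^ (E + 1)\<close>, which covers \<open>R * b\<close>.\<close>

lemma norm_discrepancy_asymptotic:
  fixes n1 n2 E :: nat
  defines "v \<equiv> n1 + 5 * E + 9"
  assumes hyp: "exponential_sum_hyp b X D f \<sigma> c \<omega> C' Kc" and \<omega>: "0 < \<omega>" "\<omega> < 1"
    and C: "1 / ln (real b) \<le> C" and \<alpha>: "alpha b C < \<omega> / 2" and K: "K \<ge> 0"
    and L1: "\<And>n. (\<Sum>u<b ^ n. digit_prod b a0 n (real u / real (b ^ n))) \<le> K * (C * real b * ln (real b)) ^ n"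
    and lhyp: "level_of_distribution_hyp b X D f lam Kb"
    and n2: "C' \<le> real n2" and E: "E \<ge> 1" "real (n1 + n2 + 5) \<le> real E * (\<omega> - 2 * alpha b C)"
    and kb: "b \<le> k" and J: "J \<ge> 1" "J\<^sup>2 \<le> k" "2 * k ^ (2 * E) \<le> b ^ J"
    and M0: "real k ^ (n1 + 3) * (sqrt (real b) / real (b - 1)) ^ k \<le> M0"
    and M1: "real k ^ (n1 + (5 * E + 5)) * (real b powr (- 1/4)) ^ k \<le> M1"
    and M2: "real k ^ (n1 + (3 * E + 6)) * digit_gap b ^ (J - 1) \<le> M2"
    and M3: "real k ^ (n1 + (3 * E + 6)) * (1 / real (b - 1)) ^ (J - 1) \<le> M3"
  shows "norm discrepancy \<le> (4 * real s * Kf * real b ^ 3 * M0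
      + 1920 * \<bar>Kc\<bar> * K\<^sup>2 * real b ^ 9 * real b ^ n2
      + 144 * real b * ((3 * Kf + Kl) * (256 * real b ^ 9) + \<bar>Kb (real (2 * v)) (real (E + 1))\<bar>
          + (3 * Kf + 2 * real b * Kl) * (16 * real b ^ 5 * M1))
      + 256 * (2 * Kf + real b * Kl) * real b ^ 5 * (M2 + M3))
    * (real (b - 1) ^ k / real k ^ n1)"
proof -
  define x where "x = real k"
  define y where "y = ln (real X)"
  define \<eta> where "\<eta> = \<omega> - 2 * alpha b C"
  define B where "B = real b"
  have x1: "1 \<le> x" using k by (simp add: x_def)
  have B1: "1 \<le> B" using b by (simp add: B_def)
  have y: "x \<le> y" "y \<le> B * x" "1 \<le> y" using ln_X_bounds ln_X_ge_1 by (auto simp: x_def y_def B_def)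
  have "1 * 1 \<le> B * x" using B1 x1 by (intro mult_mono) auto
  then have y': "1 + y \<le> 2 * (B * x)" using y by linarith
  have Kf: "0 \<le> Kf" "0 \<le> 3 * Kf + Kl" "0 \<le> 3 * Kf + 2 * B * Kl" "0 \<le> 2 * Kf + B * Kl"
    using Kf_nonneg Kl_nonneg B1 by auto
  have pull: "x ^ m * u \<le> M / x ^ n1" if "x ^ (n1 + m) * u \<le> M" for m u M
    using that x1 by (simp add: power_add pos_le_divide_eq mult_ac)
  have yy: "y * (1 + y) ^ m \<le> (B * x) * (2 * (B * x)) ^ m" for m
    using y y' x1 B1 by (intro mult_mono power_mono) auto
  define R where "R = k ^ E"
  have Rx: "real R = x ^ E" by (simp add: R_def x_def)
  have kR: "k \<le> R" unfolding R_def using E k power_increasing[of 1 E k] by simp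
  have bR: "b \<le> R" using kb kR by simp
  have R2: "2 * R\<^sup>2 \<le> b ^ J" using J(3) by (simp add: R_def mult.commute flip: power_mult)
  have RX: "R \<le> X"
  proof -
    have "J * 1 \<le> J * J" using J(1) by (intro mult_left_mono) auto
    then have "J \<le> k" using J(2) unfolding power2_eq_square by linarith
    then have "b ^ J \<le> b ^ k" using b by (intro power_increasing) auto
    moreover have "R * 1 \<le> R * R" using kR k by (intro mult_left_mono) auto
    then have "R \<le> 2 * R\<^sup>2" by (simp add: power2_eq_square)
    ultimately show ?thesis using R2 by (simp add: X)
  qed
  have RB: "real R * real b \<le> ln (real X) powr (real (E + 1))"
  proof -
    have "real R * real b \<le> x ^ E * x" using kb x1 by (intro mult_mono) (auto simp: Rx x_def)
    also have "\<dots> = x ^ (E + 1)" by simp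
    also have "\<dots> \<le> y ^ (E + 1)" using y x1 by (intro power_mono) auto
    also have "\<dots> = y powr (real (E + 1))" using y by (intro powr_realpow[symmetric]) auto
    finally show ?thesis by (simp only: y_def)
  qed
  define Kb' where "Kb' = \<bar>Kb (real (2 * v)) (real (E + 1))\<bar>"
  define P0 where "P0 = 4 * real s * Kf * B ^ 3 * M0"
  define P1 where "P1 = 1920 * \<bar>Kc\<bar> * K\<^sup>2 * B ^ 9 * B ^ n2"
  define P2 where "P2 = 144 * B * ((3 * Kf + Kl) * (256 * B ^ 9) + Kb' + (3 * Kf + 2 * B * Kl) * (16 * B ^ 5 * M1))"
  define P3 where "P3 = 256 * (2 * Kf + B * Kl) * B ^ 5 * (M2 + M3)"
  define W where "W = real (b - 1) ^ k"
  have W0: "0 < W" using b by (simp add: W_def)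
  have main: "norm discrepancy \<le>
    real s * Kf * y * (1 + y) ^ 2 * real X powr (1/2)
    + W * (1920 * \<bar>Kc\<bar> * K\<^sup>2 * B ^ 9 * x ^ 5 * y powr C' * real R powr (- \<eta>))
    + W * (16 * real R ^ 3 * (real R * B * (1 + 2 * pi * real R) *
      ((3 * Kf + Kl) * y * (1 + y) ^ 8 / x ^ v + x ^ v * Kb' / y powr (real (2 * v))
       + (3 * Kf + 2 * B * Kl) * y * (1 + y) ^ 4 * real X powr (- 1/4))))
    + W * (16 * real R ^ 3 * (x * (digit_gap b ^ (J - 1) + 1 / real (b - 1) ^ J) *
      ((2 * Kf + B * Kl) * y * (1 + y) ^ 4)))"
    unfolding y_def x_def B_def W_def \<eta>_def Kb'_def
    by (rule norm_discrepancy_arcs_le[OF hyp \<omega> C \<alpha> K L1 lhyp _ _ bR RX R2 RB J(1,2)])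
      (use k in \<open>auto simp: v_def\<close>)
  have T0: "real s * Kf * y * (1 + y) ^ 2 * real X powr (1/2) \<le> P0 * (W / x ^ n1)"
  proof -
    define \<rho> where "\<rho> = sqrt (real b) / real (b - 1)"
    have "real X powr (1/2) = sqrt (real b) ^ k"
      by (simp add: X powr_half_sqrt real_sqrt_power)
    also have "sqrt (real b) = \<rho> * real (b - 1)" using b by (simp add: \<rho>_def)
    finally have X2: "real X powr (1/2) = \<rho> ^ k * W" by (simp add: power_mult_distrib W_def)
    have \<rho>0: "0 \<le> \<rho> ^ k" by (simp add: \<rho>_def)
    have "real s * Kf * (y * (1 + y) ^ 2) * (\<rho> ^ k * W) \<le>
        real s * Kf * ((B * x) * (2 * (B * x)) ^ 2) * (\<rho> ^ k * W)"
      using Kf \<rho>0 W0 by (intro mult_right_mono mult_left_mono yy) auto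
    also have "\<dots> = 4 * real s * Kf * B ^ 3 * W * (x ^ 3 * \<rho> ^ k)"
      by (simp add: power2_eq_square power3_eq_cube)
    also have "\<dots> \<le> 4 * real s * Kf * B ^ 3 * W * (M0 / x ^ n1)"
      using Kf B1 W0 M0 by (intro mult_left_mono pull) (auto simp: \<rho>_def x_def)
    finally show ?thesis unfolding X2 P0_def by (simp add: mult_ac)
  qed
  have T1: "1920 * \<bar>Kc\<bar> * K\<^sup>2 * B ^ 9 * x ^ 5 * y powr C' * real R powr (- \<eta>) \<le> P1 / x ^ n1"
  proof -
    have "y powr C' \<le> y powr (real n2)" using y n2 by (intro powr_mono) auto
    also have "\<dots> = y ^ n2" using y by (intro powr_realpow) auto
    also have "\<dots> \<le> (B * x) ^ n2" using y by (intro power_mono) auto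
    finally have 1: "y powr C' \<le> (B * x) ^ n2" .
    have "real R powr (- \<eta>) = (x powr real E) powr (- \<eta>)" using x1 by (simp add: Rx powr_realpow)
    also have "\<dots> = x powr (- (real E * \<eta>))" by (simp add: powr_powr)
    also have "\<dots> \<le> x powr (- real (n1 + n2 + 5))" using E(2) x1 by (intro powr_mono) (auto simp: \<eta>_def)
    also have "\<dots> = 1 / x ^ (n1 + n2 + 5)" using x1 by (simp only: powr_minus_divide) (simp add: powr_realpow flip: of_nat_add)
    finally have 2: "real R powr (- \<eta>) \<le> 1 / x ^ (n1 + n2 + 5)" .
    have "1920 * \<bar>Kc\<bar> * K\<^sup>2 * B ^ 9 * x ^ 5 * y powr C' * real R powr (- \<eta>) \<le>
        1920 * \<bar>Kc\<bar> * K\<^sup>2 * B ^ 9 * x ^ 5 * (B * x) ^ n2 * (1 / x ^ (n1 + n2 + 5))"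
      using B1 x1 by (intro mult_mono order.refl 1 2 mult_nonneg_nonneg) auto
    also have "\<dots> = P1 / x ^ n1" using x1 by (simp add: P1_def power_add power_mult_distrib)
    finally show ?thesis .
  qed
  have xx: "x ^ (5 * E) * (1 / x ^ v) = 1 / x ^ (n1 + 9)"
    using x1 by (simp add: v_def power_add)
  have T2: "16 * real R ^ 3 * (real R * B * (1 + 2 * pi * real R) *
      ((3 * Kf + Kl) * y * (1 + y) ^ 8 / x ^ v + x ^ v * Kb' / y powr (real (2 * v))
       + (3 * Kf + 2 * B * Kl) * y * (1 + y) ^ 4 * real X powr (- 1/4))) \<le> P2 / x ^ n1"
  proof -
    have R1: "1 \<le> real R" using kR k by simp
    have "1 + 2 * pi * real R \<le> real R + 8 * real R"
      using R1 pi_less_4 by (intro add_mono mult_right_mono) auto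
    then have Rpi: "1 + 2 * pi * real R \<le> 9 * real R" by simp
    have S1: "x ^ (5 * E) * ((3 * Kf + Kl) * y * (1 + y) ^ 8 / x ^ v) \<le> (3 * Kf + Kl) * (256 * B ^ 9) / x ^ n1"
    proof -
      have "x ^ (5 * E) * ((3 * Kf + Kl) * y * (1 + y) ^ 8 / x ^ v) =
          (3 * Kf + Kl) * (y * (1 + y) ^ 8) * (x ^ (5 * E) * (1 / x ^ v))" by simp
      also have "\<dots> \<le> (3 * Kf + Kl) * ((B * x) * (2 * (B * x)) ^ 8) * (x ^ (5 * E) * (1 / x ^ v))"
        using Kf x1 by (intro mult_right_mono mult_left_mono yy) auto
      also have "\<dots> = (3 * Kf + Kl) * (256 * B ^ 9) * (x ^ 9 * (1 / x ^ (n1 + 9)))"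
        unfolding xx by (simp add: power_mult_distrib eval_nat_numeral mult_ac)
      also have "x ^ 9 * (1 / x ^ (n1 + 9)) = 1 / x ^ n1" using x1 by (simp add: power_add)
      finally show ?thesis by simp
    qed
    have S2: "x ^ (5 * E) * (x ^ v * Kb' / y powr (real (2 * v))) \<le> Kb' / x ^ n1"
    proof -
      have "y powr (real (2 * v)) = y ^ (2 * v)" using y by (intro powr_realpow) auto
      moreover have "x ^ (2 * v) \<le> y ^ (2 * v)" using y x1 by (intro power_mono) auto
      moreover have "0 < x ^ (2 * v)" using x1 by simp
      ultimately have "x ^ v * Kb' / y powr (real (2 * v)) \<le> x ^ v * Kb' / x ^ (2 * v)"
        using x1 y by (intro divide_left_mono mult_pos_pos) (auto simp: Kb'_def)
      also have "\<dots> = Kb' * (1 / x ^ v)" using x1 by (simp add: mult_2 power_add)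
      finally have "x ^ (5 * E) * (x ^ v * Kb' / y powr (real (2 * v))) \<le> x ^ (5 * E) * (Kb' * (1 / x ^ v))"
        using x1 by (intro mult_left_mono) auto
      also have "\<dots> = Kb' * (x ^ (5 * E) * (1 / x ^ v))" by simp
      also have "\<dots> \<le> Kb' * (1 / x ^ n1)"
        unfolding xx using x1 by (intro mult_left_mono divide_left_mono power_increasing) (auto simp: Kb'_def)
      finally show ?thesis by simp
    qed
    have S3: "x ^ (5 * E) * ((3 * Kf + 2 * B * Kl) * y * (1 + y) ^ 4 * real X powr (- 1/4)) \<le>
        (3 * Kf + 2 * B * Kl) * (16 * B ^ 5 * M1) / x ^ n1"
    proof -
      define \<rho> where "\<rho> = real b powr (- 1/4)"
      have X4: "real X powr (- 1/4) = \<rho> ^ k"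
        using b by (simp add: X \<rho>_def powr_powr mult.commute flip: powr_realpow)
      have \<rho>0: "0 \<le> \<rho> ^ k" by (simp add: \<rho>_def)
      have "x ^ (5 * E) * ((3 * Kf + 2 * B * Kl) * y * (1 + y) ^ 4 * \<rho> ^ k) =
          (3 * Kf + 2 * B * Kl) * (y * (1 + y) ^ 4) * (x ^ (5 * E) * \<rho> ^ k)" by simp
      also have "\<dots> \<le> (3 * Kf + 2 * B * Kl) * ((B * x) * (2 * (B * x)) ^ 4) * (x ^ (5 * E) * \<rho> ^ k)"
        using Kf x1 \<rho>0 by (intro mult_right_mono mult_left_mono yy) auto
      also have "\<dots> = (3 * Kf + 2 * B * Kl) * (16 * B ^ 5) * (x ^ (5 * E + 5) * \<rho> ^ k)"
        by (simp add: power_mult_distrib power_add eval_nat_numeral mult_ac)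
      also have "\<dots> \<le> (3 * Kf + 2 * B * Kl) * (16 * B ^ 5) * (M1 / x ^ n1)"
        using Kf B1 M1 by (intro mult_left_mono pull) (auto simp: \<rho>_def x_def)
      finally show ?thesis unfolding X4 by simp
    qed
    define Q where "Q = (3 * Kf + Kl) * y * (1 + y) ^ 8 / x ^ v + x ^ v * Kb' / y powr (real (2 * v))
       + (3 * Kf + 2 * B * Kl) * y * (1 + y) ^ 4 * real X powr (- 1/4)"
    have Q0: "0 \<le> Q"
      unfolding Q_def using Kf Kl_nonneg B1 y x1 by (intro add_nonneg_nonneg mult_nonneg_nonneg divide_nonneg_nonneg) (auto simp: Kb'_def)
    have "16 * real R ^ 3 * (real R * B * (1 + 2 * pi * real R) * Q) \<le>
        16 * real R ^ 3 * (real R * B * (9 * real R) * Q)"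
      using Rpi Q0 B1 by (intro mult_left_mono mult_right_mono) auto
    also have "\<dots> = 144 * B * (real R ^ 5 * Q)" by (simp add: eval_nat_numeral mult_ac)
    also have "real R ^ 5 = x ^ (5 * E)" by (simp add: Rx mult.commute flip: power_mult)
    also have "144 * B * (x ^ (5 * E) * Q) \<le> 144 * B * ((3 * Kf + Kl) * (256 * B ^ 9) / x ^ n1 + Kb' / x ^ n1 +
        (3 * Kf + 2 * B * Kl) * (16 * B ^ 5 * M1) / x ^ n1)"
      unfolding Q_def distrib_left[of "x ^ (5 * E)"] using B1
      by (intro mult_left_mono add_mono S1 S2 S3) auto
    also have "\<dots> = P2 / x ^ n1" by (simp only: P2_def add_divide_distrib[symmetric] times_divide_eq_right)
    finally show ?thesis unfolding Q_def .
  qed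
  have T3: "16 * real R ^ 3 * (x * (digit_gap b ^ (J - 1) + 1 / real (b - 1) ^ J) *
      ((2 * Kf + B * Kl) * y * (1 + y) ^ 4)) \<le> P3 / x ^ n1"
  proof -
    define G where "G = digit_gap b ^ (J - 1) + (1 / real (b - 1)) ^ (J - 1)"
    have gap: "0 \<le> digit_gap b" using digit_gap_bounds[of b] b by simp
    have "(1 / real (b - 1)) ^ J \<le> (1 / real (b - 1)) ^ (J - 1)"
      using b by (intro power_decreasing) auto
    then have Gle: "digit_gap b ^ (J - 1) + 1 / real (b - 1) ^ J \<le> G"
      by (simp add: G_def power_one_over)
    have G0: "0 \<le> G" using gap by (simp add: G_def)
    have "16 * real R ^ 3 * (x * (digit_gap b ^ (J - 1) + 1 / real (b - 1) ^ J) *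
        ((2 * Kf + B * Kl) * y * (1 + y) ^ 4)) \<le> 16 * real R ^ 3 * (x * G * ((2 * Kf + B * Kl) * y * (1 + y) ^ 4))"
      using Gle x1 Kf y by (intro mult_left_mono mult_right_mono) auto
    also have "\<dots> = 16 * real R ^ 3 * (x * G * (2 * Kf + B * Kl)) * (y * (1 + y) ^ 4)" by simp
    also have "\<dots> \<le> 16 * real R ^ 3 * (x * G * (2 * Kf + B * Kl)) * ((B * x) * (2 * (B * x)) ^ 4)"
      using x1 G0 Kf by (intro mult_left_mono yy) auto
    also have "\<dots> = 256 * (2 * Kf + B * Kl) * B ^ 5 * (x ^ (3 * E + 6) * G)"
    proof -
      have "real R ^ 3 = x ^ (3 * E)" by (simp add: Rx mult.commute flip: power_mult)
      then show ?thesis by (simp add: power_mult_distrib power_add eval_nat_numeral mult_ac)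
    qed
    also have "x ^ (3 * E + 6) * G \<le> M2 / x ^ n1 + M3 / x ^ n1"
      unfolding G_def distrib_left using M2 M3 by (intro add_mono pull) (auto simp: x_def)
    then have "256 * (2 * Kf + B * Kl) * B ^ 5 * (x ^ (3 * E + 6) * G) \<le>
        256 * (2 * Kf + B * Kl) * B ^ 5 * (M2 / x ^ n1 + M3 / x ^ n1)"
      using Kf B1 by (intro mult_left_mono) auto
    also have "\<dots> = P3 / x ^ n1" by (simp only: P3_def add_divide_distrib[symmetric] times_divide_eq_right)
    finally show ?thesis .
  qed
  have "norm discrepancy \<le> P0 * (W / x ^ n1) + W * (P1 / x ^ n1) + W * (P2 / x ^ n1) + W * (P3 / x ^ n1)"
    using W0 by (intro order.trans[OF main] add_mono mult_left_mono T0 T1 T2 T3) auto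
  also have "\<dots> = (P0 + P1 + P2 + P3) * (W / x ^ n1)" by (simp add: algebra_simps add_divide_distrib)
  finally show ?thesis
    by (simp only: P0_def P1_def P2_def P3_def W_def x_def B_def Kb'_def)
qed

text \<open>The target size is the number of strings of k digits that avoid the forbidden
  digit.\<close>

lemma powr_zeta_exp: "real X powr zeta_exp b = real (b - 1) ^ k"
proof -
  have "real X powr zeta_exp b = exp (real k * ln (real b - 1))"
    using b X_ge by (simp add: powr_def zeta_exp_def ln_X)
  also have "\<dots> = (real b - 1) ^ k" using b by (simp add: exp_of_nat_mult)
  finally show ?thesis using b by (simp add: of_nat_diff)
qed

end

text \<open>Every parameter is fixed before k, X, D and the functions appear. Below a threshold that
  depends only on these parameters, the trivial estimate has just finitely many values and is
  absorbed into the constant.\<close>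

lemma discrepancy_uniform_bound:
  fixes A C' Cb \<omega> Kc Kf Kl :: real and Kb :: "real \<Rightarrow> real \<Rightarrow> real"
  assumes b: "10 \<le> b" and L1: "L1_constant b Cb" and \<omega>: "0 < \<omega>" "\<omega> < 1"
    and \<alpha>: "alpha b Cb < \<omega> / 2"
  obtains K where "\<And>k X D a0 r f \<sigma> lam c.
    missing_digit_setting b k a0 r s X D Kf Kl f \<sigma> lam c \<Longrightarrow>
    level_of_distribution_hyp b X D f lam Kb \<Longrightarrow> exponential_sum_hyp b X D f \<sigma> c \<omega> C' Kc \<Longrightarrow>
    norm (missing_digit_setting.discrepancy b a0 r s X D f \<sigma> lam c)
      \<le> K * (real X powr zeta_exp b / ln (real X) powr A)"
proof -
  obtain K where K: "K \<ge> 0" "\<And>a0 n. a0 < b \<Longrightarrow>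
      (\<Sum>u<b ^ n. digit_prod b a0 n (real u / real (b ^ n))) \<le> K * (Cb * real b * ln (real b)) ^ n"
    using digit_prod_L1_bound[OF L1] b by auto
  have C: "1 / ln (real b) \<le> Cb" using L1 by (simp add: L1_constant_def)
  define n1 n2 where "n1 = nat \<lceil>A\<rceil>" and "n2 = nat \<lceil>C'\<rceil>"
  have n1: "A \<le> real n1" and n2: "C' \<le> real n2"
    unfolding n1_def n2_def by (rule real_nat_ceiling_ge)+
  define \<eta> where "\<eta> = \<omega> - 2 * alpha b Cb"
  have \<eta>: "\<eta> > 0" using \<alpha> by (simp add: \<eta>_def)
  define E where "E = nat \<lceil>real (n1 + n2 + 5) / \<eta>\<rceil> + 1"
  have "real (n1 + n2 + 5) / \<eta> \<le> real (nat \<lceil>real (n1 + n2 + 5) / \<eta>\<rceil>)" by (rule real_nat_ceiling_ge)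
  then have "real (n1 + n2 + 5) / \<eta> \<le> real E" by (simp add: E_def)
  then have E: "real (n1 + n2 + 5) \<le> real E * (\<omega> - 2 * alpha b Cb)" "E \<ge> 1"
    using \<eta> by (simp_all add: pos_divide_le_eq \<eta>_def E_def)
  define J where "J = (\<lambda>k. nat \<lfloor>sqrt (real k)\<rfloor>)"
  have "sqrt (real b) / real (b - 1) < 1"
  proof -
    have "real b < (real (b - 1))\<^sup>2"
    proof -
      have "2 * (b - 1) \<le> (b - 1) * (b - 1)" using b by (intro mult_right_mono) auto
      then have "b < (b - 1) * (b - 1)" using b by linarith
      then have "real b < real ((b - 1) * (b - 1))" by (simp only: of_nat_less_iff)
      then show ?thesis by (simp only: power2_eq_square of_nat_mult)
    qed
    then have "sqrt (real b) < real (b - 1)" by (intro real_less_lsqrt) auto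
    then show ?thesis using b by simp
  qed
  then obtain M0 where M0: "\<And>k. real k ^ (n1 + 3) * (sqrt (real b) / real (b - 1)) ^ k \<le> M0"
    using power_times_geometric_bounded[of "sqrt (real b) / real (b - 1)" "n1 + 3"] b by auto
  have "real b powr (- 1/4) < 1"
    using b powr_less_mono[of "- 1/4" 0 "real b"] by simp
  then obtain M1 where M1: "\<And>k. real k ^ (n1 + (5 * E + 5)) * (real b powr (- 1/4)) ^ k \<le> M1"
    using power_times_geometric_bounded[of "real b powr (- 1/4)" "n1 + (5 * E + 5)"] b by auto
  obtain M2 where M2: "\<And>k. k \<ge> 1 \<Longrightarrow> real k ^ (n1 + (3 * E + 6)) * digit_gap b ^ (J k - 1) \<le> M2"
    using power_times_geometric_sqrt_bounded[of "digit_gap b" "n1 + (3 * E + 6)"] digit_gap_bounds[of b] b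
    unfolding J_def by auto
  obtain M3 where M3: "\<And>k. k \<ge> 1 \<Longrightarrow> real k ^ (n1 + (3 * E + 6)) * (1 / real (b - 1)) ^ (J k - 1) \<le> M3"
    using power_times_geometric_sqrt_bounded[of "1 / real (b - 1)" "n1 + (3 * E + 6)"] b
    unfolding J_def by auto
  \<comment> \<open>One power of k more than occurs in \<open>2 R^2 = 2 k ^ (2 E)\<close>: once k is
    at least \<open>2 * M4\<close>, the surplus absorbs the constant and
    \<open>2 R^2 \<le> b ^ J\<close> follows.\<close>
  obtain M4 where M4: "\<And>k. k \<ge> 1 \<Longrightarrow> real k ^ (2 * E + 1) * (1 / real b) ^ (J k - 1) \<le> M4"
    using power_times_geometric_sqrt_bounded[of "1 / real b" "2 * E + 1"] b
    unfolding J_def by auto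
  \<comment> \<open>The part \<open>b \<le> k\<close> of the threshold ensures that R is at least b
    and that \<open>R * b\<close> is at most \<open>k ^ (E + 1)\<close>.\<close>
  define k0 where "k0 = max b (nat \<lceil>2 * M4\<rceil>)"
  have J_large: "2 * k ^ (2 * E) \<le> b ^ J k" if k: "k \<ge> k0" for k
  proof -
    have k1: "k \<ge> 1" using k b by (simp add: k0_def)
    have "2 * M4 \<le> real (nat \<lceil>2 * M4\<rceil>)" by (rule real_nat_ceiling_ge)
    also have "\<dots> \<le> real k" using k by (simp add: k0_def)
    finally have "2 * M4 \<le> real k" .
    with M4[OF k1] have "2 * (real k ^ (2 * E + 1) * (1 / real b) ^ (J k - 1)) \<le> real k" by linarith
    then have "real k * (2 * real k ^ (2 * E) / real b ^ (J k - 1)) \<le> real k * 1"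
      by (simp add: power_one_over mult_ac)
    then have "2 * real k ^ (2 * E) / real b ^ (J k - 1) \<le> 1"
      by (rule mult_left_le_imp_le) (use k1 in simp)
    then have "2 * real k ^ (2 * E) \<le> real b ^ (J k - 1)" using b by (simp add: pos_divide_le_eq)
    also have "\<dots> \<le> real b ^ J k" using b by (intro power_increasing) auto
    finally have "real (2 * k ^ (2 * E)) \<le> real (b ^ J k)" by simp
    then show ?thesis by (simp only: of_nat_le_iff)
  qed
  define v where "v = n1 + 5 * E + 9"
  define K1 where "K1 = 4 * real s * Kf * real b ^ 3 * M0
      + 1920 * \<bar>Kc\<bar> * K\<^sup>2 * real b ^ 9 * real b ^ n2
      + 144 * real b * ((3 * Kf + Kl) * (256 * real b ^ 9) + \<bar>Kb (real (2 * v)) (real (E + 1))\<bar>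
          + (3 * Kf + 2 * real b * Kl) * (16 * real b ^ 5 * M1))
      + 256 * (2 * Kf + real b * Kl) * real b ^ 5 * (M2 + M3)"
  define T where "T = (\<lambda>k. real s * Kf * ln (real (b ^ k)) * (real (b ^ k) powr (1/2) * (1 + ln (real (b ^ k))) ^ 2)
    + real (b - 1) ^ k * ((2 * Kf + real b * Kl) * (real (b ^ k) * ln (real (b ^ k)) * (1 + ln (real (b ^ k))) ^ 4)))"
  define U where "U = (\<lambda>k. real (b - 1) ^ k / ln (real (b ^ k)) powr A)"
  \<comment> \<open>Each k below the threshold contributes its trivial bound relative to the target;
    a sum of nonnegative terms serves in place of a maximum.\<close>
  define K2 where "K2 = (\<Sum>k\<in>{1..<k0}. \<bar>T k\<bar> / U k)"
  have U: "U k > 0" if "k \<ge> 1" for k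
  proof -
    have "1 < real b ^ k" using b that by (intro one_less_power) auto
    then show ?thesis using b by (simp add: U_def)
  qed
  have K2: "0 \<le> K2" unfolding K2_def using U by (intro sum_nonneg divide_nonneg_pos) auto
  show thesis
  proof (rule that[of "\<bar>K1\<bar> * real b ^ n1 + K2"])
    fix k X :: nat and D :: real and a0 r :: nat and f \<sigma> lam :: "nat \<Rightarrow> complex" and c :: "nat \<Rightarrow> nat"
    assume "missing_digit_setting b k a0 r s X D Kf Kl f \<sigma> lam c"
      and lev: "level_of_distribution_hyp b X D f lam Kb"
      and es: "exponential_sum_hyp b X D f \<sigma> c \<omega> C' Kc"
    then interpret missing_digit_setting b k a0 r s X D Kf Kl f \<sigma> lam c by simp
    have UX: "U k = real X powr zeta_exp b / ln (real X) powr A"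
      unfolding powr_zeta_exp by (simp add: U_def X)
    have U0: "0 < U k" by (rule U[OF k])
    have "norm discrepancy \<le> (\<bar>K1\<bar> * real b ^ n1 + K2) * U k"
    proof (cases "k \<ge> k0")
      case True
      have "norm discrepancy \<le> K1 * (real (b - 1) ^ k / real k ^ n1)"
        unfolding K1_def v_def
        by (rule norm_discrepancy_asymptotic[OF es \<omega> C \<alpha> K(1) K(2)[OF a0] lev n2 E(2,1) _ _ _ J_large[OF True]
              M0 M1 M2[OF k] M3[OF k]])
          (use True k nat_floor_sqrt_bounds[of k] in \<open>auto simp: k0_def J_def\<close>)
      also have "\<dots> \<le> \<bar>K1\<bar> * (real (b - 1) ^ k / real k ^ n1)"
        by (intro mult_right_mono) auto
      also have "real (b - 1) ^ k / real k ^ n1 \<le> real b ^ n1 * U k"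
      proof -
        have lx: "1 \<le> ln (real X)" by (rule ln_X_ge_1)
        have "ln (real X) powr A \<le> ln (real X) powr (real n1)"
          using lx n1 by (intro powr_mono) auto
        also have "\<dots> = ln (real X) ^ n1" using lx by (intro powr_realpow) auto
        also have "\<dots> \<le> (real b * real k) ^ n1" using lx by (intro power_mono ln_X_bounds) auto
        finally have le: "ln (real X) powr A \<le> real b ^ n1 * real k ^ n1" by (simp add: power_mult_distrib)
        have pos: "0 < ln (real X) powr A" using lx by simp
        have "real (b - 1) ^ k * ln (real X) powr A \<le> real (b - 1) ^ k * (real b ^ n1 * real k ^ n1)"
          using le by (intro mult_left_mono) auto
        then have "real (b - 1) ^ k / real k ^ n1 \<le> real b ^ n1 * (real (b - 1) ^ k / ln (real X) powr A)"
          using pos k by (simp add: field_simps)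
        then show ?thesis by (simp add: U_def X)
      qed
      then have "\<bar>K1\<bar> * (real (b - 1) ^ k / real k ^ n1) \<le> \<bar>K1\<bar> * (real b ^ n1 * U k)"
        by (intro mult_left_mono) auto
      also have "\<dots> \<le> (\<bar>K1\<bar> * real b ^ n1 + K2) * U k"
        using K2 U0 by (simp add: distrib_right)
      finally show ?thesis .
    next
      case False
      have "norm discrepancy \<le> T k"
        using norm_discrepancy_trivial_le by (simp only: T_def X)
      also have "\<dots> \<le> (\<bar>T k\<bar> / U k) * U k" using U0 by simp
      also have "\<dots> \<le> K2 * U k"
        unfolding K2_def
        by (intro mult_right_mono member_le_sum divide_nonneg_pos U) (use False k U0 in auto)
      also have "\<dots> \<le> (\<bar>K1\<bar> * real b ^ n1 + K2) * U k"
        using U0 by (intro mult_right_mono) auto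
      finally show ?thesis .
    qed
    then show "norm discrepancy \<le> (\<bar>K1\<bar> * real b ^ n1 + K2) * (real X powr zeta_exp b / ln (real X) powr A)"
      unfolding UX .
  qed
qed

theorem theorem8p1:
  fixes \<delta> :: real
  assumes "\<delta> > 0"
  shows "\<exists>b\<^sub>0::nat. \<forall>b\<ge>b\<^sub>0.
    \<forall>(C\<^sub>b::real) (\<omega>::real) (C'::real) (K\<^sub>f::real) (K\<^sub>l::real)
     (K\<^sub>a::real \<Rightarrow> real) (K\<^sub>b::real \<Rightarrow> real \<Rightarrow> real) (K\<^sub>c::real) (s::nat) (A::real).
      L1_constant b C\<^sub>b \<and> 0 < \<omega> \<and> \<omega> < 1 \<and> alpha b C\<^sub>b < \<omega> / 2 \<and> C' > 0 \<and> s \<ge> 1 \<and> A > 0 \<longrightarrow>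
      (\<exists>K::real.
        \<forall>(k::nat) (X::nat) (D::real) (a\<^sub>0::nat) (r::nat) (f::nat \<Rightarrow> complex)
         (\<sigma>::nat \<Rightarrow> complex) (c::nat \<Rightarrow> nat) (lam::nat \<Rightarrow> complex).
          k \<ge> 1 \<and> X = b ^ k \<and> 1 \<le> D \<and> D < real X powr (1/2) \<and>
          a\<^sub>0 < b \<and>
          r \<in> missing_digit b a\<^sub>0 \<and> r < b \<and> coprime r b \<and>
          coprime (int r - int s) (int b) \<and>
          (\<forall>n. f n \<noteq> 0 \<longrightarrow> coprime n b) \<and>
          norm (f 1) \<le> K\<^sub>f \<and> (\<forall>n\<ge>2. norm (f n) \<le> K\<^sub>f * ln (real n)) \<and>
          (\<forall>d. \<sigma> d \<noteq> 0 \<longrightarrow> 1 \<le> d \<and> real d \<le> D) \<and>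
          (\<forall>d. norm (\<sigma> d) \<le> real (divisor_fun d)) \<and>
          (\<forall>d. \<sigma> d \<noteq> 0 \<longrightarrow> coprime (c d) d) \<and>
          mean_value_hyp X f lam K\<^sub>l K\<^sub>a \<and>
          level_of_distribution_hyp b X D f lam K\<^sub>b \<and>
          exponential_sum_hyp b X D f \<sigma> c \<omega> C' K\<^sub>c \<longrightarrow>
          norm (\<Sum>d\<in>moduli b D. \<sigma> d *
                  ((\<Sum>n | n < X \<and> [n = c d] (mod d).
                      f n * indicator (missing_digit_class b a\<^sub>0 r) (n + s))
                   - lam d / of_nat (totient d) * (of_nat b / of_nat (totient b)) *
                     (\<Sum>n<X. indicator (missing_digit_class b a\<^sub>0 r) n)))
            \<le> K * (real X powr zeta_exp b / ln (real X) powr A))"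
proof (rule exI[of _ 10], intro allI impI, elim conjE, goal_cases)
  \<comment> \<open>The threshold 10 is the least base above the constant 9 that the Dirichlet
    approximation produces.\<close>
  case (1 b Cb \<omega> C' Kf Kl Ka Kb Kc s A)
  then obtain K where K: "\<And>k X D a0 r f \<sigma> lam c.
    missing_digit_setting b k a0 r s X D Kf Kl f \<sigma> lam c \<Longrightarrow>
    level_of_distribution_hyp b X D f lam Kb \<Longrightarrow> exponential_sum_hyp b X D f \<sigma> c \<omega> C' Kc \<Longrightarrow>
    norm (missing_digit_setting.discrepancy b a0 r s X D f \<sigma> lam c)
      \<le> K * (real X powr zeta_exp b / ln (real X) powr A)"
    using discrepancy_uniform_bound by blast
  note b = 1(1)
  show ?case
  proof (rule exI[of _ K], intro allI impI, elim conjE, goal_cases)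
    case (1 k X D a0 r f \<sigma> c lam)
    have setting: "missing_digit_setting b k a0 r s X D Kf Kl f \<sigma> lam c"
    proof
      fix d :: nat assume "1 \<le> d" "d < X"
      then show "norm (lam d) \<le> Kl * ln (real X)"
        using \<open>mean_value_hyp X f lam Kl Ka\<close> unfolding mean_value_hyp_def by blast
    qed (use b 1 in simp_all)
    show ?case
      using K[OF setting] 1 unfolding missing_digit_setting.discrepancy_def[OF setting] by blast
  qed
qed

end
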